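(* Let $\alpha$ be an irrational number of bounded type, and let $\beta=2\alpha-1=[2m_0;2m_1,2m_2,\ldots]$ be the even continued fraction expansion of $\beta$. There are constants $A_n=O(\log n)$, of the form $$A_n=\frac14\sum_{j=1}^{\nu_n}\bigl[\operatorname{sgn}(m_{2j})-\operatorname{sgn}(m_{2j-1})\bigr]$$ with $\nu_n$ a non-decreasing sequence of non-negative integers with bounded jumps and $\nu_n\asymp\log n$, and constants $B_n>0$ with $B_n\asymp\sqrt{\log n}$, such that the following holds. If $\xi_n\in\tfrac12\mathbb Z$, $t\in\mathbb R$ and $\frac{\xi_n-A_n}{B_n}\xrightarrow[n\to\infty]{}t$, then $$\#\{1\le N\le n:D_N(\alpha)=\xi_n\}=[1+o(1)]\,\frac{n\,e^{-t^2/2}}{\sqrt{8\pi B_n^2}}\quad\text{as }n\to\infty .$$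
   Context: $\{x\}\in[0,1)$ denotes the fractional part of $x$. For irrational $\alpha$, $D_N(\alpha):=\#\{0\le j\le N-1:\{j\alpha\}\in[0,\tfrac12)\}-\tfrac12N\in\tfrac12\mathbb Z$. An irrational number is of bounded type if the partial quotients of its regular continued fraction expansion are bounded. Every irrational $\beta$ has a unique even continued fraction expansion $\beta=[2m_0;2m_1,2m_2,\ldots]:=\lim_n\bigl(2m_0+\cfrac{1}{2m_1+\cfrac1{\cdots+\cfrac1{2m_n}}}\bigr)$ with $m_0\in\mathbb Z$ and $m_i\in\mathbb Z\setminus\{0\}$ for $i\ge1$. $a_n\asymp b_n$ means that there are $C,N>1$ such that $C^{-1}\le a_n/b_n\le C$ for all $n>N$. *)

theory Defs
  imports Complex_Main "HOL-Library.Landau_Symbols"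
begin

definition discrepancy :: "nat \<Rightarrow> real \<Rightarrow> real"  where
  "discrepancy N \<alpha> =
     real (card {j. j < N \<and> frac (real j * \<alpha>) \<in> {0..<1/2}}) - real N / 2"

text \<open>The complete quotients and partial quotients of the regular continued fraction expansion;
  they are meaningful for irrational arguments only, where no complete quotient is an integer.\<close>

primrec complete_quotient :: "real \<Rightarrow> nat \<Rightarrow> real" where
  "complete_quotient x 0 = x"
| "complete_quotient x (Suc k) = 1 / frac (complete_quotient x k)"

definition partial_quotient :: "real \<Rightarrow> nat \<Rightarrow> int" where
  "partial_quotient x k = \<lfloor>complete_quotient x k\<rfloor>"

definition bounded_type :: "real \<Rightarrow> bool" where
  "bounded_type x \<longleftrightarrow> x \<notin> \<rat> \<and> (\<exists>M. \<forall>k. \<bar>partial_quotient x k\<bar> \<le> M)"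

fun finite_cfrac :: "(nat \<Rightarrow> real) \<Rightarrow> nat \<Rightarrow> real" where
  "finite_cfrac a 0 = a 0"
| "finite_cfrac a (Suc n) = a 0 + 1 / finite_cfrac (\<lambda>i. a (Suc i)) n"

text \<open>\<open>is_even_cfrac m \<beta>\<close> says that \<open>\<beta> = [2 m\<^sub>0; 2 m\<^sub>1, 2 m\<^sub>2, \<dots>]\<close>. Since the digits
  \<open>2 m\<^sub>i\<close> with \<open>i \<ge> 1\<close> have modulus at least 2, the denominators of the finite fractions have
  modulus greater than 1, so that no division by zero occurs.\<close>

definition is_even_cfrac :: "(nat \<Rightarrow> int) \<Rightarrow> real \<Rightarrow> bool" where
  "is_even_cfrac m \<beta> \<longleftrightarrow>
     (\<forall>i\<ge>1. m i \<noteq> 0) \<and>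
     (\<lambda>n. finite_cfrac (\<lambda>i. 2 * real_of_int (m i)) n) \<longlonglongrightarrow> \<beta>"

definition same_order :: "(nat \<Rightarrow> real) \<Rightarrow> (nat \<Rightarrow> real) \<Rightarrow> bool" where
  "same_order a b \<longleftrightarrow>
     (\<exists>C>1. \<exists>N>1. \<forall>n>N. inverse C \<le> a n / b n \<and> a n / b n \<le> C)"

end

theory Submission
  imports Defs "HOL-Complex_Analysis.Complex_Analysis" "HOL-Probability.Probability" "HOL-Real_Asymp.Real_Asymp"
begin

text \<open>Up to normalization the discrepancy is the sum of the signs \<open>(- 1) ^ (j + \<lfloor>j x\<rfloor>)\<close>, the checkerboard
  colours met by the line of slope \<open>x\<close> at the vertical grid lines. Since colours alternate along the line, the
  colours met at the vertical and at the horizontal grid lines cancel up to one parity bit. This replaces \<open>x\<close> by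
  \<open>1 / x\<close>, hence by its class modulo \<open>2\<close>, and \<open>N\<close> by \<open>\<lfloor>N x\<rfloor>\<close>. Iterating along the even continued
  fraction writes the discrepancy as a signed sum of about \<open>log N\<close> parity bits. Read from the top, the bits form
  an inhomogeneous Markov chain on four states. Flipping all bits is a symmetry of this chain, which accounts for
  the centring \<open>A\<close>.

  For the chain, a Doeblin condition keeps the moment generating functions away from zero on a complex disc of fixed
  radius, so that their logarithms are holomorphic of linear size; Cauchy's estimates give the Gaussian behaviour
  near the origin. Two paths that differ in exactly one bit give exponential decay of the characteristic functions
  up to frequency \<open>\<pi>\<close>, and thereby also the linear growth of the variance. Fourier inversion then yields the local
  limit theorem for a full subtree, and an initial segment is up to a small proportion a union of boundedly many full
  subtrees of comparable size.\<close>

text \<open>All estimates must be uniform in the level. The obstacle is the parabolic fixed point 1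
  of the step \<open>1 / y = 2 - y'\<close>: near it a last child has a single child, again a last
  one, and the chain hardly mixes. Bounded type enters through
  \<open>\<delta> \<le> \<bar>x k\<bar> \<le> 1 - \<delta>\<close>, which limits both the digits and
  the length of a stay near 1. Transition probabilities are ratios of subtree sizes, so the chain is
  a uniformly chosen leaf seen from the top, and statements on probabilities are statements on
  counts. Opposite states have opposite means by the flip symmetry, while mixing makes all means
  agree up to O(1); hence bits centred at 1/2 have no drift. The node 0 is its own parent and
  carries no regular subtree; the points below it are bounded by a separate induction against
  geometrically growing subtree sizes. The level at which an initial segment is cut into subtrees
  depends on the precision wanted, while \<open>\<nu>\<close> may not; the two differ by a bounded
  number of levels, which is invisible on the scale of the standard deviation.\<close>

lemma Cauchy_inequality_ball:
  assumes hol: "f holomorphic_on ball (0::complex) r" and r: "0 < r"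
    and bd: "\<And>z. z \<in> ball 0 r \<Longrightarrow> norm (f z) \<le> M"
  shows "norm ((deriv ^^ n) f 0 / fact n) \<le> M / r ^ n"
proof -
  \<comment> \<open>Cauchy's inequality on a disc needs continuity up to the bounding circle, so it
    is applied with radii \<open>t < r\<close>, and \<open>t\<close> tends to \<open>r\<close> at
    the end.\<close>
  have *: "norm ((deriv ^^ n) f 0 / fact n) \<le> M / t ^ n" if t: "0 < t" "t < r" for t
  proof -
    have "norm ((deriv ^^ n) f 0) \<le> fact n * M / t ^ n"
    proof (rule Cauchy_inequality)
      show "f holomorphic_on ball 0 t"
        using hol t by (auto intro: holomorphic_on_subset)
      show "continuous_on (cball 0 t) f"
        using hol t by (auto intro!: holomorphic_on_imp_continuous_on intro: holomorphic_on_subset)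
    qed (use t bd in auto)
    then show ?thesis by (simp add: norm_divide field_simps)
  qed
  have "((\<lambda>t. M / t ^ n) \<longlongrightarrow> M / r ^ n) (at_left r)"
    using r by (intro tendsto_intros) auto
  moreover have "eventually (\<lambda>t. norm ((deriv ^^ n) f 0 / fact n) \<le> M / t ^ n) (at_left r)"
    using r by (auto simp: eventually_at_left intro!: exI[of _ 0] *)
  ultimately show ?thesis
    by (intro tendsto_lowerbound) auto
qed

text \<open>The Cauchy bounds on the coefficients make the tail from degree 3 on a geometric series
  of ratio \<open>norm z / r \<le> 1/2\<close>, whence the factor 2.\<close>

lemma holomorphic_taylor_order_2:
  assumes hol: "f holomorphic_on ball (0::complex) r" and r: "0 < r"
    and bd: "\<And>z. z \<in> ball 0 r \<Longrightarrow> norm (f z) \<le> M"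
    and z: "norm z \<le> r / 2"
  shows "norm (f z - (f 0 + deriv f 0 * z + deriv (deriv f) 0 / 2 * z\<^sup>2)) \<le> 2 * M / r ^ 3 * norm z ^ 3"
proof -
  define a where "a n = (deriv ^^ n) f 0 / fact n" for n
  have zr: "z \<in> ball 0 r" using z r by auto
  have s: "(\<lambda>n. a n * z ^ n) sums f z"
    using holomorphic_power_series[OF hol zr] by (simp add: a_def)
  have s3: "(\<lambda>n. a (n + 3) * z ^ (n + 3)) sums (f z - (\<Sum>n<3. a n * z ^ n))"
    using sums_split_initial_segment[OF s, of 3] by simp
  have M: "M \<ge> 0" using bd[of 0] r norm_ge_zero order_trans by (metis centre_in_ball)
  have t: "norm (a (n + 3) * z ^ (n + 3)) \<le> M / r ^ 3 * norm z ^ 3 * (1/2) ^ n" for n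
  proof -
    have "norm (a (n + 3) * z ^ (n + 3)) \<le> M / r ^ (n + 3) * norm z ^ (n + 3)"
      unfolding norm_mult norm_power a_def
      by (intro mult_right_mono Cauchy_inequality_ball[OF hol r bd]) auto
    also have "\<dots> = M / r ^ 3 * norm z ^ 3 * (norm z / r) ^ n"
      by (simp add: power_add power_divide field_simps)
    also have "\<dots> \<le> M / r ^ 3 * norm z ^ 3 * (1/2) ^ n"
      using M r z by (intro mult_left_mono power_mono) (auto simp: field_simps)
    finally show ?thesis .
  qed
  have g: "(\<lambda>n. M / r ^ 3 * norm z ^ 3 * (1/2) ^ n) sums (M / r ^ 3 * norm z ^ 3 * 2)"
    using geometric_sums[of "1/2::real"] by (intro sums_mult) simp
  have "norm (\<Sum>n. a (n + 3) * z ^ (n + 3)) \<le> (\<Sum>n. M / r ^ 3 * norm z ^ 3 * (1/2) ^ n)"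
    using t g by (intro norm_suminf_le) (auto simp: sums_iff)
  then have "norm (f z - (\<Sum>n<3. a n * z ^ n)) \<le> M / r ^ 3 * norm z ^ 3 * 2"
    using s3 g by (simp add: sums_iff)
  moreover have "(\<Sum>n<3. a n * z ^ n) = f 0 + deriv f 0 * z + deriv (deriv f) 0 / 2 * z\<^sup>2"
    by (simp add: a_def eval_nat_numeral)
  ultimately show ?thesis by (simp add: algebra_simps)
qed

text \<open>Difference quotients with real increments are real, and the real line is closed. This
  justifies defining the cumulants below as real parts.\<close>

lemma deriv_in_Reals:
  fixes f :: "complex \<Rightarrow> complex"
  assumes hol: "f holomorphic_on ball 0 r" and x: "\<bar>x\<bar> < r"
    and re: "\<And>y. \<bar>y\<bar> < r \<Longrightarrow> f (of_real y) \<in> \<real>"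
  shows "deriv f (of_real x) \<in> \<real>"
proof -
  have "(f has_field_derivative deriv f (of_real x)) (at (of_real x))"
    by (rule holomorphic_derivI[OF hol]) (use x in auto)
  then have l: "((\<lambda>h. (f (of_real x + h) - f (of_real x)) / h) \<longlongrightarrow> deriv f (of_real x)) (at 0)"
    by (simp add: DERIV_def)
  have "filterlim (of_real :: real \<Rightarrow> complex) (at 0) (at_right 0)"
    by (auto simp: filterlim_at eventually_at_filter intro!: tendsto_eq_intros)
  then have "((\<lambda>h. (f (of_real x + of_real h) - f (of_real x)) / of_real h) \<longlongrightarrow> deriv f (of_real x)) (at_right 0)"
    by (rule filterlim_compose[OF l])
  moreover have "eventually (\<lambda>h. (f (of_real x + of_real h) - f (of_real x)) / of_real h \<in> \<real>) (at_right 0)"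
  proof -
    have "eventually (\<lambda>h. h < r - \<bar>x\<bar> \<and> h > 0) (at_right 0)"
      using x by (auto simp: eventually_at_right_field intro!: exI[of _ "r - \<bar>x\<bar>"])
    then show ?thesis
    proof eventually_elim
      case (elim h)
      then have "\<bar>x + h\<bar> < r" by auto
      from re[OF this] re[OF x] show ?case by auto
    qed
  qed
  ultimately show ?thesis
    by (intro Lim_in_closed_set[OF closed_complex_Reals]) auto
qed

section \<open>Additive functionals of inhomogeneous Markov chains\<close>

text \<open>Time runs downwards: \<open>p i\<close> leads from level \<open>i + 1\<close> to level
  \<open>i\<close>, so \<open>k\<close> steps lead from level \<open>i + k\<close> to level
  \<open>i\<close> and the kernel of the highest level acts first.\<close>

primrec kernel_power :: "(nat \<Rightarrow> 's \<Rightarrow> 's \<Rightarrow> real) \<Rightarrow> nat \<Rightarrow> nat \<Rightarrow> 's::finite \<Rightarrow> 's \<Rightarrow> real" where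
  "kernel_power p i 0 = (\<lambda>s t. of_bool (s = t))"
| "kernel_power p i (Suc k) = (\<lambda>s t. \<Sum>r\<in>UNIV. p (i + k) s r * kernel_power p i k r t)"

text \<open>The tilted transfer operator of the spectral approach to limit theorems; the functional
  is read at the state that is entered.\<close>

definition twist :: "(nat \<Rightarrow> 's \<Rightarrow> 's \<Rightarrow> real) \<Rightarrow> (nat \<Rightarrow> 's \<Rightarrow> real) \<Rightarrow> nat \<Rightarrow> complex \<Rightarrow> ('s::finite \<Rightarrow> complex) \<Rightarrow> 's \<Rightarrow> complex"
  where "twist p b i z \<zeta> s = (\<Sum>t\<in>UNIV. of_real (p i s t) * exp (z * of_real (b i t)) * \<zeta> t)"

text \<open>\<open>gain\<close> asks for a loss of modulus at the single state \<open>s0\<close>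
  over two steps; \<open>minorization\<close> (Doeblin) makes every state see \<open>s0\<close> and
  so spreads this loss. The involution \<open>flip\<close> reverses the functional and rules out a
  drift.\<close>

locale additive_chain =
  fixes p :: "nat \<Rightarrow> 's::finite \<Rightarrow> 's \<Rightarrow> real" and b :: "nat \<Rightarrow> 's \<Rightarrow> real"
    and flip :: "'s \<Rightarrow> 's" and g :: nat and \<gamma> c0 :: real and s0 :: 's
  assumes p_nonneg: "0 \<le> p i s t" and p_sum: "(\<Sum>t\<in>UNIV. p i s t) = 1"
    and b_le: "\<bar>b i s\<bar> \<le> 1"
    and flip_flip: "flip (flip s) = s"
    and p_flip: "p i (flip s) (flip t) = p i s t" and b_flip: "b i (flip s) = - b i s"
    and minorization: "\<gamma> \<le> kernel_power p i g s t" and \<gamma>_pos: "0 < \<gamma>"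
    and g_pos: "0 < g" and c0_pos: "0 < c0"
    and gain: "\<lbrakk>\<bar>\<theta>\<bar> \<le> pi; \<And>s. norm (\<zeta> s) \<le> N\<rbrakk> \<Longrightarrow>
      norm (twist p b (Suc i) (\<i> * of_real \<theta>) (twist p b i (\<i> * of_real \<theta>) \<zeta>) s0) \<le> (1 - c0 * \<theta>\<^sup>2) * N"
begin

abbreviation "T \<equiv> twist p b"
abbreviation "q \<equiv> kernel_power p"

primrec Tk :: "nat \<Rightarrow> nat \<Rightarrow> complex \<Rightarrow> ('s \<Rightarrow> complex) \<Rightarrow> 's \<Rightarrow> complex" where
  "Tk i 0 z \<zeta> = \<zeta>"
| "Tk i (Suc k) z \<zeta> = T (i + k) z (Tk i k z \<zeta>)"

text \<open>The expectation of \<open>exp (z * S)\<close>, where \<open>S\<close> sums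
  \<open>b\<close> over the \<open>i\<close> levels below a given state of level
  \<open>i\<close>.\<close>

primrec mgf :: "nat \<Rightarrow> complex \<Rightarrow> 's \<Rightarrow> complex" where
  "mgf 0 z = (\<lambda>s. 1)"
| "mgf (Suc i) z = T i z (mgf i z)"

lemma mgf_add: "mgf (i + k) z = Tk i k z (mgf i z)"
  by (induction k) auto

lemma q_nonneg: "0 \<le> q i k s t"
  by (induction k arbitrary: s) (auto intro!: sum_nonneg mult_nonneg_nonneg p_nonneg)

lemma q_sum: "(\<Sum>t\<in>UNIV. q i k s t) = 1"
proof (induction k arbitrary: s)
  case (Suc k)
  have "(\<Sum>t\<in>UNIV. q i (Suc k) s t) = (\<Sum>r\<in>UNIV. p (i + k) s r * (\<Sum>t\<in>UNIV. q i k r t))"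
    by (simp add: sum_distrib_left) (rule sum.swap)
  then show ?case by (simp add: Suc p_sum)
qed simp

lemma Tk_0: "Tk i k 0 \<zeta> s = (\<Sum>t\<in>UNIV. of_real (q i k s t) * \<zeta> t)"
proof (induction k arbitrary: s)
  case (Suc k)
  have "Tk i (Suc k) 0 \<zeta> s = (\<Sum>r\<in>UNIV. \<Sum>t\<in>UNIV. of_real (p (i + k) s r * q i k r t) * \<zeta> t)"
    by (simp add: twist_def Suc sum_distrib_left mult_ac)
  also have "\<dots> = (\<Sum>t\<in>UNIV. of_real (q i (Suc k) s t) * \<zeta> t)"
    by (subst sum.swap) (simp add: sum_distrib_right)
  finally show ?case .
qed (simp add: of_bool_def if_distrib if_distribR cong: if_cong)

lemma norm_average:
  fixes x :: "'s \<Rightarrow> complex"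
  assumes "\<And>t. t \<in> A \<Longrightarrow> 0 \<le> w t" "\<And>t. t \<in> A \<Longrightarrow> norm (x t) \<le> N"
  shows "norm (\<Sum>t\<in>A. of_real (w t) * x t) \<le> (\<Sum>t\<in>A. w t) * (N::real)"
  unfolding sum_distrib_right
  by (intro order.trans[OF norm_sum] sum_mono) (auto simp: norm_mult assms intro!: mult_left_mono)

lemma norm_T_le:
  assumes "\<And>t. norm (exp (z * of_real (b i t))) \<le> K" "\<And>t. norm (\<zeta> t) \<le> N"
  shows "norm (T i z \<zeta> s) \<le> K * N"
proof -
  have "norm (T i z \<zeta> s) = norm (\<Sum>t\<in>UNIV. of_real (p i s t) * (exp (z * of_real (b i t)) * \<zeta> t))"
    by (simp add: twist_def mult_ac)
  also have "\<dots> \<le> (\<Sum>t\<in>UNIV. p i s t) * (K * N)"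
    by (intro norm_average) (auto simp: p_nonneg norm_mult simp del: norm_exp_eq_Re intro!: mult_mono assms order.trans[OF norm_ge_zero assms(1)])
  finally show ?thesis by (simp add: p_sum)
qed

lemma norm_Tk_le:
  assumes K: "\<And>i t. norm (exp (z * of_real (b i t))) \<le> K" and N: "\<And>t. norm (\<zeta> t) \<le> N"
  shows "norm (Tk i k z \<zeta> s) \<le> K ^ k * N"
proof (induction k arbitrary: s)
  case (Suc k)
  then show ?case using norm_T_le[OF K Suc] by (simp add: mult_ac)
qed (use N in auto)

lemma T_perturb:
  assumes \<kappa>: "\<And>(i::nat) t. norm (exp (z * of_real (b i t)) - 1) \<le> \<kappa>" and N: "\<And>t. norm (\<zeta> t) \<le> N"
  shows "norm (T i z \<zeta> s - T i 0 \<zeta> s) \<le> \<kappa> * N"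
proof -
  have "norm (T i z \<zeta> s - T i 0 \<zeta> s) = norm (\<Sum>t\<in>UNIV. of_real (p i s t) * ((exp (z * of_real (b i t)) - 1) * \<zeta> t))"
    by (simp add: twist_def sum_subtractf [symmetric] algebra_simps)
  also have "\<dots> \<le> (\<Sum>t\<in>UNIV. p i s t) * (\<kappa> * N)"
    by (intro norm_average) (auto simp: p_nonneg norm_mult intro!: mult_mono assms order.trans[OF norm_ge_zero \<kappa>])
  finally show ?thesis by (simp add: p_sum)
qed

text \<open>Each step adds an error \<open>\<kappa>\<close> times a vector that has grown by at most
  \<open>1 + \<kappa>\<close> per earlier step, and unperturbed steps do not enlarge earlier errors;
  the sum telescopes.\<close>

lemma Tk_perturb:
  assumes \<kappa>: "\<And>(i::nat) t. norm (exp (z * of_real (b i t)) - 1) \<le> \<kappa>" and N: "\<And>t. norm (\<zeta> t) \<le> N"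
  shows "norm (Tk i k z \<zeta> s - Tk i k 0 \<zeta> s) \<le> ((1 + \<kappa>) ^ k - 1) * N"
proof (induction k arbitrary: s)
  case (Suc k)
  have e: "norm (exp (z * of_real (b i t))) \<le> 1 + \<kappa>" for i t
    using \<kappa>[of i t] norm_triangle_sub[of "exp (z * of_real (b i t))" 1] by simp
  have 1: "norm (T (i + k) z (Tk i k z \<zeta>) s - T (i + k) 0 (Tk i k z \<zeta>) s) \<le> \<kappa> * ((1 + \<kappa>) ^ k * N)"
    by (intro T_perturb \<kappa> norm_Tk_le e N)
  have "T (i + k) 0 (Tk i k z \<zeta>) s - T (i + k) 0 (Tk i k 0 \<zeta>) s = T (i + k) 0 (\<lambda>s. Tk i k z \<zeta> s - Tk i k 0 \<zeta> s) s"
    by (simp add: twist_def sum_subtractf [symmetric] algebra_simps)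
  moreover have "norm (T (i + k) 0 (\<lambda>s. Tk i k z \<zeta> s - Tk i k 0 \<zeta> s) s) \<le> 1 * (((1 + \<kappa>) ^ k - 1) * N)"
    by (intro norm_T_le Suc) auto
  ultimately have "norm (T (i + k) z (Tk i k z \<zeta>) s - T (i + k) 0 (Tk i k 0 \<zeta>) s) \<le> \<kappa> * ((1 + \<kappa>) ^ k * N) + ((1 + \<kappa>) ^ k - 1) * N"
    using 1 by (intro norm_diff_triangle_le[OF 1]) simp
  then show ?case by (simp add: algebra_simps)
qed simp

text \<open>The weights are not normalized because the contraction below applies this to a kernel
  without its common part, of mass \<open>1 - \<gamma>\<close>.\<close>

lemma average_mem_disc:
  fixes x :: "'s \<Rightarrow> complex"
  assumes "\<And>t. 0 \<le> w t" "\<And>t. norm (x t - a) \<le> N"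
  shows "norm ((\<Sum>t\<in>UNIV. of_real (w t) * x t) - of_real (\<Sum>t\<in>UNIV. w t) * a) \<le> (\<Sum>t\<in>UNIV. w t) * (N::real)"
proof -
  have "(\<Sum>t\<in>UNIV. of_real (w t) * x t) - of_real (\<Sum>t\<in>UNIV. w t) * a = (\<Sum>t\<in>UNIV. of_real (w t) * (x t - a))"
    by (simp add: sum_distrib_right sum_subtractf right_diff_distrib)
  then show ?thesis using norm_average[of UNIV w "\<lambda>t. x t - a" N] assms by simp
qed

lemma \<gamma>_le_1: "\<gamma> \<le> 1"
proof -
  have "q 0 g undefined undefined \<le> (\<Sum>t\<in>UNIV. q 0 g undefined t)"
    by (rule member_le_sum) (auto simp: q_nonneg)
  with minorization[of 0 undefined undefined] show ?thesis by (simp add: q_sum)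
qed

text \<open>Doeblin's argument: the part \<open>\<gamma> / n\<close> common to all entries
  contributes the same from every initial state and cancels; what remains has mass
  \<open>1 - \<gamma>\<close>.\<close>

lemma Tk_0_contract:
  assumes D: "\<And>s t. norm (\<zeta> s - \<zeta> t) \<le> D"
  shows "norm (Tk i g 0 \<zeta> s - Tk i g 0 \<zeta> t) \<le> (1 - \<gamma>) * D"
proof -
  define n where "n = real CARD('s)"
  have n: "n \<ge> 1" by (simp add: n_def Suc_leI)
  define w where "w s t = q i g s t - \<gamma> / n" for s t
  have w0: "0 \<le> w s t" for s t
  proof -
    have "\<gamma> / n \<le> \<gamma> / 1" using n \<gamma>_pos by (intro divide_left_mono) auto
    with minorization[of i s t] show ?thesis by (simp add: w_def)
  qed
  have ws: "(\<Sum>t\<in>UNIV. w s t) = 1 - \<gamma>" for s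
    using n by (simp add: w_def sum_subtractf q_sum n_def)
  have dec: "Tk i g 0 \<zeta> s = (\<Sum>t\<in>UNIV. of_real (w s t) * \<zeta> t) + of_real (\<gamma> / n) * (\<Sum>t\<in>UNIV. \<zeta> t)" for s
    by (simp add: Tk_0 w_def sum_subtractf sum_distrib_left left_diff_distrib)
  define a where "a s = (\<Sum>t\<in>UNIV. of_real (w s t) * \<zeta> t)" for s
  have 1: "norm (of_real (1 - \<gamma>) * \<zeta> t - a s) \<le> (1 - \<gamma>) * D" for t s
    using average_mem_disc[of "w s" \<zeta> "\<zeta> t" D] w0 D unfolding ws a_def by (simp add: norm_minus_commute)
  have eq: "of_real (1 - \<gamma>) * a t = (\<Sum>u\<in>UNIV. of_real (w t u) * (of_real (1 - \<gamma>) * \<zeta> u))" for t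
    by (simp add: a_def sum_distrib_left mult_ac)
  have "norm (of_real (1 - \<gamma>) * a t - of_real (1 - \<gamma>) * a s) \<le> (1 - \<gamma>) * ((1 - \<gamma>) * D)"
    using average_mem_disc[of "w t" "\<lambda>u. of_real (1 - \<gamma>) * \<zeta> u" "a s"] w0 1 unfolding ws eq by blast
  then have "(1 - \<gamma>) * norm (a t - a s) \<le> (1 - \<gamma>) * ((1 - \<gamma>) * D)"
    using \<gamma>_le_1 by (simp flip: right_diff_distrib of_real_diff add: norm_mult)
  \<comment> \<open>Here one cannot divide by \<open>1 - \<gamma>\<close>, but nonnegative weights
    of total mass 0 vanish.\<close>
  moreover have "a t - a s = 0" if "\<gamma> = 1"
  proof -
    have "w s t = 0" for s t using sum_nonneg_eq_0_iff[of UNIV "w s"] ws[of s] w0 that by auto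
    then show ?thesis by (simp add: a_def)
  qed
  ultimately have "norm (a t - a s) \<le> (1 - \<gamma>) * D"
    using \<gamma>_le_1 by (cases "\<gamma> = 1") auto
  then show ?thesis unfolding dec a_def[symmetric] by (simp add: norm_minus_commute)
qed

lemma norm_exp_perturb:
  assumes "\<kappa> > 0"
  shows "\<exists>r>0. \<forall>(z::complex) i t. norm z < r \<longrightarrow> norm (exp (z * of_real (b i t)) - 1) \<le> \<kappa>"
proof -
  have "isCont (exp :: complex \<Rightarrow> complex) 0" by simp
  then obtain d where d: "d > 0" "\<And>w::complex. norm w < d \<Longrightarrow> norm (exp w - 1) < \<kappa>"
    using assms unfolding continuous_at_eps_delta by (auto simp: dist_norm)
  have "norm (exp (z * of_real (b i t)) - 1) \<le> \<kappa>" if "norm z < d" for z :: complex and i t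
  proof -
    have "norm (z * of_real (b i t)) \<le> norm z * 1"
      unfolding norm_mult by (intro mult_left_mono) (use b_le in auto)
    with that d(2)[of "z * of_real (b i t)"] show ?thesis by auto
  qed
  with d(1) show ?thesis by blast
qed

text \<open>Near \<open>z = 0\<close> the moment generating functions stay in a cone of nearly constant vectors:
  the Doeblin contraction over \<open>g\<close> steps beats the perturbation of the kernels.\<close>

lemma mgf_cone:
  "\<exists>r>0. \<forall>i z. norm z < r \<longrightarrow> (\<forall>s t. mgf i z s \<noteq> 0 \<and> norm (mgf i z s - mgf i z t) \<le> 1/3 * norm (mgf i z t)
     \<and> norm (mgf (Suc i) z s - mgf i z t) \<le> 1/3 * norm (mgf i z t))"
proof -
  \<comment> \<open>\<open>\<rho>\<close> is the aperture of the cone and \<open>\<eta>\<close> the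
    perturbation allowed over \<open>g\<close> levels. The contraction gains about
    \<open>\<gamma> * \<rho>\<close>; the losses are about
    \<open>2 * \<rho>\<^sup>2 + 2 * \<eta>\<close>, half of that with these choices.\<close>
  define \<rho> where "\<rho> = \<gamma> / 8"
  define \<eta> where "\<eta> = \<gamma> * \<rho> / 8"
  have \<rho>: "0 < \<rho>" "\<rho> \<le> 1/8" and \<eta>: "0 < \<eta>" "\<eta> \<le> \<rho> / 8"
    using \<gamma>_pos \<gamma>_le_1 by (auto simp: \<rho>_def \<eta>_def field_simps)
  have key: "(1 - \<gamma>) * (\<rho> * (1 + \<rho>)) + 2 * \<eta> * (1 + \<rho>) \<le> \<rho> * (1 - \<rho> - \<eta> * (1 + \<rho>))"
  proof -
    have \<gamma>8: "\<gamma> = 8 * \<rho>" by (simp add: \<rho>_def)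
    have e: "\<eta> = \<rho>\<^sup>2" by (simp add: \<eta>_def \<gamma>8 power2_eq_square)
    have "(1 - 8 * \<rho>) * (1 + \<rho>) + 2 * \<rho> * (1 + \<rho>) \<le> 1 - \<rho> - \<rho>\<^sup>2 * (1 + \<rho>)"
    proof -
      have "\<rho>\<^sup>2 \<le> \<rho> * (1/8)" unfolding power2_eq_square using \<rho> by (intro mult_left_mono) auto
      moreover have "\<rho>\<^sup>2 * \<rho> \<le> \<rho>\<^sup>2 * 1" "\<rho>\<^sup>2 \<ge> 0" using \<rho> by (auto intro!: mult_left_mono)
      moreover have "(1 - 8 * \<rho>) * (1 + \<rho>) + 2 * \<rho> * (1 + \<rho>) = 1 - 5 * \<rho> - 6 * \<rho>\<^sup>2"
        by (simp add: algebra_simps power2_eq_square)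
      ultimately show ?thesis using \<rho> by (simp only: distrib_left)
    qed
    from mult_left_mono[OF this, of \<rho>] \<rho> show ?thesis by (simp add: e \<gamma>8 algebra_simps power2_eq_square)
  qed
  have "((\<lambda>\<kappa>::real. (1 + \<kappa>) ^ g - 1) \<longlongrightarrow> (1 + 0) ^ g - 1) (at_right 0)"
    by (intro tendsto_intros)
  then have "eventually (\<lambda>\<kappa>. (1 + \<kappa>) ^ g - 1 < \<eta>) (at_right (0::real))"
    by (rule order_tendstoD) (use \<eta> in auto)
  moreover have "eventually (\<lambda>\<kappa>. \<kappa> > 0 \<and> \<kappa> < 1/8) (at_right (0::real))"
    by (auto simp: eventually_at_right_field intro!: exI[of _ "1/8"])
  ultimately have "eventually (\<lambda>\<kappa>. (1 + \<kappa>) ^ g - 1 < \<eta> \<and> \<kappa> > 0 \<and> \<kappa> < 1/8) (at_right (0::real))"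
    by eventually_elim auto
  then obtain \<kappa> :: real where \<kappa>: "(1 + \<kappa>) ^ g - 1 < \<eta>" "\<kappa> > 0" "\<kappa> < 1/8"
    using eventually_happens'[OF trivial_limit_at_right_real] by blast
  obtain r where r: "r > 0" "\<And>(z::complex) i t. norm z < r \<Longrightarrow> norm (exp (z * of_real (b i t)) - 1) \<le> \<kappa>"
    using norm_exp_perturb[OF \<kappa>(2)] by blast
  have cone: "mgf i z s \<noteq> 0 \<and> norm (mgf i z s - mgf i z t) \<le> \<rho> * norm (mgf i z t)" if z: "norm z < r" for i z s t
  proof (induction i arbitrary: s t rule: less_induct)
    case (less i)
    note pert = Tk_perturb[OF r(2)[OF z]]
    show ?case
    \<comment> \<open>The contraction works \<open>g\<close> levels at a time. Below level
      \<open>g\<close> the function is still within \<open>\<eta>\<close> of the constant 1, which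
      suffices by itself.\<close>
    proof (cases "i < g")
      case True
      have 1: "norm (mgf i z s - 1) \<le> \<eta>" for s
      proof -
        have "norm (Tk 0 i z (\<lambda>_. 1) s - Tk 0 i 0 (\<lambda>_. 1) s) \<le> ((1 + \<kappa>) ^ i - 1) * 1"
          by (rule pert) auto
        also have "(1 + \<kappa>) ^ i \<le> (1 + \<kappa>) ^ g" using True \<kappa> by (intro power_increasing) auto
        finally have "norm (Tk 0 i z (\<lambda>_. 1) s - Tk 0 i 0 (\<lambda>_. 1) s) \<le> \<eta>" using \<kappa> by simp
        moreover have "Tk 0 i 0 (\<lambda>_. 1) s = of_real (\<Sum>t\<in>UNIV. q 0 i s t)" by (simp add: Tk_0)
        ultimately show ?thesis using mgf_add[of 0 i z] by (simp add: q_sum)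
      qed
      have 2: "norm (mgf i z s) \<ge> 1 - \<eta>" for s
        using 1[of s] norm_triangle_ineq2[of 1 "1 - mgf i z s"] by (simp add: norm_minus_commute)
      have "norm (mgf i z s - mgf i z t) \<le> \<eta> + \<eta>"
        using norm_triangle_ineq4[of "mgf i z s - 1" "mgf i z t - 1"] 1[of s] 1[of t] by simp
      also have "\<dots> \<le> \<rho> * (1 - \<eta>)"
      proof -
        have "\<rho> * \<eta> \<le> \<rho> * (1/8)" using \<rho> \<eta> by (intro mult_left_mono) auto
        then show ?thesis unfolding right_diff_distrib using \<eta> \<rho> by linarith
      qed
      also have "\<dots> \<le> \<rho> * norm (mgf i z t)" using 2[of t] \<rho> by (intro mult_left_mono) auto
      moreover have "mgf i z s \<noteq> 0" using 2[of s] \<eta> \<rho> by auto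
      ultimately show ?thesis by simp
    next
      case False
      show ?thesis
      proof -
        define j where "j = i - g"
        have j: "i = j + g" "j < i" using False g_pos by (auto simp: j_def)
        define N where "N = norm (mgf j z s)"
        note IH = less[OF j(2)]
        have N: "N > 0" using IH by (simp add: N_def)
        have dj: "norm (mgf j z t - mgf j z s) \<le> \<rho> * N" for t using IH by (simp add: N_def)
        have nj: "norm (mgf j z t) \<le> (1 + \<rho>) * N" for t
          using dj[of t] norm_triangle_sub[of "mgf j z t" "mgf j z s"] by (simp add: N_def algebra_simps)
        have dd: "norm (mgf j z u - mgf j z t) \<le> \<rho> * (1 + \<rho>) * N" for u t
        proof -
          have "norm (mgf j z u - mgf j z t) \<le> \<rho> * norm (mgf j z t)" using IH by blast
          also have "\<dots> \<le> \<rho> * ((1 + \<rho>) * N)" using nj \<rho> by (intro mult_left_mono) auto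
          finally show ?thesis by simp
        qed
        have pb: "norm (mgf i z t - Tk j g 0 (mgf j z) t) \<le> \<eta> * ((1 + \<rho>) * N)" for t
        proof -
          have "norm (Tk j g z (mgf j z) t - Tk j g 0 (mgf j z) t) \<le> ((1 + \<kappa>) ^ g - 1) * ((1 + \<rho>) * N)"
            by (rule pert) (rule nj)
          also have "\<dots> \<le> \<eta> * ((1 + \<rho>) * N)" using \<kappa> \<rho> N by (intro mult_right_mono) auto
          finally show ?thesis by (simp add: mgf_add j(1))
        qed
        have "norm (Tk j g 0 (mgf j z) t - mgf j z s) \<le> \<rho> * N" for t
          using average_mem_disc[of "q j g t" "mgf j z" "mgf j z s" "\<rho> * N"] q_nonneg dj
          by (simp add: Tk_0 q_sum)
        then have "norm (mgf i z t - mgf j z s) \<le> \<eta> * ((1 + \<rho>) * N) + \<rho> * N" for t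
          by (rule norm_diff_triangle_le[OF pb])
        moreover have "N - norm (mgf i z t - mgf j z s) \<le> norm (mgf i z t)" for t
          using norm_triangle_ineq2[of "mgf j z s" "mgf i z t"] by (simp add: N_def norm_minus_commute)
        moreover have "N * (1 - \<rho> - \<eta> * (1 + \<rho>)) = N - (\<eta> * ((1 + \<rho>) * N) + \<rho> * N)"
          by (simp add: algebra_simps)
        ultimately have low: "norm (mgf i z t) \<ge> N * (1 - \<rho> - \<eta> * (1 + \<rho>))" for t
          by (metis diff_left_mono order.trans)
        have A: "norm (Tk j g 0 (mgf j z) s - Tk j g 0 (mgf j z) t) \<le> (1 - \<gamma>) * (\<rho> * (1 + \<rho>) * N)"
          by (rule Tk_0_contract) (rule dd)
        have B: "norm (Tk j g 0 (mgf j z) t - mgf i z t) \<le> \<eta> * ((1 + \<rho>) * N)"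
          using pb[of t] by (simp add: norm_minus_commute)
        have "norm (mgf i z s - mgf i z t) \<le> \<eta> * ((1 + \<rho>) * N) + ((1 - \<gamma>) * (\<rho> * (1 + \<rho>) * N) + \<eta> * ((1 + \<rho>) * N))"
          by (rule norm_diff_triangle_le[OF pb norm_diff_triangle_le[OF A B]])
        also have "\<dots> = ((1 - \<gamma>) * (\<rho> * (1 + \<rho>)) + 2 * \<eta> * (1 + \<rho>)) * N"
          by (simp add: algebra_simps)
        also have "\<dots> \<le> (\<rho> * (1 - \<rho> - \<eta> * (1 + \<rho>))) * N" using key N by (intro mult_right_mono) auto
        also have "\<dots> \<le> \<rho> * norm (mgf i z t)" using low[of t] \<rho> by (simp add: mult_ac mult_left_mono)
        finally have d: "norm (mgf i z s - mgf i z t) \<le> \<rho> * norm (mgf i z t)" .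
        have "\<eta> * (1 + \<rho>) \<le> 1/64 * (9/8)" using \<eta> \<rho> by (intro mult_mono) auto
        then have "N * (1 - \<rho> - \<eta> * (1 + \<rho>)) > 0" using N \<rho> by (intro mult_pos_pos) auto
        with low[of s] have "mgf i z s \<noteq> 0" by auto
        with d show ?thesis by simp
      qed
    qed
  qed
  \<comment> \<open>Consecutive levels are compared too, since logarithms will be taken of ratios of
    consecutive levels.\<close>
  have "norm (mgf (Suc i) z s - mgf i z t) \<le> 1/3 * norm (mgf i z t)" if z: "norm z < r" for i z s t
  proof -
    define N where "N = norm (mgf i z t)"
    have nj: "norm (mgf i z u) \<le> (1 + \<rho>) * N" for u
      using cone[OF z, of i u t] norm_triangle_sub[of "mgf i z u" "mgf i z t"] by (simp add: N_def algebra_simps)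
    have 1: "norm (mgf (Suc i) z s - T i 0 (mgf i z) s) \<le> \<kappa> * ((1 + \<rho>) * N)"
      using T_perturb[OF r(2)[OF z] nj] by simp
    have 2: "norm (T i 0 (mgf i z) s - mgf i z t) \<le> \<rho> * N"
      using average_mem_disc[of "p i s" "mgf i z" "mgf i z t" "\<rho> * N"] p_nonneg cone[OF z, of i _ t]
      by (simp add: p_sum N_def twist_def)
    have "norm (mgf (Suc i) z s - mgf i z t) \<le> (\<kappa> * (1 + \<rho>) + \<rho>) * N"
      using 1 2 norm_triangle_ineq[of "mgf (Suc i) z s - T i 0 (mgf i z) s" "T i 0 (mgf i z) s - mgf i z t"]
      by (simp add: algebra_simps)
    also have "\<kappa> * (1 + \<rho>) \<le> 1/8 * (9/8)" using \<kappa> \<rho> by (intro mult_mono) auto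
    then have "(\<kappa> * (1 + \<rho>) + \<rho>) * N \<le> 1/3 * N"
      using \<rho> by (intro mult_right_mono) (auto simp: N_def)
    finally show ?thesis by (simp add: N_def)
  qed
  moreover have "norm (mgf i z s - mgf i z t) \<le> 1/3 * norm (mgf i z t)" if z: "norm z < r" for i z s t
  proof -
    have "norm (mgf i z s - mgf i z t) \<le> \<rho> * norm (mgf i z t)" using cone[OF z] by blast
    also have "\<dots> \<le> 1/3 * norm (mgf i z t)" using \<rho> by (intro mult_right_mono) auto
    finally show ?thesis .
  qed
  ultimately show ?thesis using r(1) cone by blast
qed

end

section \<open>Decay of the characteristic functions, cumulants and the central limit
  theorem\<close>

context additive_chain begin

lemma holomorphic_mgf: "(\<lambda>z. mgf i z s) holomorphic_on A"
proof (induction i arbitrary: s)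
  case (Suc i)
  then show ?case by (auto simp: twist_def intro!: holomorphic_intros)
qed auto

lemma mgf_real: "mgf i (of_real x) s \<in> \<real>"
  by (induction i arbitrary: s) (auto simp: twist_def exp_of_real simp flip: of_real_mult intro!: Reals_mult)

lemma mgf_at_0: "mgf i 0 s = 1"
proof (induction i arbitrary: s)
  case (Suc i)
  then show ?case using p_sum[of i s] by (simp add: twist_def flip: of_real_sum)
qed auto

text \<open>Reindexing the sums by the involution changes nothing but the sign of each
  \<open>b\<close>.\<close>

lemma mgf_flip: "mgf i z (flip s) = mgf i (- z) s"
proof (induction i arbitrary: s)
  case (Suc i)
  have bij: "bij_betw flip UNIV UNIV"
    by (rule bij_betwI[where g = flip]) (auto simp: flip_flip)
  have "mgf (Suc i) z (flip s) = (\<Sum>t\<in>UNIV. of_real (p i (flip s) (flip t)) * exp (z * of_real (b i (flip t))) * mgf i z (flip t))"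
    unfolding mgf.simps twist_def by (rule sum.reindex_bij_betw[OF bij, symmetric])
  then show ?case by (simp add: p_flip b_flip Suc twist_def)
qed auto

lemma norm_Tk_imaginary_le: "norm (Tk i k (\<i> * of_real \<theta>) \<zeta> s) \<le> (\<Sum>t\<in>UNIV. q i k s t * norm (\<zeta> t))"
proof (induction k arbitrary: s)
  case (Suc k)
  have "norm (Tk i (Suc k) (\<i> * of_real \<theta>) \<zeta> s) \<le> (\<Sum>r\<in>UNIV. p (i + k) s r * norm (Tk i k (\<i> * of_real \<theta>) \<zeta> r))"
    unfolding Tk.simps twist_def
    by (intro order.trans[OF norm_sum] sum_mono) (auto simp: norm_mult p_nonneg)
  also have "\<dots> \<le> (\<Sum>r\<in>UNIV. p (i + k) s r * (\<Sum>t\<in>UNIV. q i k r t * norm (\<zeta> t)))"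
    by (intro sum_mono mult_left_mono Suc p_nonneg)
  also have "\<dots> = (\<Sum>t\<in>UNIV. q i (Suc k) s t * norm (\<zeta> t))"
    by (simp add: sum_distrib_left sum_distrib_right mult_ac) (rule sum.swap)
  finally show ?case .
qed (simp add: of_bool_def if_distrib if_distribR cong: if_cong)

text \<open>The two lower levels give the gain at \<open>s0\<close> only; the \<open>g\<close>
  levels above them lead to \<open>s0\<close> with probability at least \<open>\<gamma>\<close>, so
  a share \<open>\<gamma>\<close> of the gain reaches every state.\<close>

lemma mgf_block_decay:
  assumes \<theta>: "\<bar>\<theta>\<bar> \<le> pi" and N: "\<And>s. norm (mgf i (\<i> * of_real \<theta>) s) \<le> N"
  shows "norm (mgf (i + (g + 2)) (\<i> * of_real \<theta>) s) \<le> (1 - \<gamma> * c0 * \<theta>\<^sup>2) * N"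
proof -
  let ?z = "\<i> * complex_of_real \<theta>"
  have N0: "N \<ge> 0" using N[of s] norm_ge_zero order_trans by blast
  have 2: "mgf (i + 2) ?z = T (Suc i) ?z (T i ?z (mgf i ?z))" by (simp add: numeral_2_eq_2)
  have g2: "norm (mgf (i + 2) ?z s0) \<le> (1 - c0 * \<theta>\<^sup>2) * N"
    unfolding 2 by (intro gain \<theta> N)
  have N2: "norm (mgf (i + 2) ?z t) \<le> N" for t
    unfolding mgf_add using norm_Tk_le[of ?z 1 "mgf i ?z" N i 2 t, OF _ N] by simp
  have "mgf (i + (g + 2)) ?z = Tk (i + 2) g ?z (mgf (i + 2) ?z)"
    using mgf_add[of "i + 2" g ?z] by (metis add.assoc add.commute)
  then have "norm (mgf (i + (g + 2)) ?z s) \<le> (\<Sum>t\<in>UNIV. q (i + 2) g s t * norm (mgf (i + 2) ?z t))"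
    using norm_Tk_imaginary_le by simp
  also have "\<dots> \<le> (\<Sum>t\<in>UNIV. q (i + 2) g s t * (N - (if t = s0 then c0 * \<theta>\<^sup>2 * N else 0)))"
    using g2 N2 by (intro sum_mono mult_left_mono q_nonneg) (auto simp: algebra_simps)
  also have "\<dots> = N - q (i + 2) g s s0 * (c0 * \<theta>\<^sup>2 * N)"
    by (simp add: right_diff_distrib sum_subtractf q_sum flip: sum_distrib_right)
       (simp add: if_distrib cong: if_cong)
  also have "\<dots> \<le> N - \<gamma> * (c0 * \<theta>\<^sup>2 * N)"
    using minorization[of "i + 2" s s0] c0_pos N0 by (intro diff_left_mono mult_right_mono) auto
  finally show ?thesis by (simp add: algebra_simps)
qed

lemma mgf_decay:
  "\<exists>C>0. \<exists>c>0. \<forall>J \<theta> s. \<bar>\<theta>\<bar> \<le> pi \<longrightarrow> norm (mgf J (\<i> * of_real \<theta>) s) \<le> C * exp (- (c * real J * \<theta>\<^sup>2))"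
proof (intro exI conjI allI impI)
  define a where "a = \<gamma> * c0"
  have a: "a > 0" using \<gamma>_pos c0_pos by (simp add: a_def)
  \<comment> \<open>The constant pays for the incomplete block of \<open>J mod (g + 2)\<close>
    levels: one block is worth at most \<open>exp (a * \<theta>\<^sup>2)\<close>.\<close>
  show "exp (a * pi\<^sup>2) > 0" "a / real (g + 2) > 0" using a by auto
  fix J \<theta> s assume \<theta>: "\<bar>\<theta>\<bar> \<le> pi"
  let ?z = "\<i> * complex_of_real \<theta>"
  \<comment> \<open>The block estimate at level 0 with \<open>N = 1\<close> bounds a norm by this
    quantity.\<close>
  have a1: "0 \<le> 1 - a * \<theta>\<^sup>2"
    using order.trans[OF norm_ge_zero mgf_block_decay[OF \<theta>, of 0 1 s]] unfolding a_def by simp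
  have 1: "norm (mgf (n * (g + 2)) ?z s) \<le> (1 - a * \<theta>\<^sup>2) ^ n" for n s
  proof (induction n arbitrary: s)
    case (Suc n)
    have "Suc n * (g + 2) = n * (g + 2) + (g + 2)" by simp
    then show ?case using mgf_block_decay[OF \<theta> Suc, of s] unfolding a_def
      by (simp only: power_Suc)
  qed auto
  define n where "n = J div (g + 2)"
  have J: "J = n * (g + 2) + J mod (g + 2)" unfolding n_def by (rule div_mult_mod_eq[symmetric])
  have "norm (mgf J ?z s) \<le> 1 ^ (J mod (g + 2)) * (1 - a * \<theta>\<^sup>2) ^ n"
    by (subst J, subst mgf_add, intro norm_Tk_le 1) auto
  also have "\<dots> \<le> exp (- (a * \<theta>\<^sup>2)) ^ n"
    using a1 exp_ge_add_one_self[of "- (a * \<theta>\<^sup>2)"] by (simp add: power_mono)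
  also have "\<dots> = exp (- (a * \<theta>\<^sup>2) * real n)" by (metis exp_of_nat_mult mult.commute)
  also have "\<dots> \<le> exp (a * pi\<^sup>2 - a / real (g + 2) * real J * \<theta>\<^sup>2)"
  proof -
    have "J mod (g + 2) \<le> g + 2" by (intro less_imp_le mod_less_divisor) simp
    then have "J \<le> n * (g + 2) + (g + 2)" using J by linarith
    then have "real J \<le> (real n + 1) * real (g + 2)"
      by (metis (mono_tags) add.commute distrib_right mult_1 of_nat_1 of_nat_add of_nat_le_iff of_nat_mult)
    then have "real J / real (g + 2) \<le> real n + 1" by (simp add: field_simps)
    then have "a * \<theta>\<^sup>2 * (real J / real (g + 2)) \<le> a * \<theta>\<^sup>2 * (real n + 1)"
      using a by (intro mult_left_mono) auto
    moreover have "a * \<theta>\<^sup>2 \<le> a * pi\<^sup>2"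
      using a \<theta> by (intro mult_left_mono) (auto simp: abs_le_square_iff[symmetric])
    ultimately show ?thesis by (simp add: algebra_simps)
  qed
  also have "\<dots> = exp (a * pi\<^sup>2) * exp (- (a / real (g + 2) * real J * \<theta>\<^sup>2))"
    by (simp flip: exp_add)
  finally show "norm (mgf J ?z s) \<le> exp (a * pi\<^sup>2) * exp (- (a / real (g + 2) * real J * \<theta>\<^sup>2))" .
qed

text \<open>A ratio within 1/3 of 1 stays in the right half-plane, away from the cut of the
  principal logarithm.\<close>

lemma Ln_near_1:
  fixes u v :: complex
  assumes "norm (u - v) \<le> 1/3 * norm v" "v \<noteq> 0"
  shows "norm (Ln (u / v)) \<le> 1" and "exp (Ln (u / v)) = u / v" and "u / v \<notin> \<real>\<^sub>\<le>\<^sub>0"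
    and "u \<in> \<real> \<Longrightarrow> v \<in> \<real> \<Longrightarrow> Ln (u / v) \<in> \<real>"
proof -
  have *: "norm (u / v - 1) \<le> 1/3"
    using assms by (simp add: field_simps flip: norm_divide) (simp add: norm_divide divide_simps mult.commute)
  then show "norm (Ln (u / v)) \<le> 1"
    using norm_Ln_le[of "u / v - 1"] by simp
  have "\<bar>Re (u / v - 1)\<bar> \<le> 1/3" using * abs_Re_le_cmod order_trans by blast
  then have Re: "Re (u / v) > 0"
    unfolding minus_complex.simps one_complex.simps by linarith
  then show "u / v \<notin> \<real>\<^sub>\<le>\<^sub>0" by (auto simp: complex_nonpos_Reals_iff)
  show "exp (Ln (u / v)) = u / v" using Re by (intro exp_Ln) auto
  assume "u \<in> \<real>" "v \<in> \<real>"
  then obtain y where y: "u / v = of_real y" using Reals_divide Reals_cases by metis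
  with Re have "y > 0" by simp
  with y show "Ln (u / v) \<in> \<real>" by (simp add: Ln_of_real)
qed

text \<open>A logarithm of \<open>mgf J z s\<close> glued from ratios of consecutive levels. All of
  them are close to 1, so no branch has to be chosen and the size is at most linear in
  \<open>J\<close>; the last term passes from \<open>s0\<close> to \<open>s\<close>.\<close>

definition lmgf :: "nat \<Rightarrow> complex \<Rightarrow> 's \<Rightarrow> complex" where
  "lmgf J z s = (\<Sum>i<J. Ln (mgf (Suc i) z s0 / mgf i z s0)) + Ln (mgf J z s / mgf J z s0)"

definition mean :: "nat \<Rightarrow> 's \<Rightarrow> real" where
  "mean J s = Re (deriv (\<lambda>z. lmgf J z s) 0)"

definition var :: "nat \<Rightarrow> 's \<Rightarrow> real" where
  "var J s = Re (deriv (deriv (\<lambda>z. lmgf J z s)) 0)"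

text \<open>On a disc of uniform radius the logarithms of the moment generating functions are holomorphic,
  grow at most linearly in the number of steps and depend on the initial state only up to \<open>O(1)\<close>.
  Cauchy's estimates turn this into bounds on the cumulants.\<close>

lemma cumulants:
  "\<exists>C>0. \<exists>r>0. (\<forall>J s z. norm z \<le> r \<longrightarrow>
       (\<exists>R. mgf J z s = exp (of_real (mean J s) * z + of_real (var J s) / 2 * z\<^sup>2 + R) \<and> norm R \<le> C * (real J + 1) * norm z ^ 3))
     \<and> (\<forall>J s. \<bar>mean J s\<bar> \<le> C) \<and> (\<forall>J s. \<bar>var J s - var J s0\<bar> \<le> C) \<and> (\<forall>J. \<bar>var (Suc J) s0 - var J s0\<bar> \<le> C)"
proof -
  obtain r where r: "r > 0" and cone: "\<And>i z s t. norm z < r \<Longrightarrow> mgf i z s \<noteq> 0 \<and> norm (mgf i z s - mgf i z t) \<le> 1/3 * norm (mgf i z t)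
     \<and> norm (mgf (Suc i) z s - mgf i z t) \<le> 1/3 * norm (mgf i z t)"
    using mgf_cone by metis
  note L1 = Ln_near_1[OF conjunct1[OF conjunct2[OF cone]] conjunct1[OF cone]]
  note L2 = Ln_near_1[OF conjunct2[OF conjunct2[OF cone]] conjunct1[OF cone]]
  have hol: "(\<lambda>z. lmgf J z s) holomorphic_on ball 0 r" for J s
    unfolding lmgf_def
    by (intro holomorphic_intros holomorphic_mgf) (use L1(3) L2(3) cone in auto)
  have exp_l: "exp (lmgf J z s) = mgf J z s" if z: "norm z < r" for J z s
  proof -
    have "exp (\<Sum>i<J. Ln (mgf (Suc i) z s0 / mgf i z s0)) = mgf J z s0" for J
    proof (induction J)
      case (Suc J)
      then show ?case using L2(2)[OF z z] cone[OF z, of J s0] by (simp add: exp_add)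
    qed auto
    then show ?thesis using L1(2)[OF z z] cone[OF z, of J s0] by (simp add: lmgf_def exp_add)
  qed
  have bd: "norm (lmgf J z s) \<le> real J + 1" if z: "norm z < r" for J z s
  proof -
    have "norm (\<Sum>i<J. Ln (mgf (Suc i) z s0 / mgf i z s0)) \<le> real (card {..<J}) * 1"
      by (intro sum_norm_bound L2(1) z)
    then show ?thesis unfolding lmgf_def using L1(1)[OF z z] by (intro norm_triangle_le add_mono) auto
  qed
  have re: "lmgf J (of_real x) s \<in> \<real>" if x: "\<bar>x\<bar> < r" for J x s
  proof -
    have x': "norm (complex_of_real x) < r" using x by simp
    show ?thesis unfolding lmgf_def
      by (intro Reals_add sum_in_Reals L1(4)[OF x' x'] L2(4)[OF x' x'] mgf_real)
  qed
  have l0: "lmgf J 0 s = 0" for J s by (simp add: lmgf_def mgf_at_0 del: mgf.simps)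
  have hd: "deriv (\<lambda>z. lmgf J z s) holomorphic_on ball 0 r" for J s
    by (intro holomorphic_deriv hol) auto
  have dre: "deriv (\<lambda>z. lmgf J z s) (of_real x) \<in> \<real>" if "\<bar>x\<bar> < r" for J s x
    by (rule deriv_in_Reals[OF hol that re])
  then have mean: "deriv (\<lambda>z. lmgf J z s) 0 = of_real (mean J s)" for J s
    using r dre[of 0] by (simp add: mean_def complex_is_Real_iff complex_eq_iff)
  have "deriv (deriv (\<lambda>z. lmgf J z s)) (of_real 0) \<in> \<real>" for J s
    by (rule deriv_in_Reals[OF hd _ dre]) (use r in auto)
  then have var: "deriv (deriv (\<lambda>z. lmgf J z s)) 0 = of_real (var J s)" for J s
    by (simp add: var_def complex_is_Real_iff complex_eq_iff)
  \<comment> \<open>\<open>2 / r ^ 3\<close> serves the Taylor remainder; \<open>2 / r\<close> and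
    \<open>4 / r ^ 2\<close> are Cauchy's bounds for the first two derivatives of a difference of
    modulus at most 2.\<close>
  define C where "C = 2 / r ^ 3 + 2 / r + 4 / r ^ 2"
  have C: "C > 0" using r by (simp add: C_def add_pos_pos)
  have C1: "2 / r ^ 3 \<le> C" "2 / r \<le> C" "4 / r\<^sup>2 \<le> C" using r by (auto simp: C_def)
  have taylor: "\<exists>R. mgf J z s = exp (of_real (mean J s) * z + of_real (var J s) / 2 * z\<^sup>2 + R) \<and> norm R \<le> C * (real J + 1) * norm z ^ 3"
    if z: "norm z \<le> r / 2" for J z s
  proof (intro exI conjI)
    define R where "R = lmgf J z s - (lmgf J 0 s + deriv (\<lambda>z. lmgf J z s) 0 * z + deriv (deriv (\<lambda>z. lmgf J z s)) 0 / 2 * z\<^sup>2)"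
    have zr: "norm z < r" using z r by auto
    have "norm R \<le> 2 * (real J + 1) / r ^ 3 * norm z ^ 3"
      unfolding R_def by (rule holomorphic_taylor_order_2[OF hol r _ z]) (use bd in auto)
    also have "\<dots> = 2 / r ^ 3 * ((real J + 1) * norm z ^ 3)" by simp
    also have "\<dots> \<le> C * ((real J + 1) * norm z ^ 3)" using C1 by (intro mult_right_mono) auto
    finally show "norm R \<le> C * (real J + 1) * norm z ^ 3" by (simp add: mult_ac)
    have "lmgf J z s = of_real (mean J s) * z + of_real (var J s) / 2 * z\<^sup>2 + R"
      by (simp add: R_def mean var l0)
    then show "mgf J z s = exp (of_real (mean J s) * z + of_real (var J s) / 2 * z\<^sup>2 + R)"
      using exp_l[OF zr, of J s] by simp
  qed
  have diff: "norm (deriv (\<lambda>z. lmgf J z s) 0 - deriv (\<lambda>z. lmgf J' z s') 0) \<le> C"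
     "norm (deriv (deriv (\<lambda>z. lmgf J z s)) 0 - deriv (deriv (\<lambda>z. lmgf J' z s')) 0) \<le> C"
    if b: "\<And>z. norm z < r \<Longrightarrow> norm (lmgf J z s - lmgf J' z s') \<le> 2" for J J' s s'
  proof -
    let ?d = "\<lambda>z. lmgf J z s - lmgf J' z s'"
    have h: "?d holomorphic_on ball 0 r" by (intro holomorphic_intros hol)
    have in0: "0 \<in> ball 0 r" using r by simp
    have "norm ((deriv ^^ n) ?d 0 / fact n) \<le> 2 / r ^ n" for n
      by (rule Cauchy_inequality_ball[OF h r]) (use b in auto)
    moreover have "(deriv ^^ n) ?d 0 = (deriv ^^ n) (\<lambda>z. lmgf J z s) 0 - (deriv ^^ n) (\<lambda>z. lmgf J' z s') 0" for n
      by (rule higher_deriv_diff[OF hol hol _ in0]) auto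
    ultimately have *: "norm (((deriv ^^ n) (\<lambda>z. lmgf J z s) 0 - (deriv ^^ n) (\<lambda>z. lmgf J' z s') 0) / fact n) \<le> 2 / r ^ n" for n
      by simp
    show "norm (deriv (\<lambda>z. lmgf J z s) 0 - deriv (\<lambda>z. lmgf J' z s') 0) \<le> C"
      using *[of 1] C1 by simp
    show "norm (deriv (deriv (\<lambda>z. lmgf J z s)) 0 - deriv (deriv (\<lambda>z. lmgf J' z s')) 0) \<le> C"
      using *[of 2] C1 by (simp add: numeral_2_eq_2 norm_divide)
  qed
  have ds: "norm (lmgf J z s - lmgf J z t) \<le> 2" if z: "norm z < r" for J z s t
    unfolding lmgf_def using L1(1)[OF z z, of J s s0] L1(1)[OF z z, of J t s0]
    by (simp add: norm_triangle_le_diff)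
  have dJ: "norm (lmgf (Suc J) z s0 - lmgf J z s0) \<le> 2" if z: "norm z < r" for J z
    unfolding lmgf_def using L2(1)[OF z z, of J s0 s0] by (simp add: cone z del: mgf.simps)
  \<comment> \<open>The flip symmetry is known for \<open>mgf\<close>, not for the logarithm, so the
    mean is identified with the derivative of \<open>mgf\<close> at 0.\<close>
  have dm: "((\<lambda>z. mgf J z s) has_field_derivative of_real (mean J s)) (at 0)" for J s
  proof -
    have d: "((\<lambda>z. lmgf J z s) has_field_derivative of_real (mean J s)) (at 0)"
      using holomorphic_derivI[OF hol open_ball, of 0 J s] r by (simp add: mean)
    have "((\<lambda>z. exp (lmgf J z s)) has_field_derivative of_real (mean J s)) (at 0)"
      using DERIV_fun_exp[OF d] by (simp add: l0)
    then show ?thesis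
      by (rule has_field_derivative_transform_within[OF _ r]) (use exp_l in auto)
  qed
  have flip: "mean J (flip s) = - mean J s" for J s
  proof -
    have "((\<lambda>z. mgf J (- z) s) has_field_derivative of_real (mean J s) * (- 1)) (at 0)"
      by (rule DERIV_chain'[where f = uminus]) (use dm in \<open>auto intro!: derivative_eq_intros\<close>)
    then have "complex_of_real (mean J (flip s)) = of_real (mean J s) * (- 1)"
      using dm[of J "flip s"] unfolding mgf_flip by (intro DERIV_unique)
    then show ?thesis by (simp flip: of_real_minus)
  qed
  \<comment> \<open>The means at \<open>s\<close> and \<open>flip s\<close> are opposite and differ
    by at most \<open>C\<close>: there is no drift.\<close>
  have m: "\<bar>mean J s\<bar> \<le> C" for J s
    using diff(1)[OF ds, of J s "flip s"] C unfolding mean flip by (simp add: norm_mult flip: of_real_diff)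
  have v: "\<bar>var J s - var J s0\<bar> \<le> C" for J s
    using diff(2)[OF ds, of J s s0] unfolding var by (simp flip: of_real_diff)
  have vJ: "\<bar>var (Suc J) s0 - var J s0\<bar> \<le> C" for J
    using diff(2)[OF dJ, of J] unfolding var by (simp flip: of_real_diff)
  show ?thesis
    by (rule exI[of _ C], intro conjI, rule C, rule exI[of _ "r / 2"]) (use r taylor m v vJ in auto)
qed

text \<open>Linear growth of the variance is read off at one fixed small frequency: the decay bound
  forces the quadratic term of the expansion to be large. One normalization \<open>V\<close> serves
  all initial states, whose variances differ by O(1).\<close>

lemma central_limit:
  "\<exists>V::nat \<Rightarrow> real. \<exists>C>0. \<exists>c>0. (\<forall>J. \<bar>V (Suc J) - V J\<bar> \<le> C) \<and> (\<forall>\<^sub>F J in sequentially. V J \<ge> c * real J)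
     \<and> (\<forall>J \<theta> s. \<bar>\<theta>\<bar> \<le> pi \<longrightarrow> norm (mgf J (\<i> * of_real \<theta>) s) \<le> C * exp (- (c * real J * \<theta>\<^sup>2)))
     \<and> (\<forall>s \<tau>. (\<lambda>J. mgf J (\<i> * of_real (\<tau> / sqrt (V J))) s) \<longlonglongrightarrow> of_real (exp (- \<tau>\<^sup>2 / 2)))"
proof -
  obtain C1 r where C1: "C1 > 0" and r: "r > 0"
    and taylor: "\<And>J s z. norm z \<le> r \<Longrightarrow>
       \<exists>R. mgf J z s = exp (of_real (mean J s) * z + of_real (var J s) / 2 * z\<^sup>2 + R) \<and> norm R \<le> C1 * (real J + 1) * norm z ^ 3"
    and m: "\<And>J s. \<bar>mean J s\<bar> \<le> C1" and v: "\<And>J s. \<bar>var J s - var J s0\<bar> \<le> C1"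
    and vJ: "\<And>J. \<bar>var (Suc J) s0 - var J s0\<bar> \<le> C1"
    using cumulants by metis
  obtain C2 c where C2: "C2 > 0" and c: "c > 0"
    and decay: "\<And>J \<theta> s. \<bar>\<theta>\<bar> \<le> pi \<Longrightarrow> norm (mgf J (\<i> * of_real \<theta>) s) \<le> C2 * exp (- (c * real J * \<theta>\<^sup>2))"
    using mgf_decay by metis
  define V where "V J = var J s0" for J
  \<comment> \<open>So small that the cubic remainder, of order \<open>C1 * J * \<theta>^3\<close>,
    uses up at most half of the decay exponent \<open>c * J * \<theta>\<^sup>2\<close>; the variance
    must supply the rest.\<close>
  define \<theta> where "\<theta> = min (min r pi) (c / (2 * C1))"
  have \<theta>: "0 < \<theta>" "\<theta> \<le> r" "\<theta> \<le> pi" and "\<theta> \<le> c / (2 * C1)" using r c C1 by (auto simp: \<theta>_def)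
  then have \<theta>c: "C1 * \<theta> \<le> c / 2" using C1 by (simp add: field_simps)
  define K where "K = c + 2 * ln C2 / \<theta>\<^sup>2"
  have VK: "V J \<ge> c * real J - K" for J
  proof -
    obtain R where R: "mgf J (\<i> * of_real \<theta>) s0 = exp (of_real (mean J s0) * (\<i> * of_real \<theta>) + of_real (V J) / 2 * (\<i> * of_real \<theta>)\<^sup>2 + R)"
      and Rb: "norm R \<le> C1 * (real J + 1) * norm (\<i> * complex_of_real \<theta>) ^ 3"
      using taylor[of "\<i> * of_real \<theta>" J s0] \<theta> by (auto simp: norm_mult V_def)
    have "norm (mgf J (\<i> * of_real \<theta>) s0) = exp (- (V J / 2 * \<theta>\<^sup>2) + Re R)"
      unfolding R norm_exp_eq_Re by (simp add: power_mult_distrib)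
    then have "- (V J / 2 * \<theta>\<^sup>2) + Re R \<le> ln (C2 * exp (- (c * real J * \<theta>\<^sup>2)))"
      using decay[of \<theta> J s0] \<theta> C2 by (subst ln_ge_iff) auto
    also have "\<dots> = ln C2 - c * real J * \<theta>\<^sup>2" using C2 by (simp add: ln_mult)
    finally have 1: "c * real J * \<theta>\<^sup>2 \<le> V J / 2 * \<theta>\<^sup>2 + ln C2 - Re R" by simp
    have "- Re R \<le> norm R" using abs_Re_le_cmod[of R] by linarith
    also have "\<dots> \<le> C1 * (real J + 1) * \<theta> ^ 3" using Rb \<theta> by (simp add: norm_mult)
    also have "\<dots> = (C1 * \<theta>) * ((real J + 1) * \<theta>\<^sup>2)" by (simp add: power3_eq_cube power2_eq_square)
    also have "\<dots> \<le> c / 2 * ((real J + 1) * \<theta>\<^sup>2)" by (intro mult_right_mono \<theta>c) auto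
    finally have 2: "- Re R \<le> c / 2 * ((real J + 1) * \<theta>\<^sup>2)" .
    have "(V J / 2 + ln C2 / \<theta>\<^sup>2 + c / 2 * (real J + 1)) * \<theta>\<^sup>2 = V J / 2 * \<theta>\<^sup>2 + ln C2 + c / 2 * ((real J + 1) * \<theta>\<^sup>2)"
      using \<theta> by (simp add: field_simps)
    with 1 2 have "c * real J * \<theta>\<^sup>2 \<le> (V J / 2 + ln C2 / \<theta>\<^sup>2 + c / 2 * (real J + 1)) * \<theta>\<^sup>2"
      by linarith
    then have "c * real J \<le> V J / 2 + ln C2 / \<theta>\<^sup>2 + c / 2 * (real J + 1)"
      using \<theta> by simp
    moreover have "K = c + 2 * (ln C2 / \<theta>\<^sup>2)" by (simp add: K_def)
    moreover have "c / 2 * (real J + 1) = c * real J / 2 + c / 2" by (simp add: field_simps)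
    ultimately show ?thesis by linarith
  qed
  have "eventually (\<lambda>J. real J \<ge> 2 * K / c) sequentially" by real_asymp
  then have Vc: "eventually (\<lambda>J. V J \<ge> c / 2 * real J) sequentially"
  proof eventually_elim
    case (elim J)
    then have "K \<le> c / 2 * real J" using c by (simp add: field_simps)
    with VK[of J] show ?case by linarith
  qed
  have Vinf: "filterlim V at_top sequentially"
  proof (rule filterlim_at_top_mono[OF _ Vc])
    show "filterlim (\<lambda>J. c / 2 * real J) at_top sequentially" using c by real_asymp
  qed
  have lim: "(\<lambda>J. mgf J (\<i> * of_real (\<tau> / sqrt (V J))) s) \<longlonglongrightarrow> of_real (exp (- \<tau>\<^sup>2 / 2))" for s \<tau>
  proof -
    define z where "z J = \<i> * complex_of_real (\<tau> / sqrt (V J))" for J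
    have Vpos: "eventually (\<lambda>J. V J > 0) sequentially" using Vinf by (simp add: filterlim_at_top_dense)
    have inv: "(\<lambda>J. 1 / V J) \<longlonglongrightarrow> 0" using Vinf by (intro tendsto_divide_0[OF tendsto_const] filterlim_at_top_imp_at_infinity)
    have isq: "(\<lambda>J. 1 / sqrt (V J)) \<longlonglongrightarrow> 0"
      by (intro tendsto_divide_0[OF tendsto_const] filterlim_at_top_imp_at_infinity filterlim_compose[OF sqrt_at_top Vinf])
    have nz: "norm (z J) = \<bar>\<tau>\<bar> * \<bar>1 / sqrt (V J)\<bar>" for J by (simp add: z_def norm_mult abs_mult norm_divide)
    have "(\<lambda>J. \<bar>\<tau>\<bar> * \<bar>1 / sqrt (V J)\<bar>) \<longlonglongrightarrow> \<bar>\<tau>\<bar> * \<bar>0\<bar>"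
      by (intro tendsto_intros isq)
    then have nz0: "(\<lambda>J. norm (z J)) \<longlonglongrightarrow> 0" unfolding nz by simp
    have "eventually (\<lambda>J. norm (z J) \<le> r) sequentially"
      using order_tendstoD(2)[OF nz0 r] by eventually_elim simp
    define R where "R J = (SOME R. mgf J (z J) s = exp (of_real (mean J s) * z J + of_real (var J s) / 2 * (z J)\<^sup>2 + R) \<and> norm R \<le> C1 * (real J + 1) * norm (z J) ^ 3)" for J
    have R: "eventually (\<lambda>J. mgf J (z J) s = exp (of_real (mean J s) * z J + of_real (var J s) / 2 * (z J)\<^sup>2 + R J) \<and> norm (R J) \<le> C1 * (real J + 1) * norm (z J) ^ 3) sequentially"
      using \<open>eventually (\<lambda>J. norm (z J) \<le> r) sequentially\<close>
    proof eventually_elim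
      case (elim J)
      from someI_ex[OF taylor[OF this, of J s]] show ?case unfolding R_def .
    qed
    have t1: "(\<lambda>J. of_real (mean J s) * z J) \<longlonglongrightarrow> 0"
    proof (rule Lim_null_comparison)
      show "(\<lambda>J. C1 * norm (z J)) \<longlonglongrightarrow> 0" by (rule tendsto_mult_right_zero[OF nz0])
      show "eventually (\<lambda>J. norm (of_real (mean J s) * z J) \<le> C1 * norm (z J)) sequentially"
        using m by (intro always_eventually allI) (simp add: norm_mult mult_right_mono)
    qed
    have "(\<lambda>J. (var J s - V J) * (1 / V J)) \<longlonglongrightarrow> 0"
    proof (rule Lim_null_comparison)
      show "(\<lambda>J. C1 * \<bar>1 / V J\<bar>) \<longlonglongrightarrow> 0" by (rule tendsto_mult_right_zero[OF tendsto_rabs_zero[OF inv]])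
      show "eventually (\<lambda>J. norm ((var J s - V J) * (1 / V J)) \<le> C1 * \<bar>1 / V J\<bar>) sequentially"
        using v by (intro always_eventually allI) (simp add: abs_mult V_def divide_right_mono)
    qed
    then have "(\<lambda>J. - (\<tau>\<^sup>2 / 2) * (1 + (var J s - V J) * (1 / V J))) \<longlonglongrightarrow> - (\<tau>\<^sup>2 / 2) * (1 + 0)"
      by (intro tendsto_intros)
    then have t2: "(\<lambda>J. of_real (var J s) / 2 * (z J)\<^sup>2) \<longlonglongrightarrow> of_real (- (\<tau>\<^sup>2 / 2) * (1 + 0))"
    proof (rule Lim_transform_eventually[OF tendsto_of_real])
      show "eventually (\<lambda>J. complex_of_real (- (\<tau>\<^sup>2 / 2) * (1 + (var J s - V J) * (1 / V J))) = of_real (var J s) / 2 * (z J)\<^sup>2) sequentially"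
        using Vpos
      proof eventually_elim
        case (elim J)
        have "(z J)\<^sup>2 = of_real (- (\<tau>\<^sup>2 / V J))"
          using elim by (simp add: z_def power_mult_distrib power_divide flip: of_real_power)
        moreover have "- (\<tau>\<^sup>2 / 2) * (1 + (var J s - V J) * (1 / V J)) = var J s / 2 * (- (\<tau>\<^sup>2 / V J))"
          using elim by (simp add: field_simps)
        ultimately show ?case by simp
      qed
    qed
    \<comment> \<open>The remainder is of order \<open>J / V J\<close> times
      \<open>1 / sqrt (V J)\<close>, and the first factor is bounded.\<close>
    have t3: "R \<longlonglongrightarrow> 0"
    proof (rule Lim_null_comparison)
      have "(\<lambda>J. 2 * C1 * \<bar>\<tau>\<bar> ^ 3 * (2 / c) * (1 / sqrt (V J))) \<longlonglongrightarrow> 2 * C1 * \<bar>\<tau>\<bar> ^ 3 * (2 / c) * 0"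
        by (intro tendsto_intros isq)
      then show "(\<lambda>J. 2 * C1 * \<bar>\<tau>\<bar> ^ 3 * (2 / c) * (1 / sqrt (V J))) \<longlonglongrightarrow> 0" by simp
      show "eventually (\<lambda>J. norm (R J) \<le> 2 * C1 * \<bar>\<tau>\<bar> ^ 3 * (2 / c) * (1 / sqrt (V J))) sequentially"
        using R Vpos Vc eventually_ge_at_top[of 1]
      proof eventually_elim
        case (elim J)
        have s3: "norm (z J) ^ 3 = \<bar>\<tau>\<bar> ^ 3 * (1 / V J) * (1 / sqrt (V J))"
          using elim by (simp add: nz power_mult_distrib power3_eq_cube power_divide field_simps)
        have "norm (R J) \<le> C1 * (real J + 1) * norm (z J) ^ 3" using elim by simp
        also have "\<dots> \<le> C1 * (2 * real J) * norm (z J) ^ 3"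
          using elim C1 by (intro mult_right_mono mult_left_mono) auto
        also have "\<dots> = 2 * C1 * \<bar>\<tau>\<bar> ^ 3 * (real J / V J) * (1 / sqrt (V J))" unfolding s3 by simp
        also have "\<dots> \<le> 2 * C1 * \<bar>\<tau>\<bar> ^ 3 * (2 / c) * (1 / sqrt (V J))"
          using elim C1 c by (intro mult_right_mono mult_left_mono) (auto simp: field_simps)
        finally show ?case .
      qed
    qed
    have "(\<lambda>J. exp (of_real (mean J s) * z J + of_real (var J s) / 2 * (z J)\<^sup>2 + R J)) \<longlonglongrightarrow> exp (0 + of_real (- (\<tau>\<^sup>2 / 2) * (1 + 0)) + 0)"
      by (intro tendsto_intros t1 t2 t3)
    moreover have "exp (0 + complex_of_real (- (\<tau>\<^sup>2 / 2) * (1 + 0)) + 0) = of_real (exp (- \<tau>\<^sup>2 / 2))"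
      by (simp add: exp_of_real[symmetric])
    ultimately show ?thesis
      unfolding z_def[symmetric] using R
      by (auto intro: Lim_transform_eventually elim!: eventually_mono)
  qed
  show ?thesis
  proof (intro exI conjI allI impI)
    show "max C1 C2 > 0" "c / 2 > 0" using C1 c by auto
    show "\<bar>V (Suc J) - V J\<bar> \<le> max C1 C2" for J using vJ[of J] by (simp add: V_def)
    show "norm (mgf J (\<i> * of_real \<theta>) s) \<le> max C1 C2 * exp (- (c / 2 * real J * \<theta>\<^sup>2))" if "\<bar>\<theta>\<bar> \<le> pi" for J \<theta> s
    proof -
      have "norm (mgf J (\<i> * of_real \<theta>) s) \<le> C2 * exp (- (c * real J * \<theta>\<^sup>2))" by (rule decay[OF that])
      also have "\<dots> \<le> max C1 C2 * exp (- (c / 2 * real J * \<theta>\<^sup>2))"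
        using C2 c by (intro mult_mono) (auto intro!: mult_right_mono)
      finally show ?thesis .
    qed
  qed (use Vc lim in auto)
qed

end

text \<open>With \<open>t = \<bar>x\<bar> / 4\<close> the double angle formula and
  \<open>t / 2 \<le> sin t\<close> give it. It measures the cancellation of two phases
  \<open>x / 2\<close> and \<open>- x / 2\<close>, up to the extreme frequency
  \<open>pi\<close>.\<close>

lemma cos_half_le:
  assumes "\<bar>x\<bar> \<le> pi"
  shows "cos (x / 2) \<le> 1 - x\<^sup>2 / 32"
proof -
  define t where "t = \<bar>x\<bar> / 4"
  have t: "0 \<le> t" "t \<le> pi / 4" using assms by (auto simp: t_def)
  have "t / 2 \<le> sin t"
  proof (cases "t = 0")
    case False
    have "\<exists>\<xi>. 0 < \<xi> \<and> \<xi> < t \<and> sin t - sin 0 = (t - 0) * cos \<xi>"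
      by (rule MVT2) (use False t in \<open>auto intro!: derivative_eq_intros\<close>)
    then obtain \<xi> where \<xi>: "0 < \<xi>" "\<xi> < t" "sin t = t * cos \<xi>" by auto
    have "cos (pi / 3) \<le> cos \<xi>" using \<xi> t pi_gt_zero by (intro cos_monotone_0_pi_le) (auto simp: field_simps)
    then show ?thesis using \<xi> t by (simp add: cos_60 mult_left_mono)
  qed auto
  then have "(t / 2)\<^sup>2 \<le> (sin t)\<^sup>2" using t by (intro power_mono) auto
  moreover have "cos (x / 2) = cos (2 * t)" by (auto simp: t_def abs_if)
  ultimately show ?thesis unfolding cos_double_sin by (simp add: t_def power_divide)
qed

section \<open>The renormalization tree\<close>

text \<open>A node carries the parity bit that it contributes to the discrepancy and the information whether
  it is the last child of its parent. The latter decides whether the node has an exceptional number of children: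
  \<open>1 / y = 2 m \<plusminus> y'\<close>, so runs of points with the same \<open>\<lfloor>u y\<rfloor>\<close> have length \<open>2 m\<close> or \<open>2 m \<plusminus> 1\<close>.
  Level \<open>0\<close> is the bottom of the tree.\<close>

type_synonym state = "bool \<times> bool"

text \<open>\<open>pos i\<close> tells the sign in \<open>1 / y = 2 m \<plusminus> y'\<close>. At a
  level with \<open>m = 1\<close> and the minus sign a last child has one child only, again a last
  one; \<open>good_step\<close> bounds the length of stretches of such levels.\<close>

locale renormalization_tree =
  fixes m :: "nat \<Rightarrow> nat" and pos :: "nat \<Rightarrow> bool" and sg :: "nat \<Rightarrow> int" and K gap :: nat
  assumes m_ge: "1 \<le> m i" and m_le: "m i \<le> K" and sg: "\<bar>sg i\<bar> = 1"
    and good_step: "\<exists>j. i \<le> j \<and> j < i + gap \<and> (pos j \<or> 2 \<le> m j)"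
begin

definition run :: "nat \<Rightarrow> state \<Rightarrow> nat" where
  "run i s = (if snd s then if pos i then 2 * m i + 1 else 2 * m i - 1 else 2 * m i)"

text \<open>The \<open>r\<close>-th point \<open>u\<close> above \<open>w\<close> has the bit
  \<open>odd (u + w)\<close>. Modulo 2 the run starts at the parent of \<open>w\<close> plus
  \<open>of_bool (pos i)\<close>, and the sum of \<open>w\<close> and its parent has the parity
  given by the bit of \<open>w\<close>.\<close>

definition child :: "nat \<Rightarrow> state \<Rightarrow> nat \<Rightarrow> state" where
  "child i s r = (odd (r + of_bool (fst s) + of_bool (pos i)), Suc r = run i s)"

primrec wt :: "nat \<Rightarrow> state \<Rightarrow> nat" where
  "wt 0 s = 1"
| "wt (Suc i) s = (\<Sum>r<run i s. wt i (child i s r))"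

text \<open>Counts leaves by the signed sum of the bits on the path to them; the bit of the top node
  \<open>s\<close> itself is not included.\<close>

primrec cnt :: "nat \<Rightarrow> state \<Rightarrow> int \<Rightarrow> nat" where
  "cnt 0 s y = of_bool (y = 0)"
| "cnt (Suc i) s y = (\<Sum>r<run i s. cnt i (child i s r) (y - sg i * of_bool (fst (child i s r))))"

text \<open>Descending with probability proportional to the number of leaves makes the final leaf
  uniform. The sum collects children that share a state.\<close>

definition p :: "nat \<Rightarrow> state \<Rightarrow> state \<Rightarrow> real" where
  "p i s t = (\<Sum>r<run i s. if child i s r = t then real (wt i t) / real (wt (Suc i) s) else 0)"

text \<open>Centring the bit at 1/2 makes \<open>b\<close> odd under \<open>flip\<close>; the
  removed halves add up to \<open>center\<close> below.\<close>

definition b :: "nat \<Rightarrow> state \<Rightarrow> real" where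
  "b i s = of_int (sg i) * (of_bool (fst s) - 1 / 2)"

definition flip :: "state \<Rightarrow> state" where "flip s = (\<not> fst s, snd s)"

abbreviation good :: "nat \<Rightarrow> bool" where "good i \<equiv> pos i \<or> 2 \<le> m i"

lemma run_pos: "0 < run i s"
  using m_ge[of i] by (auto simp: run_def)

lemma run_le: "run i s \<le> 2 * K + 1"
  using m_le[of i] by (auto simp: run_def)

lemma wt_pos: "0 < wt i s"
proof (induction i arbitrary: s)
  case (Suc i)
  then show ?case using run_pos[of i s] unfolding wt.simps
    by (intro sum_pos Suc.IH) (auto simp: lessThan_empty_iff)
qed auto

declare wt.simps(2) [simp del]

text \<open>The parity bit of a node affects the bits of its descendants, never their
  number.\<close>

lemma wt_snd: "snd s = snd t \<Longrightarrow> wt i s = wt i t"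
proof (induction i arbitrary: s t)
  case (Suc i)
  then have "run i s = run i t" by (simp add: run_def)
  then show ?case by (auto intro!: sum.cong Suc simp: child_def wt.simps(2))
qed auto

abbreviation W :: "nat \<Rightarrow> bool \<Rightarrow> nat" where "W i l \<equiv> wt i (False, l)"

lemma wt_eq_W: "wt i s = W i (snd s)"
  by (rule wt_snd) simp

lemma wt_Suc: "wt (Suc i) s = (run i s - 1) * W i False + W i True"
proof -
  obtain k where k: "run i s = Suc k" using run_pos[of i s] gr0_implies_Suc by blast
  have "wt (Suc i) s = (\<Sum>r<k. wt i (child i s r)) + wt i (child i s k)" by (simp add: k wt.simps(2))
  also have "wt i (child i s k) = W i True" by (rule wt_snd) (simp add: child_def k)
  also have "(\<Sum>r<k. wt i (child i s r)) = (\<Sum>r<k. W i False)"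
    by (intro sum.cong wt_snd) (auto simp: child_def k)
  finally show ?thesis by (simp add: k)
qed

lemma W_True_le: "W i True \<le> 2 * W i False"
proof (cases i)
  case (Suc j)
  obtain k where "m j = Suc k" using m_ge[of j] by (cases "m j") auto
  then show ?thesis unfolding Suc wt_Suc by (auto simp: run_def algebra_simps)
qed auto

text \<open>In the bad case, the minus sign, a last node lacks exactly one child of weight
  \<open>W i False\<close>, so the ratio of the two weights grows by at most 1 per level.\<close>

lemma W_False_Suc_le: "W i False \<le> c * W i True \<Longrightarrow> 1 \<le> c \<Longrightarrow> W (Suc i) False \<le> (c + 1) * W (Suc i) True"
proof (cases "pos i")
  case True
  assume "1 \<le> c"
  have "(2 * m i - 1) * W i False \<le> 2 * m i * W i False" by (intro mult_right_mono) auto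
  then have "W (Suc i) False \<le> 1 * W (Suc i) True" unfolding wt_Suc using True by (simp add: run_def)
  also have "\<dots> \<le> (c + 1) * W (Suc i) True" by (intro mult_right_mono) auto
  finally show ?thesis .
next
  case False
  assume c: "W i False \<le> c * W i True"
  have "W (Suc i) False = W i False + W (Suc i) True"
    unfolding wt_Suc using False m_ge[of i] by (cases "m i") (auto simp: run_def algebra_simps)
  also have "W i True \<le> W (Suc i) True" by (simp only: wt_Suc le_add2)
  then have "c * W i True \<le> c * W (Suc i) True" by simp
  with c have "W i False \<le> c * W (Suc i) True" by linarith
  finally show ?thesis by simp
qed

lemma W_False_le_good:
  assumes "good i"
  shows "W (Suc i) False \<le> 2 * W (Suc i) True"
proof (cases "pos i")
  case True
  then show ?thesis unfolding wt_Suc by (cases "m i") (auto simp: run_def algebra_simps)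
next
  case False
  then obtain k where "m i = Suc (Suc k)" using assms False by (metis add_2_eq_Suc le_iff_add)
  then show ?thesis unfolding wt_Suc using False by (simp add: run_def algebra_simps)
qed

lemma W_False_le_add: "W i False \<le> c * W i True \<Longrightarrow> 1 \<le> c \<Longrightarrow> W (i + k) False \<le> (c + k) * W (i + k) True"
proof (induction k)
  case (Suc k)
  then show ?case using W_False_Suc_le[of "i + k" "c + k"] by simp
qed auto

text \<open>A good level resets the ratio to 2, after which it gains at most 1 per level until the
  next good one.\<close>

lemma W_False_le: "W i False \<le> (gap + 2) * W i True"
proof -
  have *: "\<exists>c. 1 \<le> c \<and> c \<le> gap + 2 \<and> W i False \<le> c * W i True"
  proof (cases "i < gap")
    case True
    then show ?thesis using W_False_le_add[of 0 1 i] by (intro exI[of _ "1 + i"]) auto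
  next
    case False
    obtain j where j: "i - gap \<le> j" "j < i - gap + gap" "good j" using good_step by blast
    with False have "j < i" by simp
    then obtain k where k: "i = Suc j + k" using less_iff_Suc_add by auto
    with j False have "k \<le> gap" by simp
    moreover have "W i False \<le> (2 + k) * W i True"
      unfolding k by (rule W_False_le_add[OF W_False_le_good]) (use j in auto)
    ultimately show ?thesis by (intro exI[of _ "2 + k"]) auto
  qed
  then obtain c where "c \<le> gap + 2" "W i False \<le> c * W i True" by blast
  moreover from this have "c * W i True \<le> (gap + 2) * W i True" by (intro mult_right_mono) auto
  ultimately show ?thesis by linarith
qed

lemma wt_le_False: "wt i s \<le> 2 * W i False"
  using W_True_le[of i] wt_eq_W[of i s] by (cases "snd s") auto

lemma W_False_le_wt: "W i False \<le> (gap + 2) * wt i s"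
  using W_False_le[of i] wt_eq_W[of i s] by (cases "snd s") auto

lemma wt_comparable: "wt i s \<le> 2 * (gap + 2) * wt i t"
  using wt_le_False[of i s] W_False_le_wt[of i t] by simp

lemma wt_Suc_le: "wt (Suc i) s \<le> 2 * (gap + 2) * (2 * K + 1) * wt i t"
proof -
  have "wt (Suc i) s \<le> (\<Sum>r<run i s. 2 * (gap + 2) * wt i t)"
    unfolding wt.simps by (intro sum_mono wt_comparable)
  also have "\<dots> = run i s * (2 * (gap + 2) * wt i t)" by simp
  also have "\<dots> \<le> (2 * K + 1) * (2 * (gap + 2) * wt i t)" by (intro mult_right_mono run_le) auto
  finally show ?thesis by (simp only: mult_ac)
qed

text \<open>A node that is not last has at least two children, and the last of them weighs at least
  \<open>1 / (gap + 2)\<close> of an ordinary one.\<close>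

lemma W_growth: "real (W (Suc i) False) \<ge> (1 + 1 / real (gap + 2)) * real (W i False)"
proof -
  have "W i False + W i True \<le> W (Suc i) False"
    unfolding wt_Suc using m_ge[of i] by (cases "m i") (auto simp: run_def)
  moreover have "real (W i False) \<le> real (gap + 2) * real (W i True)"
    using W_False_le[of i] by (metis of_nat_le_iff of_nat_mult)
  then have "real (W i False) / real (gap + 2) \<le> real (W i True)" by (simp add: field_simps)
  ultimately show ?thesis by (simp add: distrib_right)
qed

text \<open>A lower bound for the probability of each single child; the denominator is the constant
  of \<open>wt_Suc_le\<close>.\<close>

definition p0 :: real where "p0 = 1 / (2 * (real gap + 2) * (2 * real K + 1))"

lemma p0_pos: "0 < p0"
  by (simp add: p0_def add_nonneg_pos)

lemma wt_ratio_ge: "p0 \<le> real (wt i t) / real (wt (Suc i) s)"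
proof -
  have "real (wt (Suc i) s) \<le> real (2 * (gap + 2) * (2 * K + 1) * wt i t)"
    using wt_Suc_le of_nat_le_iff by blast
  then have "real (wt (Suc i) s) \<le> 2 * (real gap + 2) * (2 * real K + 1) * real (wt i t)"
    by (simp only: of_nat_mult of_nat_add of_nat_numeral of_nat_1)
  then show ?thesis using wt_pos[of "Suc i" s] unfolding p0_def
    by (simp add: divide_simps mult_ac)
qed

lemma p_nonneg: "0 \<le> p i s t"
  by (auto simp: p_def intro!: sum_nonneg)

lemma p_ge: "r < run i s \<Longrightarrow> p0 \<le> p i s (child i s r)"
proof -
  assume r: "r < run i s"
  have "p0 \<le> (if child i s r = child i s r then real (wt i (child i s r)) / real (wt (Suc i) s) else 0)"
    using wt_ratio_ge by simp
  also have "\<dots> \<le> p i s (child i s r)"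
    unfolding p_def using r by (intro member_le_sum) auto
  finally show ?thesis .
qed

lemma sum_p: "(\<Sum>t\<in>UNIV. p i s t * h t) = (\<Sum>r<run i s. real (wt i (child i s r)) / real (wt (Suc i) s) * h (child i s r))"
proof -
  have "(\<Sum>t\<in>UNIV. p i s t * h t) = (\<Sum>r<run i s. \<Sum>t\<in>UNIV. (if child i s r = t then real (wt i t) / real (wt (Suc i) s) else 0) * h t)"
    unfolding p_def sum_distrib_right by (rule sum.swap)
  then show ?thesis by (simp add: if_distrib if_distribR cong: if_cong)
qed

lemma sum_p_complex: "(\<Sum>t\<in>UNIV. complex_of_real (p i s t) * h t) = (\<Sum>r<run i s. of_real (real (wt i (child i s r)) / real (wt (Suc i) s)) * h (child i s r))"
proof -
  have "(\<Sum>t\<in>UNIV. complex_of_real (p i s t) * h t) = (\<Sum>r<run i s. \<Sum>t\<in>UNIV. of_real (if child i s r = t then real (wt i t) / real (wt (Suc i) s) else 0) * h t)"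
    unfolding p_def of_real_sum sum_distrib_right by (rule sum.swap)
  also have "\<dots> = (\<Sum>r<run i s. \<Sum>t\<in>UNIV. if child i s r = t then of_real (real (wt i t) / real (wt (Suc i) s)) * h t else 0)"
    by (intro sum.cong) auto
  finally show ?thesis by simp
qed

lemma twist_p: "twist p b i z \<zeta> s = (\<Sum>r<run i s. of_real (real (wt i (child i s r)) / real (wt (Suc i) s)) * (exp (z * of_real (b i (child i s r))) * \<zeta> (child i s r)))"
  unfolding twist_def mult.assoc sum_p_complex ..

lemma p_sum: "(\<Sum>t\<in>UNIV. p i s t) = 1"
proof -
  have "(\<Sum>t\<in>UNIV. p i s t) = (\<Sum>r<run i s. real (wt i (child i s r)) / real (wt (Suc i) s))"
    using sum_p[of i s "\<lambda>_. 1"] by simp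
  also have "\<dots> = real (wt (Suc i) s) / real (wt (Suc i) s)"
    by (simp add: wt.simps(2) flip: sum_divide_distrib)
  finally show ?thesis using wt_pos[of "Suc i" s] by simp
qed

section \<open>Mixing: every state leads to every state in boundedly many steps\<close>

primrec reach :: "nat \<Rightarrow> nat \<Rightarrow> state \<Rightarrow> state \<Rightarrow> bool" where
  "reach i 0 s t \<longleftrightarrow> s = t"
| "reach i (Suc k) s t \<longleftrightarrow> (\<exists>r<run (i + k) s. reach i k (child (i + k) s r) t)"

lemma kernel_power_nonneg: "0 \<le> kernel_power p i k s t"
  by (induction k arbitrary: s) (auto intro!: sum_nonneg mult_nonneg_nonneg p_nonneg)

lemma reach_kernel_power: "reach i k s t \<Longrightarrow> p0 ^ k \<le> kernel_power p i k s t"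
proof (induction k arbitrary: s)
  case (Suc k)
  then obtain r where r: "r < run (i + k) s" "reach i k (child (i + k) s r) t" by auto
  have "p0 ^ Suc k \<le> p (i + k) s (child (i + k) s r) * kernel_power p i k (child (i + k) s r) t"
    unfolding power_Suc using p_ge[OF r(1)] Suc.IH[OF r(2)] p0_pos by (intro mult_mono) (auto simp: p_nonneg)
  also have "\<dots> \<le> kernel_power p i (Suc k) s t"
    unfolding kernel_power.simps
    by (rule member_le_sum[of "child (i + k) s r" UNIV "\<lambda>u. p (i + k) s u * kernel_power p i k u t"])
      (auto simp: p_nonneg kernel_power_nonneg)
  finally show ?case .
qed auto

text \<open>The first and the last child of an ordinary node are of the two kinds, and the bit
  \<open>d\<close> of the node is free to adjust the parity.\<close>

lemma step_False: "\<exists>d r. r < run i (d, False) \<and> child i (d, False) r = t"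
proof (cases t)
  case (Pair e l)
  show ?thesis
  proof (cases l)
    case True
    then show ?thesis unfolding Pair using m_ge[of i]
      by (intro exI[of _ "e = pos i"] exI[of _ "2 * m i - 1"]) (auto simp: child_def run_def)
  next
    case False
    then show ?thesis unfolding Pair using m_ge[of i]
      by (intro exI[of _ "e \<noteq> pos i"] exI[of _ 0]) (auto simp: child_def run_def)
  qed
qed

text \<open>A last node of a good level has at least three children, so \<open>r = 0\<close> and
  \<open>r = 1\<close> are both ordinary and have opposite bits.\<close>

lemma step_True_good:
  assumes "good i"
  shows "\<exists>r<run i (d, True). child i (d, True) r = (e, False)"
proof (cases "odd (of_bool d + of_bool (pos i) :: nat) = e")
  case True
  then show ?thesis using assms m_ge[of i] by (intro exI[of _ 0]) (auto simp: child_def run_def)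
next
  case False
  then show ?thesis using assms m_ge[of i] by (intro exI[of _ 1]) (auto simp: child_def run_def)
qed

lemma step_to_True: "\<exists>r<run i s. snd (child i s r)"
  using run_pos[of i s] by (intro exI[of _ "run i s - 1"]) (auto simp: child_def)

lemma reach_from_False: "\<exists>d. reach i (Suc k) (d, False) t"
proof (induction k)
  case 0
  then show ?case using step_False[of i t] by auto
next
  case (Suc k)
  then obtain d where "reach i (Suc k) (d, False) t" by blast
  moreover obtain d' r where "r < run (i + Suc k) (d', False)" "child (i + Suc k) (d', False) r = (d, False)"
    using step_False by blast
  ultimately show ?case by (subst reach.simps(2)) metis
qed

text \<open>Stay on last children down to level \<open>j\<close>, choose any ordinary child there
  and continue by \<open>reach_from_False\<close>, which needs at least one more level; hence
  \<open>i < j\<close>.\<close>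

lemma reach_from_True:
  assumes "i < j" "j < i + k" "good j" "snd s"
  shows "reach i k s t"
  using assms
proof (induction k arbitrary: s)
  case (Suc k)
  obtain d where s: "s = (d, True)" using Suc.prems by (cases s) auto
  show ?case
  proof (cases "j = i + k")
    case True
    with Suc.prems obtain k' where k': "k = Suc k'" by (cases k) auto
    obtain e where "reach i k (e, False) t" using reach_from_False unfolding k' by blast
    then show ?thesis using step_True_good[of "i + k" d e] Suc.prems True s by auto
  next
    case False
    obtain r where "r < run (i + k) s" "snd (child (i + k) s r)" using step_to_True by blast
    then show ?thesis using Suc False by (subst reach.simps(2)) (metis less_Suc_eq add_Suc_right)
  qed
qed simp

text \<open>One step moves to a last child; the next \<open>gap + 1\<close> levels contain a good
  one that is not the lowest.\<close>

lemma reach_all: "reach i (gap + 2) s t"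
proof -
  obtain j where j: "Suc i \<le> j" "j < Suc i + gap" "good j" using good_step by blast
  obtain r where r: "r < run (i + (gap + 1)) s" "snd (child (i + (gap + 1)) s r)" using step_to_True by blast
  have "reach i (gap + 1) (child (i + (gap + 1)) s r) t"
    by (rule reach_from_True[of i j]) (use j r in auto)
  with r(1) have "reach i (Suc (gap + 1)) s t" by (subst reach.simps(2)) blast
  then show ?thesis by (simp only: add_2_eq_Suc' add_Suc_right Suc_eq_plus1[symmetric])
qed

text \<open>From a node that is not last in its run there are two ways to reach the same state two levels
  below which differ in one parity bit only.\<close>

lemma twist_gain:
  assumes \<theta>: "\<bar>\<theta>\<bar> \<le> pi" and N: "\<And>s. norm (\<zeta> s) \<le> N"
  shows "norm (twist p b (Suc i) (\<i> * of_real \<theta>) (twist p b i (\<i> * of_real \<theta>) \<zeta>) (False, False)) \<le> (1 - p0\<^sup>2 / 16 * \<theta>\<^sup>2) * N"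
proof -
  let ?s = "(False, False)"
  define c1 where "c1 = (\<lambda>r :: nat \<times> nat. child (Suc i) ?s (fst r))"
  define c2 where "c2 = (\<lambda>r. child i (c1 r) (snd r))"
  define A where "A = Sigma {..<run (Suc i) ?s} (\<lambda>r. {..<run i (child (Suc i) ?s r)})"
  define w where "w r = real (wt i (c2 r)) / real (wt (Suc (Suc i)) ?s)" for r
  define x where "x r = b (Suc i) (c1 r) + b i (c2 r)" for r
  define f where "f r = complex_of_real (w r) * (exp (\<i> * of_real \<theta> * of_real (x r)) * \<zeta> (c2 r))" for r
  have finA: "finite A" by (simp add: A_def)
  have N0: "N \<ge> 0" using N[of ?s] norm_ge_zero order_trans by blast
  have w0: "w r \<ge> 0" for r by (simp add: w_def)
  have eq: "twist p b (Suc i) (\<i> * of_real \<theta>) (twist p b i (\<i> * of_real \<theta>) \<zeta>) ?s = (\<Sum>r\<in>A. f r)"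
  proof -
    have "(\<Sum>r\<in>A. f r) = (\<Sum>r<run (Suc i) ?s. \<Sum>r'<run i (child (Suc i) ?s r). f (r, r'))"
      unfolding A_def by (subst sum.Sigma) auto
    also have "\<dots> = twist p b (Suc i) (\<i> * of_real \<theta>) (twist p b i (\<i> * of_real \<theta>) \<zeta>) ?s"
      unfolding twist_p sum_distrib_left
    proof (intro sum.cong refl)
      fix r r'
      have "wt (Suc i) (child (Suc i) ?s r) \<noteq> 0" using wt_pos[of "Suc i" "child (Suc i) ?s r"] by linarith
      then show "f (r, r') = of_real (real (wt (Suc i) (child (Suc i) ?s r)) / real (wt (Suc (Suc i)) ?s)) *
          (exp (\<i> * of_real \<theta> * of_real (b (Suc i) (child (Suc i) ?s r))) *
            (of_real (real (wt i (child i (child (Suc i) ?s r) r')) / real (wt (Suc i) (child (Suc i) ?s r))) *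
              (exp (\<i> * of_real \<theta> * of_real (b i (child i (child (Suc i) ?s r) r'))) * \<zeta> (child i (child (Suc i) ?s r) r'))))"
        by (simp add: f_def w_def x_def c1_def c2_def exp_add distrib_left)
    qed
    finally show ?thesis by simp
  qed
  have sw: "(\<Sum>r\<in>A. w r) = 1"
  proof -
    have "(\<Sum>r\<in>A. w r) = (\<Sum>r<run (Suc i) ?s. \<Sum>r'<run i (child (Suc i) ?s r). w (r, r'))"
      unfolding A_def by (subst sum.Sigma) auto
    also have "\<dots> = (\<Sum>r<run (Suc i) ?s. real (wt (Suc i) (child (Suc i) ?s r)) / real (wt (Suc (Suc i)) ?s))"
      by (intro sum.cong refl) (simp add: w_def c1_def c2_def wt.simps(2)[of i] flip: sum_divide_distrib)
    also have "\<dots> = real (wt (Suc (Suc i)) ?s) / real (wt (Suc (Suc i)) ?s)"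
      by (simp add: wt.simps(2)[of "Suc i"] flip: sum_divide_distrib)
    finally show ?thesis using wt_pos[of "Suc (Suc i)" ?s] by simp
  qed
  \<comment> \<open>First and last child, each followed by its own last child. The upper bits are
    opposite. Below, the opposite parent bit is compensated by the run of a last child being one
    longer or shorter, so both paths end in the same state.\<close>
  define \<alpha> where "\<alpha> = (0 :: nat, run i (child (Suc i) ?s 0) - 1)"
  define \<beta> where "\<beta> = (2 * m (Suc i) - 1, run i (child (Suc i) ?s (2 * m (Suc i) - 1)) - 1)"
  have m1: "1 \<le> m (Suc i)" "1 \<le> m i" by (rule m_ge)+
  have \<alpha>A: "\<alpha> \<in> A" and \<beta>A: "\<beta> \<in> A" and ne: "\<alpha> \<noteq> \<beta>"
    using m1 run_pos[of i] by (auto simp: A_def \<alpha>_def \<beta>_def) (auto simp: run_def)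
  have c1: "c1 \<alpha> = (pos (Suc i), False)" "c1 \<beta> = (\<not> pos (Suc i), True)"
    using m1 by (auto simp: c1_def \<alpha>_def \<beta>_def child_def run_def)
  have c2: "c2 \<alpha> = c2 \<beta>"
    using m1 unfolding c2_def c1 by (auto simp: \<alpha>_def \<beta>_def child_def run_def)
  have b12: "b (Suc i) (c1 \<beta>) = - b (Suc i) (c1 \<alpha>)" by (auto simp: b_def c1)
  have b1: "\<bar>b (Suc i) (c1 \<alpha>)\<bar> = 1 / 2" using sg[of "Suc i"] by (auto simp: b_def c1 abs_mult simp flip: of_int_abs)
  \<comment> \<open>Equal weights and phases \<open>\<theta> / 2\<close>,
    \<open>- \<theta> / 2\<close> add to twice a cosine. The saving
    \<open>2 * w \<alpha> * \<theta>\<^sup>2 / 32\<close> explains the constant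
    \<open>p0\<^sup>2 / 16\<close>, because a two-step path has weight at least
    \<open>p0\<^sup>2\<close>.\<close>
  have pair: "norm (f \<alpha> + f \<beta>) \<le> w \<alpha> * (2 * (1 - \<theta>\<^sup>2 / 32)) * N"
  proof -
    define u where "u = b (Suc i) (c1 \<alpha>)"
    have "exp (\<i> * of_real \<theta> * of_real (x \<alpha>)) = exp (\<i> * of_real \<theta> * of_real (b i (c2 \<alpha>))) * exp (\<i> * of_real (\<theta> * u))"
      "exp (\<i> * of_real \<theta> * of_real (x \<beta>)) = exp (\<i> * of_real \<theta> * of_real (b i (c2 \<alpha>))) * exp (- (\<i> * of_real (\<theta> * u)))"
      unfolding exp_add[symmetric] x_def u_def c2 b12 by (rule arg_cong[where f = exp], simp add: algebra_simps)+
    moreover have "w \<beta> = w \<alpha>" by (simp add: w_def c2)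
    ultimately have "f \<alpha> + f \<beta> = of_real (w \<alpha>) * (exp (\<i> * of_real \<theta> * of_real (b i (c2 \<alpha>))) * ((exp (\<i> * of_real (\<theta> * u)) + exp (- (\<i> * of_real (\<theta> * u)))) * \<zeta> (c2 \<alpha>)))"
      unfolding f_def c2 by (simp only: distrib_left distrib_right mult.assoc)
    moreover have "exp (\<i> * complex_of_real (\<theta> * u)) + exp (- (\<i> * of_real (\<theta> * u))) = of_real (2 * cos (\<theta> * u))"
      by (simp add: cos_of_real [symmetric] cos_exp_eq)
    moreover have "u = 1 / 2 \<or> u = - (1 / 2)" using b1 by (auto simp: u_def abs_if split: if_splits)
    then have "cos (\<theta> * u) = cos (\<theta> / 2)"
      by (rule disjE) (simp_all only: times_divide_eq_right mult_1_right mult_minus_right cos_minus)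
    ultimately have "norm (f \<alpha> + f \<beta>) = w \<alpha> * \<bar>2 * cos (\<theta> / 2)\<bar> * norm (\<zeta> (c2 \<alpha>))"
      using w0 by (simp add: norm_mult abs_mult)
    also have "\<bar>2 * cos (\<theta> / 2)\<bar> = 2 * cos (\<theta> / 2)"
      using \<theta> cos_ge_zero[of "\<theta> / 2"] by simp
    also have "w \<alpha> * (2 * cos (\<theta> / 2)) * norm (\<zeta> (c2 \<alpha>)) \<le> w \<alpha> * (2 * (1 - \<theta>\<^sup>2 / 32)) * N"
    proof -
      have "0 \<le> cos (\<theta> / 2)" using cos_ge_zero[of "\<theta> / 2"] \<theta> by simp
      with cos_half_le[OF \<theta>] have c: "0 \<le> 2 * (1 - \<theta>\<^sup>2 / 32)" and d: "2 * cos (\<theta> / 2) \<le> 2 * (1 - \<theta>\<^sup>2 / 32)" by auto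
      show ?thesis
        by (rule mult_mono[OF mult_left_mono[OF d w0] N mult_nonneg_nonneg[OF w0 c] norm_ge_zero])
    qed
    finally show ?thesis .
  qed
  have sumA: "(\<Sum>r\<in>A. h r) = h \<alpha> + h \<beta> + (\<Sum>r\<in>A - {\<alpha>} - {\<beta>}. h r)" for h :: "nat \<times> nat \<Rightarrow> 'b :: comm_monoid_add"
    using sum.remove[OF finA \<alpha>A, of h] sum.remove[of "A - {\<alpha>}" \<beta> h] finA \<beta>A ne by (simp add: add_ac)
  have rest: "(\<Sum>r\<in>A - {\<alpha>} - {\<beta>}. w r) = 1 - 2 * w \<alpha>"
    using sumA[of w] sw c2 by (simp add: w_def)
  have "norm (\<Sum>r\<in>A - {\<alpha>} - {\<beta>}. f r) \<le> (\<Sum>r\<in>A - {\<alpha>} - {\<beta>}. w r * N)"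
    by (intro order.trans[OF norm_sum] sum_mono) (auto simp: f_def norm_mult w0 N intro!: mult_left_mono)
  also have "\<dots> = (1 - 2 * w \<alpha>) * N"
    using rest by (simp flip: sum_distrib_right)
  finally have R: "norm (\<Sum>r\<in>A - {\<alpha>} - {\<beta>}. f r) \<le> (1 - 2 * w \<alpha>) * N" .
  have "norm (\<Sum>r\<in>A. f r) \<le> w \<alpha> * (2 * (1 - \<theta>\<^sup>2 / 32)) * N + (1 - 2 * w \<alpha>) * N"
    unfolding sumA[of f] by (rule norm_triangle_le[OF add_mono[OF pair R]])
  also have "\<dots> = (1 - w \<alpha> / 16 * \<theta>\<^sup>2) * N" by (simp add: algebra_simps)
  also have "\<dots> \<le> (1 - p0\<^sup>2 / 16 * \<theta>\<^sup>2) * N"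
  proof -
    have "p0\<^sup>2 \<le> (real (wt i (c2 \<alpha>)) / real (wt (Suc i) ?s)) * (real (wt (Suc i) ?s) / real (wt (Suc (Suc i)) ?s))"
      unfolding power2_eq_square using p0_pos by (intro mult_mono wt_ratio_ge) auto
    also have "\<dots> = w \<alpha>" using wt_pos[of "Suc i" ?s] by (simp add: w_def)
    finally show ?thesis using N0 by (intro mult_right_mono diff_left_mono mult_right_mono) auto
  qed
  finally show ?thesis unfolding eq .
qed

lemma child_flip: "child i (flip s) r = flip (child i s r)"
  by (auto simp: child_def flip_def run_def)

sublocale additive_chain p b flip "gap + 2" "p0 ^ (gap + 2)" "p0\<^sup>2 / 16" "(False, False)"
proof
  show "p i (flip s) (flip t) = p i s t" for i s t
  proof -
    have "run i (flip s) = run i s" by (simp add: run_def flip_def)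
    moreover have "wt i (flip t) = wt i t" for i t
      by (rule wt_snd, simp add: flip_def)
    moreover have "flip u = flip t \<longleftrightarrow> u = t" for u by (cases u; cases t) (auto simp: flip_def)
    ultimately show ?thesis by (simp add: p_def child_flip cong: if_cong)
  qed
  show "\<bar>b i s\<bar> \<le> 1" for i s
    using sg[of i] by (auto simp: b_def abs_mult simp flip: of_int_abs)
  show "p0 ^ (gap + 2) \<le> kernel_power p i (gap + 2) s t" for i s t
    by (rule reach_kernel_power[OF reach_all])
  show "0 < p0 ^ (gap + 2)" "0 < p0\<^sup>2 / 16" using p0_pos by auto
  show "norm (twist p b (Suc i) (\<i> * of_real \<theta>) (twist p b i (\<i> * of_real \<theta>) \<zeta>) (False, False)) \<le> (1 - p0\<^sup>2 / 16 * \<theta>\<^sup>2) * N"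
    if "\<bar>\<theta>\<bar> \<le> pi" "\<And>s. norm (\<zeta> s) \<le> N" for \<theta> \<zeta> N i
    by (rule twist_gain[OF that])
qed (auto simp: p_nonneg p_sum flip_def b_def)

end

section \<open>Fourier inversion and the local limit theorem for full subtrees\<close>

lemma integrable_exp_minus_square:
  assumes "0 < (c::real)"
  shows "integrable lborel (\<lambda>x. exp (- (c * x\<^sup>2)))"
proof -
  have "integrable lborel (\<lambda>x. sqrt (2 * pi * (1 / sqrt (2 * c))\<^sup>2) * normal_density 0 (1 / sqrt (2 * c)) x)"
    by (intro integrable_mult_right integrable_normal_density) (use assms in auto)
  also have "(\<lambda>x. sqrt (2 * pi * (1 / sqrt (2 * c))\<^sup>2) * normal_density 0 (1 / sqrt (2 * c)) x) = (\<lambda>x. exp (- (c * x\<^sup>2)))"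
    using assms by (auto simp: normal_density_def power_divide)
  finally show ?thesis .
qed

text \<open>The characteristic function of the Gaussian is again Gaussian, so that formula read
  backwards is its inversion.\<close>

lemma std_normal_density_fourier:
  "complex_of_real (std_normal_density x) = of_real (1 / (2 * pi)) * (LINT \<tau>|lborel. of_real (exp (- \<tau>\<^sup>2 / 2)) * iexp (- (\<tau> * x)))"
proof -
  have "complex_of_real (exp (- x\<^sup>2 / 2)) = char std_normal_distribution (- x)"
    by (simp add: char_std_normal_distribution)
  also have "\<dots> = (LINT \<tau>|lborel. std_normal_density \<tau> *\<^sub>R iexp (- x * \<tau>))"
    unfolding char_def by (subst integral_density) (auto simp: normal_density_nonneg)
  also have "\<dots> = (LINT \<tau>|lborel. of_real (1 / sqrt (2 * pi)) * (of_real (exp (- \<tau>\<^sup>2 / 2)) * iexp (- (\<tau> * x))))"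
    by (intro Bochner_Integration.integral_cong refl) (simp add: std_normal_density_def scaleR_conv_of_real mult_ac)
  also have "\<dots> = of_real (1 / sqrt (2 * pi)) * (LINT \<tau>|lborel. of_real (exp (- \<tau>\<^sup>2 / 2)) * iexp (- (\<tau> * x)))"
    by (rule integral_mult_right_zero)
  finally have "complex_of_real (1 / sqrt (2 * pi)) * of_real (exp (- x\<^sup>2 / 2)) = of_real (1 / sqrt (2 * pi) * (1 / sqrt (2 * pi))) * (LINT \<tau>|lborel. of_real (exp (- \<tau>\<^sup>2 / 2)) * iexp (- (\<tau> * x)))"
    by (simp only: of_real_mult mult.assoc)
  moreover have "1 / sqrt (2 * pi) * (1 / sqrt (2 * pi)) = 1 / (2 * pi)" by simp
  ultimately show ?thesis unfolding std_normal_density_def by (simp only: of_real_mult)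
qed

lemma has_integral_iexp_int:
  "((\<lambda>\<theta>. iexp (- (\<theta> * of_int y))) has_integral of_real (2 * pi * of_bool (y = 0))) {- pi..pi}"
proof (cases "y = 0")
  case True
  then show ?thesis using has_integral_const_real[of "1::complex" "- pi" pi] by (simp add: scaleR_conv_of_real)
next
  case False
  define F where "F = (\<lambda>\<theta>. iexp (- (\<theta> * real_of_int y)) / (- \<i> * of_int y))"
  have "((\<lambda>\<theta>. iexp (- (\<theta> * of_int y))) has_integral (F pi - F (- pi))) {- pi..pi}"
  proof (rule fundamental_theorem_of_calculus)
    fix x assume "x \<in> {- pi..pi}"
    have "((\<lambda>\<theta>. exp (- \<i> * of_int y * \<theta>) / (- \<i> * of_int y)) has_field_derivative exp (- \<i> * of_int y * of_real x)) (at (complex_of_real x))"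
      using False by (auto intro!: derivative_eq_intros)
    then have "((\<lambda>\<theta>. exp (- \<i> * of_int y * of_real \<theta>) / (- \<i> * of_int y)) has_vector_derivative exp (- \<i> * of_int y * of_real x)) (at x within {- pi..pi})"
      by (rule has_vector_derivative_real_field)
    then show "(F has_vector_derivative iexp (- (x * of_int y))) (at x within {- pi..pi})"
      by (simp add: F_def mult_ac)
  qed simp
  moreover have "F pi = F (- pi)"
  proof -
    have "iexp (- (pi * real_of_int y)) = iexp (- (- pi * real_of_int y))"
      by (simp add: exp_eq) (intro exI[of _ "- y"], simp)
    then show ?thesis by (simp only: F_def)
  qed
  ultimately show ?thesis using False by simp
qed

lemma bounded_increments:
  fixes V :: "nat \<Rightarrow> real"
  assumes "\<And>J. \<bar>V (Suc J) - V J\<bar> \<le> C"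
  shows "\<bar>V J - V J'\<bar> \<le> C * \<bar>real J - real J'\<bar>"
proof -
  have *: "\<bar>V (J + i) - V J\<bar> \<le> C * real i" for J i
  proof (induction i)
    case (Suc i)
    then show ?case using assms[of "J + i"] by (simp add: algebra_simps)
  qed simp
  show ?thesis
  proof (cases "J \<le> J'")
    case True
    then show ?thesis using *[of J "J' - J"] by (simp add: of_nat_diff abs_minus_commute)
  next
    case False
    then show ?thesis using *[of J' "J - J'"] by (simp add: of_nat_diff)
  qed
qed

context renormalization_tree
begin

text \<open>What centring the bits at 1/2 has removed from the signed sum.\<close>

definition center :: "nat \<Rightarrow> real" where
  "center J = (\<Sum>k<J. of_int (sg k)) / 2"

lemma wt_mgf_Suc:
  "of_nat (wt (Suc i) s) * mgf (Suc i) z s =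
    (\<Sum>r<run i s. exp (z * of_real (b i (child i s r))) * (of_nat (wt i (child i s r)) * mgf i z (child i s r)))"
  using wt_pos[of "Suc i" s] by (simp add: twist_p sum_distrib_left mult_ac)

text \<open>\<open>center\<close> may be half-integral, but it cancels against the centring inside
  \<open>mgf\<close>, so the integrand is a trigonometric polynomial with integer frequencies. The
  induction follows the recursion of \<open>cnt\<close> down to orthogonality of the
  exponentials.\<close>

lemma cnt_fourier:
  "((\<lambda>\<theta>. of_nat (wt J s) * mgf J (\<i> * of_real \<theta>) s * iexp (- (\<theta> * (of_int y - center J)))) has_integral of_real (2 * pi * real (cnt J s y))) {- pi..pi}"
proof (induction J arbitrary: s y)
  case 0
  then show ?case using has_integral_iexp_int[of y] by (simp add: center_def)
next
  case (Suc i)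
  define y' where "y' r = y - sg i * of_bool (fst (child i s r))" for r
  have "((\<lambda>\<theta>. \<Sum>r<run i s. of_nat (wt i (child i s r)) * mgf i (\<i> * of_real \<theta>) (child i s r) * iexp (- (\<theta> * (of_int (y' r) - center i))))
     has_integral (\<Sum>r<run i s. of_real (2 * pi * real (cnt i (child i s r) (y' r))))) {- pi..pi}"
    by (intro has_integral_sum Suc) auto
  moreover have "(\<Sum>r<run i s. of_nat (wt i (child i s r)) * mgf i (\<i> * of_real \<theta>) (child i s r) * iexp (- (\<theta> * (of_int (y' r) - center i))))
     = of_nat (wt (Suc i) s) * mgf (Suc i) (\<i> * of_real \<theta>) s * iexp (- (\<theta> * (of_int y - center (Suc i))))" for \<theta>
    unfolding wt_mgf_Suc sum_distrib_right
  proof (intro sum.cong refl)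
    fix r
    have "iexp (- (\<theta> * (of_int (y' r) - center i))) = exp (\<i> * of_real \<theta> * of_real (b i (child i s r))) * iexp (- (\<theta> * (of_int y - center (Suc i))))"
      unfolding exp_add[symmetric]
      by (rule arg_cong[where f = exp]) (simp add: y'_def b_def center_def algebra_simps add_divide_distrib)
    then show "of_nat (wt i (child i s r)) * mgf i (\<i> * of_real \<theta>) (child i s r) * iexp (- (\<theta> * (of_int (y' r) - center i)))
       = exp (\<i> * of_real \<theta> * of_real (b i (child i s r))) * (of_nat (wt i (child i s r)) * mgf i (\<i> * of_real \<theta>) (child i s r)) * iexp (- (\<theta> * (of_int y - center (Suc i))))"
      by (simp only: mult_ac)
  qed
  ultimately show ?case by (simp add: y'_def sum_distrib_left del: mgf.simps)
qed

lemma continuous_mgf: "continuous_on A (\<lambda>\<theta>. mgf J (\<i> * of_real \<theta>) s)"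
  by (rule continuous_on_compose2[OF holomorphic_on_imp_continuous_on[OF holomorphic_mgf[of J s UNIV]]])
    (auto intro!: continuous_intros)

lemma cnt_eq_LINT:
  assumes v: "0 < v"
  shows "complex_of_real (v * real (cnt J s y) / real (wt J s)) =
     of_real (1 / (2 * pi)) * (LINT \<tau>|lborel. indicator {- pi..pi} (\<tau> / v) *\<^sub>R (mgf J (\<i> * of_real (\<tau> / v)) s) * iexp (- (\<tau> * ((of_int y - center J) / v))))"
proof -
  define f where "f = (\<lambda>\<theta>. mgf J (\<i> * of_real \<theta>) s * iexp (- (\<theta> * (of_int y - center J))))"
  have "(f has_integral of_real (2 * pi * real (cnt J s y)) / of_nat (wt J s)) {- pi..pi}"
  proof -
    have "((\<lambda>\<theta>. of_nat (wt J s) * mgf J (\<i> * of_real \<theta>) s * iexp (- (\<theta> * (of_int y - center J))) / of_nat (wt J s)) has_integral of_real (2 * pi * real (cnt J s y)) / of_nat (wt J s)) {- pi..pi}"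
      by (rule has_integral_divide[OF cnt_fourier])
    then show ?thesis using wt_pos[of J s] by (simp add: f_def)
  qed
  moreover have si: "set_integrable lborel {- pi..pi} f"
    unfolding f_def by (intro borel_integrable_atLeastAtMost' continuous_intros continuous_mgf)
  ultimately have "complex_of_real (2 * pi * real (cnt J s y)) / of_nat (wt J s) = (LINT \<theta>:{- pi..pi}|lborel. f \<theta>)"
    by (simp add: set_borel_integral_eq_integral(2) integral_unique)
  also have "\<dots> = \<bar>1 / v\<bar> *\<^sub>R (LINT \<tau>|lborel. indicator {- pi..pi} (0 + 1 / v * \<tau>) *\<^sub>R f (0 + 1 / v * \<tau>))"
    unfolding set_lebesgue_integral_def by (rule lborel_integral_real_affine) (use v in auto)
  also have "(LINT \<tau>|lborel. indicator {- pi..pi} (0 + 1 / v * \<tau>) *\<^sub>R f (0 + 1 / v * \<tau>)) =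
    (LINT \<tau>|lborel. indicator {- pi..pi} (\<tau> / v) *\<^sub>R (mgf J (\<i> * of_real (\<tau> / v)) s) * iexp (- (\<tau> * ((of_int y - center J) / v))))"
    by (intro Bochner_Integration.integral_cong refl) (simp add: f_def)
  finally show ?thesis using v by (simp add: scaleR_conv_of_real field_simps)
qed

text \<open>Inversion bounds the error for every \<open>y\<close> by the L1 distance between the
  rescaled characteristic function and the Gaussian, which makes uniformity in \<open>y\<close>
  automatic. Uniformity in \<open>s\<close> costs a sum over four states.\<close>

lemma local_limit:
  "\<exists>(V :: nat \<Rightarrow> real) e. \<exists>C>0. \<exists>c>0. (\<forall>J. \<bar>V (Suc J) - V J\<bar> \<le> C) \<and> (\<forall>\<^sub>F J in sequentially. V J \<ge> c * real J)
     \<and> e \<longlonglongrightarrow> 0 \<and> (\<forall>\<^sub>F J in sequentially. \<forall>s y.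
        \<bar>sqrt (V J) * real (cnt J s y) / real (wt J s) - std_normal_density ((of_int y - center J) / sqrt (V J))\<bar> \<le> e J)"
proof -
  obtain V C c where C: "C > 0" and c: "c > 0" and V1: "\<And>J. \<bar>V (Suc J) - V J\<bar> \<le> C"
    and Vc: "\<forall>\<^sub>F J in sequentially. V J \<ge> c * real J"
    and decay: "\<And>J \<theta> s. \<bar>\<theta>\<bar> \<le> pi \<Longrightarrow> norm (mgf J (\<i> * of_real \<theta>) s) \<le> C * exp (- (c * real J * \<theta>\<^sup>2))"
    and lim: "\<And>s \<tau>. (\<lambda>J. mgf J (\<i> * of_real (\<tau> / sqrt (V J))) s) \<longlonglongrightarrow> of_real (exp (- \<tau>\<^sup>2 / 2))"
    using central_limit by blast
  have Vle: "V J \<le> \<bar>V 0\<bar> + C * real J" for J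
    using bounded_increments[of V C J 0, OF V1] by simp
  \<comment> \<open>After rescaling the decay exponent is \<open>c * J / V J\<close> times
    \<open>\<tau>\<^sup>2\<close>; since \<open>V\<close> grows at most linearly, \<open>c3\<close>
    is a lower bound for the factor and gives a majorant free of \<open>J\<close>.\<close>
  define c3 where "c3 = c / (\<bar>V 0\<bar> + C)"
  have c3: "c3 > 0" using c C by (simp add: c3_def add_nonneg_pos)
  have Vpos: "\<forall>\<^sub>F J in sequentially. 0 < V J \<and> c3 \<le> c * real J / V J"
    using Vc eventually_ge_at_top[of 1]
  proof eventually_elim
    case (elim J)
    then have V: "0 < V J" using c by (intro less_le_trans[OF _ elim(1)] mult_pos_pos) auto
    have "V J \<le> (\<bar>V 0\<bar> + C) * real J"
      using Vle[of J] elim mult_left_mono[of 1 "real J" "\<bar>V 0\<bar>"] by (simp add: algebra_simps)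
    then have "c3 * V J \<le> c3 * ((\<bar>V 0\<bar> + C) * real J)" using c3 by (intro mult_left_mono) auto
    also have "\<dots> = c * real J" using C by (simp add: c3_def)
    finally show ?case using V by (simp add: field_simps)
  qed
  define F where "F J s \<tau> = indicator {- pi..pi} (\<tau> / sqrt (V J)) *\<^sub>R mgf J (\<i> * of_real (\<tau> / sqrt (V J))) s" for J s \<tau>
  define G where "G \<tau> = complex_of_real (exp (- \<tau>\<^sup>2 / 2))" for \<tau>
  define e0 where "e0 s J = (LINT \<tau>|lborel. norm (F J s \<tau> - G \<tau>))" for s J
  define H where "H \<tau> = C * exp (- (c3 * \<tau>\<^sup>2)) + exp (- (1 / 2 * \<tau>\<^sup>2))" for \<tau>
  have intH: "integrable lborel H"
    unfolding H_def using c3 by (intro Bochner_Integration.integrable_add integrable_mult_right integrable_exp_minus_square) auto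
  have intG: "integrable lborel G"
    using integrable_exp_minus_square[of "1 / 2"] unfolding G_def by (intro integrable_of_real) simp
  have measF: "F J s \<in> borel_measurable lborel" for J s
  proof -
    have "(\<lambda>\<theta>. mgf J (\<i> * of_real \<theta>) s) \<in> borel_measurable borel"
      by (intro borel_measurable_continuous_onI continuous_mgf)
    then have "(\<lambda>\<tau>. mgf J (\<i> * of_real (\<tau> / sqrt (V J))) s) \<in> borel_measurable borel"
      by (rule measurable_compose[rotated]) simp
    then show ?thesis unfolding F_def by simp
  qed
  have bF: "norm (F J s \<tau>) \<le> C * exp (- (c3 * \<tau>\<^sup>2))" if J: "0 < V J" "c3 \<le> c * real J / V J" for J s \<tau>
  proof (cases "\<tau> / sqrt (V J) \<in> {- pi..pi}")
    case True
    then have "\<bar>\<tau> / sqrt (V J)\<bar> \<le> pi" unfolding atLeastAtMost_iff by linarith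
    from decay[OF this, of J s] True have "norm (F J s \<tau>) \<le> C * exp (- (c * real J * (\<tau> / sqrt (V J))\<^sup>2))"
      by (simp add: F_def)
    also have "\<dots> \<le> C * exp (- (c3 * \<tau>\<^sup>2))"
      using mult_right_mono[OF J(2), of "\<tau>\<^sup>2"] J C by (simp add: power_divide)
    finally show ?thesis .
  qed (use C in \<open>simp add: F_def\<close>)
  have e0: "e0 s \<longlonglongrightarrow> 0" for s
  proof -
    obtain J0 where J0: "\<And>J. J \<ge> J0 \<Longrightarrow> 0 < V J \<and> c3 \<le> c * real J / V J"
      using Vpos by (auto simp: eventually_sequentially)
    have "(\<lambda>J. LINT \<tau>|lborel. norm (F (J + J0) s \<tau> - G \<tau>)) \<longlonglongrightarrow> (LINT \<tau>::real|lborel. 0)"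
    proof (rule integral_dominated_convergence[where w = H])
      show "AE \<tau> in lborel. (\<lambda>J. norm (F (J + J0) s \<tau> - G \<tau>)) \<longlonglongrightarrow> 0"
      proof (intro AE_I2)
        fix \<tau> :: real
        have Vinf: "filterlim V at_top sequentially"
          by (rule filterlim_at_top_mono[OF _ Vc]) (use c in real_asymp)
        have "filterlim (\<lambda>J. pi * sqrt (V J)) at_top sequentially"
          by (intro filterlim_tendsto_pos_mult_at_top[OF tendsto_const] filterlim_compose[OF sqrt_at_top Vinf]) auto
        then have "\<forall>\<^sub>F J in sequentially. \<bar>\<tau>\<bar> \<le> pi * sqrt (V J)" by (simp add: filterlim_at_top)
        with Vpos have "\<forall>\<^sub>F J in sequentially. mgf J (\<i> * of_real (\<tau> / sqrt (V J))) s = F J s \<tau>"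
        proof eventually_elim
          case (elim J)
          then have "\<tau> / sqrt (V J) \<in> {- pi..pi}" by (auto simp: field_simps abs_le_iff)
          then show ?case by (simp add: F_def)
        qed
        then have "(\<lambda>J. F J s \<tau>) \<longlonglongrightarrow> G \<tau>"
          using lim[of \<tau> s] unfolding G_def by (rule Lim_transform_eventually[rotated])
        then have "(\<lambda>J. norm (F J s \<tau> - G \<tau>)) \<longlonglongrightarrow> 0"
          by (simp add: LIM_zero tendsto_norm_zero)
        then show "(\<lambda>J. norm (F (J + J0) s \<tau> - G \<tau>)) \<longlonglongrightarrow> 0"
          by (rule LIMSEQ_ignore_initial_segment)
      qed
      show "AE \<tau> in lborel. norm (norm (F (J + J0) s \<tau> - G \<tau>)) \<le> H \<tau>" for J
      proof (intro AE_I2)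
        fix \<tau> :: real
        have "norm (F (J + J0) s \<tau> - G \<tau>) \<le> norm (F (J + J0) s \<tau>) + norm (G \<tau>)" by (rule norm_triangle_ineq4)
        also have "\<dots> \<le> H \<tau>" unfolding H_def
          using bF[of "J + J0" s \<tau>] J0[of "J + J0"] by (intro add_mono) (auto simp: G_def)
        finally show "norm (norm (F (J + J0) s \<tau> - G \<tau>)) \<le> H \<tau>" by simp
      qed
    qed (use measF intG intH in auto)
    then have "(\<lambda>J. e0 s (J + J0)) \<longlonglongrightarrow> 0" by (simp add: e0_def)
    then show ?thesis by (rule LIMSEQ_offset)
  qed
  define e where "e J = 1 / (2 * pi) * (\<Sum>s\<in>UNIV. e0 s J)" for J
  have elim0: "e \<longlonglongrightarrow> 0" unfolding e_def
    by (intro tendsto_mult_right_zero tendsto_null_sum e0)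
  have "\<forall>\<^sub>F J in sequentially. \<forall>s y.
        \<bar>sqrt (V J) * real (cnt J s y) / real (wt J s) - std_normal_density ((of_int y - center J) / sqrt (V J))\<bar> \<le> e J"
    using Vpos
  proof (eventually_elim, intro allI)
    case (elim J)
    fix s y
    have J: "0 < V J" "c3 \<le> c * real J / V J" using elim by auto
    define x where "x = (of_int y - center J) / sqrt (V J)"
    have HF: "norm (F J s \<tau>) \<le> norm (H \<tau>)" for \<tau>
    proof -
      have "norm (F J s \<tau>) \<le> H \<tau>" unfolding H_def by (rule order.trans[OF bF[OF J]]) simp
      then show ?thesis using abs_ge_self[of "H \<tau>"] by simp
    qed
    have intF: "integrable lborel (F J s)"
      by (rule Bochner_Integration.integrable_bound[OF intH measF]) (use HF in auto)
    have intFx: "integrable lborel (\<lambda>\<tau>. F J s \<tau> * iexp (- (\<tau> * x)))"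
      by (rule Bochner_Integration.integrable_bound[OF intF]) (use measF in \<open>auto simp: norm_mult\<close>)
    have intGx: "integrable lborel (\<lambda>\<tau>. G \<tau> * iexp (- (\<tau> * x)))"
      by (rule Bochner_Integration.integrable_bound[OF intG]) (use intG in \<open>auto simp: norm_mult\<close>)
    have "complex_of_real (sqrt (V J) * real (cnt J s y) / real (wt J s) - std_normal_density x) =
       of_real (1 / (2 * pi)) * (LINT \<tau>|lborel. F J s \<tau> * iexp (- (\<tau> * x)) - G \<tau> * iexp (- (\<tau> * x)))"
      unfolding of_real_diff cnt_eq_LINT[OF real_sqrt_gt_zero[OF J(1)]] std_normal_density_fourier
        Bochner_Integration.integral_diff[OF intFx intGx] right_diff_distrib
      by (simp only: F_def G_def x_def)
    then have "\<bar>sqrt (V J) * real (cnt J s y) / real (wt J s) - std_normal_density x\<bar> =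
      1 / (2 * pi) * norm (LINT \<tau>|lborel. F J s \<tau> * iexp (- (\<tau> * x)) - G \<tau> * iexp (- (\<tau> * x)))"
      by (metis (no_types, lifting) norm_mult norm_of_real abs_of_nonneg divide_nonneg_nonneg mult_nonneg_nonneg pi_ge_zero zero_le_numeral zero_le_one)
    also have "\<dots> \<le> 1 / (2 * pi) * (LINT \<tau>|lborel. norm (F J s \<tau> * iexp (- (\<tau> * x)) - G \<tau> * iexp (- (\<tau> * x))))"
      by (intro mult_left_mono integral_norm_bound) auto
    also have "(LINT \<tau>|lborel. norm (F J s \<tau> * iexp (- (\<tau> * x)) - G \<tau> * iexp (- (\<tau> * x)))) = e0 s J"
      unfolding e0_def by (intro Bochner_Integration.integral_cong refl) (simp add: norm_mult flip: left_diff_distrib)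
    also have "1 / (2 * pi) * e0 s J \<le> e J" unfolding e_def
      by (intro mult_left_mono member_le_sum) (auto simp: e0_def)
    finally show "\<bar>sqrt (V J) * real (cnt J s y) / real (wt J s) - std_normal_density ((of_int y - center J) / sqrt (V J))\<bar> \<le> e J"
      by (simp add: x_def)
  qed
  with C c V1 Vc elim0 show ?thesis by blast
qed

end

section \<open>Badly approximable numbers and even continued fractions\<close>

text \<open>The indices are shifted by one, so that the recursion starts with the formal convergent \<open>1/0\<close>.\<close>

fun cden :: "(nat \<Rightarrow> int) \<Rightarrow> nat \<Rightarrow> int" where
  "cden a 0 = 0"
| "cden a (Suc 0) = 1"
| "cden a (Suc (Suc k)) = a (Suc k) * cden a (Suc k) + cden a k"

fun cnum :: "(nat \<Rightarrow> int) \<Rightarrow> nat \<Rightarrow> int" where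
  "cnum a 0 = 1"
| "cnum a (Suc 0) = a 0"
| "cnum a (Suc (Suc k)) = a (Suc k) * cnum a (Suc k) + cnum a k"

definition cerr :: "(nat \<Rightarrow> int) \<Rightarrow> real \<Rightarrow> nat \<Rightarrow> real" where
  "cerr a y k = of_int (cden a k) * y - of_int (cnum a k)"

lemma cden_cnum_det: "cden a (Suc k) * cnum a k - cden a k * cnum a (Suc k) = (- 1) ^ k"
  by (induction k) (auto simp: algebra_simps)

lemma cden_cerr_det:
  "of_int (cden a (Suc k)) * cerr a y k - of_int (cden a k) * cerr a y (Suc k) = - ((- 1) ^ k)"
proof -
  have "of_int (cden a (Suc k)) * cerr a y k - of_int (cden a k) * cerr a y (Suc k)
     = - real_of_int (cden a (Suc k) * cnum a k - cden a k * cnum a (Suc k))"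
    by (simp add: cerr_def algebra_simps)
  then show ?thesis by (simp only: cden_cnum_det) simp
qed

text \<open>Stated for an arbitrary expansion with quotients \<open>y\<close> and remainders
  \<open>x\<close>, so that it serves the regular and the even continued fraction alike.\<close>

lemma cerr_Suc:
  assumes "\<And>k. y k = of_int (a k) + x k" "\<And>k. x k \<noteq> 0" "\<And>k. y (Suc k) = 1 / x k"
  shows "cerr a (y 0) (Suc k) = - x k * cerr a (y 0) k"
proof (induction k)
  case 0
  then show ?case using assms(1)[of 0] by (simp add: cerr_def)
next
  case (Suc k)
  have "1 / x k = of_int (a (Suc k)) + x (Suc k)" using assms(1)[of "Suc k"] assms(3)[of k] by simp
  then have "1 = (of_int (a (Suc k)) + x (Suc k)) * x k" using assms(2)[of k] by (simp add: field_simps)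
  then have "cerr a (y 0) k = - (of_int (a (Suc k)) + x (Suc k)) * cerr a (y 0) (Suc k)"
    unfolding Suc by (metis (no_types, lifting) minus_mult_minus mult.assoc mult_1)
  moreover have "cerr a (y 0) (Suc (Suc k)) = of_int (a (Suc k)) * cerr a (y 0) (Suc k) + cerr a (y 0) k"
    by (simp add: cerr_def algebra_simps)
  ultimately show ?case by (simp add: algebra_simps)
qed

lemma frac_irrational: "x \<notin> \<rat> \<Longrightarrow> frac x \<notin> \<rat>" for x :: real
  by (metis Rats_add Rats_of_int frac_def add.commute diff_add_cancel)

lemma frac_pos_irrational: "x \<notin> \<rat> \<Longrightarrow> 0 < frac x" for x :: real
  by (metis Ints_subset_Rats frac_gt_0_iff subsetD)

lemma complete_quotient_irrational: "x \<notin> \<rat> \<Longrightarrow> complete_quotient x k \<notin> \<rat>"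
proof (induction k)
  case (Suc k)
  then have "frac (complete_quotient x k) \<notin> \<rat>" using frac_irrational by blast
  then show ?case by (metis Rats_divide Rats_1 complete_quotient.simps(2) divide_divide_eq_right mult_1 div_by_1)
qed auto

text \<open>For \<open>q\<close> between two consecutive denominators, \<open>(p, q)\<close> is an
  integral combination of the two convergents with coefficients \<open>u\<close>, \<open>v\<close>
  not both of the same strict sign. The errors of the convergents alternate, so the contributions
  add and the error of \<open>p / q\<close> is at least that of the lower convergent.\<close>

lemma bounded_type_badly_approximable:
  assumes "bounded_type \<alpha>"
  shows "\<exists>c>0. \<forall>p q :: int. q \<noteq> 0 \<longrightarrow> c \<le> \<bar>of_int q\<bar> * \<bar>of_int q * \<alpha> - of_int p\<bar>"
proof -
  obtain M where irr: "\<alpha> \<notin> \<rat>" and M: "\<And>k. \<bar>partial_quotient \<alpha> k\<bar> \<le> M"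
    using assms by (auto simp: bounded_type_def)
  define y where "y = complete_quotient \<alpha>"
  define a where "a = partial_quotient \<alpha>"
  define x where "x k = frac (y k)" for k
  have y: "y k = of_int (a k) + x k" "y (Suc k) = 1 / x k" for k
    by (simp_all add: y_def a_def x_def partial_quotient_def frac_def)
  have x: "0 < x k" "x k < 1" for k
    unfolding x_def y_def using frac_pos_irrational[OF complete_quotient_irrational[OF irr]] frac_lt_1 by auto
  then have x0: "x k \<noteq> 0" for k by (metis less_irrefl)
  have y0: "y 0 = \<alpha>" by (simp add: y_def)
  have a: "1 \<le> a (Suc k)" for k
  proof -
    have "1 \<le> 1 / x k" using x[of k] by simp
    then show ?thesis using y(2)[of k] by (simp add: a_def y_def partial_quotient_def le_floor_iff)
  qed
  have aM: "a k \<le> M" for k using M[of k] by (simp add: a_def)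
  note E = cerr_Suc[where y = y and a = a and x = x, OF y(1) x0 y(2), unfolded y0]
  have den: "0 \<le> cden a k \<and> int k \<le> cden a (Suc k) \<and> 1 \<le> cden a (Suc k) \<and> cden a k \<le> cden a (Suc k) \<and> (k = 0 \<or> 1 \<le> cden a k)" for k
  proof (induction k)
    case (Suc k)
    have "cden a (Suc k) \<le> a (Suc k) * cden a (Suc k)"
      using Suc a[of k] by simp
    with Suc show ?case unfolding cden.simps by (elim conjE, intro conjI disjI2; elim disjE; linarith)
  qed auto
  have M2: "0 < M + 2" using a[of 0] aM[of 1] by simp
  have main: "1 / of_int (M + 2) \<le> of_int q * \<bar>of_int q * \<alpha> - of_int p\<bar>" if q: "1 \<le> q" for p q :: int
  proof -
    define j where "j = (LEAST j. q < cden a j)"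
    have "\<exists>j. q < cden a j" using den[of "nat q + 1"] q by (intro exI[of _ "Suc (nat q + 1)"]) auto
    then have j: "q < cden a j" unfolding j_def by (rule LeastI_ex)
    have "\<not> q < cden a i" if "i < j" for i using that unfolding j_def by (rule not_less_Least)
    then have j': "cden a i \<le> q" if "i < j" for i using that by fastforce
    obtain k where k: "j = Suc (Suc k)"
    proof -
      have "j \<noteq> 0" using j q by (metis cden.simps(1) not_less order.trans zero_le_one)
      moreover have "j \<noteq> Suc 0" using j q by (metis cden.simps(2) not_less)
      ultimately show thesis using that by (metis not0_implies_Suc)
    qed
    define A B where "A = cden a (Suc k)" and "B = cden a (Suc (Suc k))"
    have AB: "1 \<le> A" "A \<le> q" "q < B" "A \<le> B" using den[of k] den[of "Suc k"] j j'[of "Suc k"] k by (auto simp: A_def B_def)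
    define e where "e = (- 1 :: int) ^ Suc k"
    have e: "e * e = 1" by (simp add: e_def flip: power_mult_distrib)
    have det: "B * cnum a (Suc k) - A * cnum a (Suc (Suc k)) = e"
      using cden_cnum_det[of a "Suc k"] by (simp only: A_def B_def e_def)
    \<comment> \<open>Cramer's rule; \<open>e\<close> is the determinant, of square 1.\<close>
    define u v where "u = e * (B * p - cnum a (Suc (Suc k)) * q)" and "v = e * (cnum a (Suc k) * q - A * p)"
    have "u * A + v * B = e * (q * (B * cnum a (Suc k) - A * cnum a (Suc (Suc k))))"
      by (simp add: u_def v_def algebra_simps)
    then have q_eq: "q = u * A + v * B" using det e by (simp add: mult.left_commute)
    have "u * cnum a (Suc k) + v * cnum a (Suc (Suc k)) = e * (p * (B * cnum a (Suc k) - A * cnum a (Suc (Suc k))))"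
      by (simp add: u_def v_def algebra_simps)
    then have p_eq: "p = u * cnum a (Suc k) + v * cnum a (Suc (Suc k))" using det e by (simp add: mult.left_commute)
    define D where "D = cerr a \<alpha> (Suc k)"
    have D1: "cerr a \<alpha> (Suc (Suc k)) = - x (Suc k) * D" unfolding D_def by (rule E)
    have err: "of_int q * \<alpha> - of_int p = D * (of_int u - x (Suc k) * of_int v)"
    proof -
      have "of_int q * \<alpha> - of_int p = of_int u * cerr a \<alpha> (Suc k) + of_int v * cerr a \<alpha> (Suc (Suc k))"
        by (subst q_eq, subst p_eq) (simp add: cerr_def A_def B_def algebra_simps)
      then show ?thesis unfolding D1 by (simp add: D_def algebra_simps)
    qed
    have uv: "1 \<le> \<bar>of_int u - x (Suc k) * of_int v\<bar>"
    proof -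
      have up: "1 \<le> u \<and> v \<le> 0 \<or> u \<le> - 1 \<and> 0 \<le> v"
      proof (cases "v \<ge> 1")
        case True
        then have "B \<le> v * B" using AB by simp
        then have "u * A < 0" using q_eq AB by linarith
        then show ?thesis using True AB by (auto simp: mult_less_0_iff)
      next
        case False
        then have "v * B \<le> 0" using AB by (simp add: mult_le_0_iff)
        then have "u * A > 0" using q_eq AB by linarith
        then show ?thesis using False AB by (auto simp: zero_less_mult_iff)
      qed
      then show ?thesis
      proof
        assume "1 \<le> u \<and> v \<le> 0"
        then have "1 \<le> real_of_int u" "x (Suc k) * of_int v \<le> 0" using x[of "Suc k"] by (auto simp: mult_le_0_iff)
        then show ?thesis by linarith
      next
        assume "u \<le> - 1 \<and> 0 \<le> v"
        then have "real_of_int u \<le> - 1" "0 \<le> x (Suc k) * of_int v" using x[of "Suc k"] by auto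
        then show ?thesis by linarith
      qed
    qed
    \<comment> \<open>The determinant identity says how small the error \<open>D\<close> can be; the
      digit bound \<open>M\<close> compares the denominators \<open>B\<close> and
      \<open>A\<close>.\<close>
    have "1 = \<bar>of_int B * D - of_int A * (- x (Suc k) * D)\<bar>"
      using cden_cerr_det[of a "Suc k" \<alpha>] unfolding D_def[symmetric] D1 A_def B_def by simp
    also have "\<dots> = \<bar>D\<bar> * (of_int B + of_int A * x (Suc k))"
    proof -
      have "of_int B * D - of_int A * (- x (Suc k) * D) = D * (of_int B + of_int A * x (Suc k))" by (simp add: algebra_simps)
      then show ?thesis using x[of "Suc k"] AB by (simp add: abs_mult)
    qed
    also have "\<dots> \<le> \<bar>D\<bar> * (of_int (M + 2) * of_int A)"
    proof (intro mult_left_mono)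
      have "a (Suc k) * A \<le> M * A" using aM AB by (intro mult_right_mono) auto
      moreover have "cden a k \<le> A" using den[of k] by (simp add: A_def)
      ultimately have "B \<le> M * A + A" by (simp add: B_def A_def)
      then have "real_of_int B \<le> of_int (M * A + A)" by (simp only: of_int_le_iff)
      moreover have "of_int A * x (Suc k) \<le> of_int A * 1" using x[of "Suc k"] AB by (intro mult_left_mono) auto
      ultimately show "of_int B + of_int A * x (Suc k) \<le> of_int (M + 2) * of_int A" by (simp add: algebra_simps)
    qed auto
    finally have "1 / of_int (M + 2) \<le> of_int A * \<bar>D\<bar>" using M2 by (simp add: field_simps)
    also have "\<dots> \<le> of_int q * (\<bar>D\<bar> * \<bar>of_int u - x (Suc k) * of_int v\<bar>)"
    proof -
      have "\<bar>D\<bar> * 1 \<le> \<bar>D\<bar> * \<bar>of_int u - x (Suc k) * of_int v\<bar>" by (intro mult_left_mono uv) auto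
      then show ?thesis using AB by (intro mult_mono) auto
    qed
    finally show ?thesis unfolding err abs_mult .
  qed
  show ?thesis
  proof (intro exI conjI allI impI)
    show "1 / real_of_int (M + 2) > 0" using M2 by simp
    fix p q :: int assume "q \<noteq> 0"
    then consider "1 \<le> q" | "1 \<le> - q" by linarith
    then show "1 / real_of_int (M + 2) \<le> \<bar>of_int q\<bar> * \<bar>of_int q * \<alpha> - of_int p\<bar>"
    proof cases
      case 1
      then show ?thesis using main[OF 1, of p] by simp
    next
      case 2
      have "\<bar>of_int (- q) * \<alpha> - of_int (- p)\<bar> = \<bar>of_int q * \<alpha> - of_int p\<bar>" by simp
      with main[OF 2, of "- p"] 2 show ?thesis by simp
    qed
  qed
qed

lemma finite_cfrac_gt_1:
  assumes "\<And>i. 2 \<le> \<bar>a i\<bar>"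
  shows "1 < \<bar>finite_cfrac a n\<bar>"
  using assms
proof (induction n arbitrary: a)
  case 0
  show ?case by (simp, rule less_le_trans[OF _ 0]) simp
next
  case (Suc n)
  have "1 < \<bar>finite_cfrac (\<lambda>i. a (Suc i)) n\<bar>" by (rule Suc.IH) (rule Suc.prems)
  then have "\<bar>1 / finite_cfrac (\<lambda>i. a (Suc i)) n\<bar> < 1" by simp
  with Suc.prems[of 0] show ?case unfolding finite_cfrac.simps by linarith
qed

text \<open>All tails have modulus greater than 1, so the limit of their inverses has modulus at
  most 1; equality is excluded by irrationality.\<close>

lemma even_cfrac_step:
  assumes "is_even_cfrac m \<beta>" and irr: "\<beta> \<notin> \<rat>"
  shows "\<bar>\<beta> - 2 * of_int (m 0)\<bar> < 1" and "is_even_cfrac (\<lambda>i. m (Suc i)) (1 / (\<beta> - 2 * of_int (m 0)))"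
    and "1 / (\<beta> - 2 * of_int (m 0)) \<notin> \<rat>"
proof -
  define f where "f n = finite_cfrac (\<lambda>i. 2 * real_of_int (m (Suc i))) n" for n
  define x where "x = \<beta> - 2 * of_int (m 0)"
  have x: "x \<notin> \<rat>" unfolding x_def using irr by (metis Rats_add Rats_mult Rats_of_int Rats_number_of diff_add_cancel)
  have nz: "m i \<noteq> 0" if "1 \<le> i" for i using assms(1) that by (auto simp: is_even_cfrac_def)
  have f1: "1 < \<bar>f n\<bar>" for n
    unfolding f_def
  proof (rule finite_cfrac_gt_1)
    fix i
    have "1 \<le> \<bar>m (Suc i)\<bar>" using nz[of "Suc i"] by linarith
    then have "1 \<le> \<bar>real_of_int (m (Suc i))\<bar>" by linarith
    then show "2 \<le> \<bar>2 * real_of_int (m (Suc i))\<bar>" by simp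
  qed
  have "(\<lambda>n. finite_cfrac (\<lambda>i. 2 * real_of_int (m i)) (Suc n)) \<longlonglongrightarrow> \<beta>"
    using assms(1) by (intro LIMSEQ_Suc) (simp add: is_even_cfrac_def)
  then have "(\<lambda>n. 2 * real_of_int (m 0) + 1 / f n - 2 * of_int (m 0)) \<longlonglongrightarrow> x"
    unfolding x_def by (intro tendsto_diff tendsto_const) (simp add: f_def)
  then have lim: "(\<lambda>n. 1 / f n) \<longlonglongrightarrow> x" by simp
  have "\<bar>x\<bar> \<le> 1"
  proof (rule LIMSEQ_le_const2[OF tendsto_rabs[OF lim]])
    show "\<exists>N. \<forall>n\<ge>N. \<bar>1 / f n\<bar> \<le> 1"
    proof (intro exI allI impI)
      fix n :: nat
      show "\<bar>1 / f n\<bar> \<le> 1" using f1[of n] by simp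
    qed
  qed
  moreover have "x \<noteq> 1" "x \<noteq> - 1" "x \<noteq> 0" using x by (metis Rats_1 Rats_minus_iff Rats_0)+
  ultimately show "\<bar>\<beta> - 2 * of_int (m 0)\<bar> < 1" by (fold x_def) linarith
  have "(\<lambda>n. 1 / (1 / f n)) \<longlonglongrightarrow> 1 / x" using \<open>x \<noteq> 0\<close> by (intro tendsto_intros lim)
  then show "is_even_cfrac (\<lambda>i. m (Suc i)) (1 / (\<beta> - 2 * of_int (m 0)))"
    using nz by (simp add: is_even_cfrac_def x_def f_def)
  show "1 / (\<beta> - 2 * of_int (m 0)) \<notin> \<rat>" using x unfolding x_def[symmetric]
    by (metis Rats_divide Rats_1 divide_divide_eq_right mult_1 div_by_1)
qed

primrec even_quotient :: "(nat \<Rightarrow> int) \<Rightarrow> real \<Rightarrow> nat \<Rightarrow> real" where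
  "even_quotient m \<beta> 0 = \<beta>"
| "even_quotient m \<beta> (Suc k) = 1 / (even_quotient m \<beta> k - 2 * of_int (m k))"

lemma even_quotient_cfrac:
  assumes "is_even_cfrac m \<beta>" "\<beta> \<notin> \<rat>"
  shows "is_even_cfrac (\<lambda>i. m (k + i)) (even_quotient m \<beta> k) \<and> even_quotient m \<beta> k \<notin> \<rat>"
proof (induction k)
  case (Suc k)
  with even_cfrac_step[of "\<lambda>i. m (k + i)" "even_quotient m \<beta> k"] show ?case by simp
qed (use assms in auto)

text \<open>If \<open>\<bar>x k\<bar>\<close> were close to \<open>1\<close>, then the sum or the difference of two consecutive even convergents
  \<open>(p, q)\<close> would approximate \<open>\<beta>\<close> too well.\<close>

lemma even_cfrac_bounds:
  assumes bt: "bounded_type \<alpha>" and \<beta>: "\<beta> = 2 * \<alpha> - 1" and ecf: "is_even_cfrac m \<beta>"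
  shows "\<exists>x \<delta>. \<delta> > 0 \<and> \<beta> = 2 * of_int (m 0) + x 0 \<and>
    (\<forall>k. 1 / x k = 2 * of_int (m (Suc k)) + x (Suc k) \<and> x k \<notin> \<rat> \<and> \<delta> \<le> \<bar>x k\<bar> \<and> \<bar>x k\<bar> \<le> 1 - \<delta>)"
proof -
  obtain c where c: "c > 0" and bad: "\<And>p q :: int. q \<noteq> 0 \<Longrightarrow> c \<le> \<bar>of_int q\<bar> * \<bar>of_int q * \<alpha> - of_int p\<bar>"
    using bounded_type_badly_approximable[OF bt] by blast
  have irr: "\<beta> \<notin> \<rat>"
  proof
    assume "\<beta> \<in> \<rat>"
    then have "(\<beta> + 1) / 2 \<in> \<rat>" by auto
    then show False using bt by (simp add: \<beta> bounded_type_def)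
  qed
  define c' where "c' = c / 4"
  have c': "c' > 0" using c by (simp add: c'_def)
  have bad\<beta>: "c' \<le> \<bar>of_int q\<bar> * \<bar>of_int q * \<beta> - of_int p\<bar>" if "q \<noteq> 0" for p q :: int
  proof -
    have "c \<le> \<bar>of_int (2 * q)\<bar> * \<bar>of_int (2 * q) * \<alpha> - of_int (p + q)\<bar>" using that by (intro bad) auto
    also have "of_int (2 * q) * \<alpha> - of_int (p + q) = of_int q * \<beta> - of_int p" by (simp add: \<beta> algebra_simps)
    finally have "c \<le> 2 * (\<bar>of_int q\<bar> * \<bar>of_int q * \<beta> - of_int p\<bar>)" by (simp add: abs_mult)
    moreover have "0 \<le> \<bar>of_int q\<bar> * \<bar>of_int q * \<beta> - of_int p\<bar>" by simp
    ultimately show ?thesis unfolding c'_def by linarith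
  qed
  define y where "y = even_quotient m \<beta>"
  define a where "a k = 2 * m k" for k
  define x where "x k = y k - of_int (a k)" for k
  have ek: "is_even_cfrac (\<lambda>i. m (k + i)) (y k)" "y k \<notin> \<rat>" for k
    using even_quotient_cfrac[OF ecf irr] by (auto simp: y_def)
  have y: "y k = of_int (a k) + x k" "y (Suc k) = 1 / x k" "y 0 = \<beta>" for k
    by (simp_all add: x_def a_def y_def)
  have x1: "\<bar>x k\<bar> < 1" for k using even_cfrac_step(1)[OF ek] by (simp add: x_def a_def)
  have xirr: "x k \<notin> \<rat>" for k unfolding x_def using ek by (metis Rats_add Rats_of_int diff_add_cancel)
  then have x0: "x k \<noteq> 0" for k by (metis Rats_0)
  note E = cerr_Suc[where y = y and a = a and x = x, OF y(1) x0 y(2), unfolded y(3)]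
  have m0: "m (Suc k) \<noteq> 0" for k using ecf by (simp add: is_even_cfrac_def)
  have den: "\<bar>cden a k\<bar> < \<bar>cden a (Suc k)\<bar>" for k
  proof (induction k)
    case (Suc k)
    have "2 * \<bar>cden a (Suc k)\<bar> \<le> \<bar>a (Suc k)\<bar> * \<bar>cden a (Suc k)\<bar>"
      using m0[of k] by (intro mult_right_mono) (auto simp: a_def)
    then have "2 * \<bar>cden a (Suc k)\<bar> \<le> \<bar>a (Suc k) * cden a (Suc k)\<bar>" by (simp only: abs_mult)
    then show ?case using Suc by simp
  qed auto
  have up: "\<bar>x k\<bar> \<le> 1 - c' / 2" and low: "c' * (c' / 2) \<le> \<bar>x k\<bar>" for k
  proof -
    \<comment> \<open>With \<open>s\<close> the sign of \<open>x k\<close>, the combination of the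
      two convergents with coefficients 1 and \<open>s\<close> has error
      \<open>s * (1 - \<bar>x k\<bar>) * D\<close>, small exactly when
      \<open>\<bar>x k\<bar>\<close> is near 1.\<close>
    define A B s where "A = cden a (Suc k)" and "B = cden a k" and "s = (if x k > 0 then 1 else - 1 :: int)"
    define D where "D = cerr a \<beta> k"
    have AB: "\<bar>B\<bar> < \<bar>A\<bar>" using den by (simp add: A_def B_def)
    then have ABr: "\<bar>real_of_int B\<bar> < \<bar>of_int A\<bar>" by linarith
    have D1: "cerr a \<beta> (Suc k) = - x k * D" unfolding D_def by (rule E)
    have sx: "x k = of_int s * \<bar>x k\<bar>" by (auto simp: s_def)
    have "1 = \<bar>of_int A * D - of_int B * (- x k * D)\<bar>"
      using cden_cerr_det[of a k \<beta>] unfolding D_def[symmetric] D1 A_def[symmetric] B_def[symmetric] by simp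
    then have unit: "1 = \<bar>D\<bar> * \<bar>of_int A + x k * of_int B\<bar>"
      unfolding abs_mult[symmetric] by (simp add: algebra_simps)
    \<comment> \<open>Keeps the denominator of that combination under control: the right-hand side
      is \<open>2 / \<bar>D\<bar>\<close> by the determinant identity.\<close>
    have comb: "\<bar>of_int A + of_int (s * B)\<bar> \<le> 2 * \<bar>of_int A + x k * of_int B\<bar>"
    proof -
      define t where "t = \<bar>x k\<bar>"
      define u where "u = real_of_int A"
      define v where "v = real_of_int (s * B)"
      have t: "0 \<le> t" "t < 1" using x1[of k] by (auto simp: t_def)
      have uv: "\<bar>v\<bar> < \<bar>u\<bar>" using ABr by (auto simp: u_def v_def s_def)
      have xB: "x k * of_int B = t * v" by (subst sx) (simp add: t_def v_def)
      have "\<bar>u + v\<bar> \<le> 2 * \<bar>u + t * v\<bar>"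
      proof (cases "u > 0")
        case True
        have "0 \<le> t * (u + v)" "0 \<le> (1 - t) * (u - v)" using t uv True by (auto intro!: mult_nonneg_nonneg)
        then have "u + v \<le> 2 * (u + t * v)" using True t uv by (simp add: algebra_simps)
        moreover have "0 \<le> u + v" using uv True by linarith
        ultimately show ?thesis by simp
      next
        case False
        have "0 \<le> t * (- u - v)" "0 \<le> (1 - t) * (- u + v)" using t uv False by (auto intro!: mult_nonneg_nonneg)
        then have "- (u + v) \<le> - 2 * (u + t * v)" using False t uv by (simp add: algebra_simps)
        moreover have "u + v \<le> 0" using uv False by linarith
        ultimately show ?thesis by simp
      qed
      then show ?thesis by (simp add: u_def v_def xB)
    qed
    have "c' \<le> \<bar>of_int (A + s * B)\<bar> * \<bar>of_int (A + s * B) * \<beta> - of_int (cnum a (Suc k) + s * cnum a k)\<bar>"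
    proof (rule bad\<beta>)
      have "\<bar>s * B\<bar> = \<bar>B\<bar>" by (simp add: s_def)
      then show "A + s * B \<noteq> 0" using AB by linarith
    qed
    also have "of_int (A + s * B) * \<beta> - of_int (cnum a (Suc k) + s * cnum a k) = cerr a \<beta> (Suc k) + of_int s * D"
      by (simp add: D_def cerr_def A_def B_def algebra_simps)
    also have "\<dots> = of_int s * ((1 - \<bar>x k\<bar>) * D)"
      unfolding D1 by (subst (1) sx) (simp add: algebra_simps)
    also have "\<bar>of_int s * ((1 - \<bar>x k\<bar>) * D)\<bar> = (1 - \<bar>x k\<bar>) * \<bar>D\<bar>" using x1[of k] by (auto simp: abs_mult s_def)
    also have "\<bar>of_int (A + s * B)\<bar> * ((1 - \<bar>x k\<bar>) * \<bar>D\<bar>) \<le> (2 * \<bar>of_int A + x k * of_int B\<bar>) * ((1 - \<bar>x k\<bar>) * \<bar>D\<bar>)"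
      using comb x1[of k] by (intro mult_right_mono) auto
    also have "\<dots> = 2 * (1 - \<bar>x k\<bar>) * (\<bar>D\<bar> * \<bar>of_int A + x k * of_int B\<bar>)" by simp
    finally show up: "\<bar>x k\<bar> \<le> 1 - c' / 2" unfolding unit[symmetric] by simp
    \<comment> \<open>For the lower bound the convergent itself is tested; the upper bound just
      proved keeps \<open>1 - \<bar>x k\<bar>\<close> away from 0.\<close>
    have "c' \<le> \<bar>of_int A\<bar> * \<bar>of_int A * \<beta> - of_int (cnum a (Suc k))\<bar>"
      by (rule bad\<beta>) (use AB in auto)
    also have "of_int A * \<beta> - of_int (cnum a (Suc k)) = - x k * D" using D1 by (simp add: cerr_def A_def)
    finally have 1: "c' \<le> \<bar>of_int A\<bar> * (\<bar>x k\<bar> * \<bar>D\<bar>)" by (simp add: abs_mult)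
    have "\<bar>of_int A\<bar> * (1 - \<bar>x k\<bar>) \<le> \<bar>of_int A + x k * of_int B\<bar>"
    proof -
      have "\<bar>x k * of_int B\<bar> \<le> \<bar>x k\<bar> * \<bar>of_int A\<bar>" unfolding abs_mult using ABr by (intro mult_left_mono) auto
      then show ?thesis using abs_triangle_ineq2[of "of_int A" "- (x k * of_int B)"] by (simp add: algebra_simps)
    qed
    then have "\<bar>D\<bar> * (\<bar>of_int A\<bar> * (1 - \<bar>x k\<bar>)) \<le> 1" unfolding unit by (intro mult_left_mono) auto
    then have "\<bar>x k\<bar> * (\<bar>D\<bar> * (\<bar>of_int A\<bar> * (1 - \<bar>x k\<bar>))) \<le> \<bar>x k\<bar> * 1" by (intro mult_left_mono) auto
    moreover have "c' * (1 - \<bar>x k\<bar>) \<le> \<bar>of_int A\<bar> * (\<bar>x k\<bar> * \<bar>D\<bar>) * (1 - \<bar>x k\<bar>)"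
      using 1 x1[of k] by (intro mult_right_mono) auto
    ultimately have "c' * (1 - \<bar>x k\<bar>) \<le> \<bar>x k\<bar>" by (simp add: mult_ac)
    moreover have "c' * (c' / 2) \<le> c' * (1 - \<bar>x k\<bar>)" using up c' by (intro mult_left_mono) auto
    ultimately show "c' * (c' / 2) \<le> \<bar>x k\<bar>" by (rule order.trans[rotated])
  qed
  have rec: "1 / x k = 2 * of_int (m (Suc k)) + x (Suc k)" for k
    using y(1)[of "Suc k"] y(2)[of k] by (simp add: a_def)
  define \<delta> where "\<delta> = min (c' / 2) (c' * (c' / 2))"
  have "\<delta> \<le> c' / 2" "\<delta> \<le> c' * (c' / 2)" by (simp_all add: \<delta>_def)
  then have "\<delta> \<le> \<bar>x k\<bar> \<and> \<bar>x k\<bar> \<le> 1 - \<delta>" for k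
    using up[of k] low[of k] by linarith
  moreover have "\<delta> > 0" using c' by (simp add: \<delta>_def)
  moreover have "\<beta> = 2 * of_int (m 0) + x 0" using y(1)[of 0] by (simp add: y(3) a_def)
  ultimately show ?thesis using rec xirr by (intro exI[of _ x] exI[of _ \<delta>]) auto
qed

section \<open>Renormalization of the discrepancy\<close>

definition altern :: "real \<Rightarrow> nat \<Rightarrow> int" where
  "altern x j = (if even (int j + \<lfloor>real j * x\<rfloor>) then 1 else - 1)"

text \<open>The term \<open>j = 0\<close> is 1 for every \<open>x\<close> and would spoil the
  oddness in \<open>x\<close>; it is restored in \<open>discrepancy_eq\<close>.\<close>

definition altern_sum :: "real \<Rightarrow> nat \<Rightarrow> int" where
  "altern_sum x u = (\<Sum>j=1..u. altern x j)"

lemma altern_sum_Suc: "altern_sum x (Suc u) = altern_sum x u + altern x (Suc u)"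
  by (simp add: altern_sum_def)

lemma altern_sum_0 [simp]: "altern_sum x 0 = 0"
  by (simp add: altern_sum_def)

lemma abs_altern_sum_le: "\<bar>altern_sum x u\<bar> \<le> int u"
proof -
  have "\<bar>altern_sum x u\<bar> \<le> (\<Sum>j=1..u. \<bar>altern x j\<bar>)" unfolding altern_sum_def by (rule sum_abs)
  also have "\<dots> \<le> (\<Sum>j=1..u. 1)" by (intro sum_mono) (auto simp: altern_def)
  finally show ?thesis by simp
qed

lemma altern_add_even: "altern (2 * of_int n + x) j = altern x j"
proof -
  have "\<lfloor>real j * (2 * of_int n + x)\<rfloor> = 2 * (int j * n) + \<lfloor>real j * x\<rfloor>"
  proof -
    have "real j * (2 * of_int n + x) = real_of_int (2 * (int j * n)) + real j * x" by (simp add: algebra_simps)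
    then show ?thesis by (simp only: int_add_floor)
  qed
  then show ?thesis by (simp add: altern_def)
qed

lemma irrational_mult_of_nat: "x \<notin> \<rat> \<Longrightarrow> 1 \<le> j \<Longrightarrow> real j * x \<notin> \<rat>" for x :: real
  by (metis Rats_divide Rats_of_nat nonzero_mult_div_cancel_left not_one_le_zero of_nat_eq_0_iff)

lemma altern_uminus:
  assumes "x \<notin> \<rat>" "1 \<le> j"
  shows "altern (- x) j = - altern x j"
proof -
  have "real j * x \<notin> \<int>" using irrational_mult_of_nat[OF assms] Ints_subset_Rats by blast
  then have "\<lfloor>real j * (- x)\<rfloor> = - \<lfloor>real j * x\<rfloor> - 1" using frac_neg[of "real j * x"]
    by (simp add: frac_def split: if_splits)
  then show ?thesis by (auto simp: altern_def)
qed

lemma altern_sum_uminus: "x \<notin> \<rat> \<Longrightarrow> altern_sum (- x) u = - altern_sum x u"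
  unfolding altern_sum_def by (simp add: altern_uminus flip: sum_negf)

lemma altern_sum_add_even: "altern_sum (2 * of_int n + x) u = altern_sum x u"
  by (simp add: altern_sum_def altern_add_even)

text \<open>Crossing the unit grid along the line of slope \<open>x\<close>, the colours of the checkerboard cells
  alternate; the left-hand sums collect the colours at the crossings of vertical and of horizontal grid lines.\<close>

lemma altern_sum_reciprocal:
  assumes x: "0 < x" "x < 1" and irr: "x \<notin> \<rat>"
  shows "altern_sum x u + altern_sum (1 / x) (nat \<lfloor>real u * x\<rfloor>) = - of_bool (odd (u + nat \<lfloor>real u * x\<rfloor>))"
proof (induction u)
  case (Suc u)
  define K where "K = nat \<lfloor>real u * x\<rfloor>"
  have K: "real K \<le> real u * x" "real u * x < real K + 1"
    using x by (auto simp: K_def of_nat_nat)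
  have fl: "\<lfloor>real u * x\<rfloor> = int K" using x by (simp add: K_def)
  show ?case
  proof (cases "real (Suc u) * x < real K + 1")
    case True
    then have fl': "\<lfloor>real (Suc u) * x\<rfloor> = int K" using K x by (intro floor_unique) (auto simp: algebra_simps)
    then have n: "nat \<lfloor>real (Suc u) * x\<rfloor> = K" by simp
    have "altern x (Suc u) = (if even (int (Suc u) + int K) then 1 else - 1)" by (simp only: altern_def fl')
    then show ?thesis using Suc unfolding n altern_sum_Suc fl by auto
  next
    \<comment> \<open>One horizontal line is crossed before the next vertical one. The two new terms
      have opposite colours and cancel, and the parity bit is unchanged.\<close>
    case False
    have "real (Suc u) * x \<notin> \<rat>" by (rule irrational_mult_of_nat[OF irr]) simp
    moreover have "real K + 1 \<in> \<rat>" by simp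
    ultimately have ne: "real (Suc u) * x \<noteq> real K + 1" by metis
    then have fl': "\<lfloor>real (Suc u) * x\<rfloor> = int K + 1" using K x False by (intro floor_unique) (auto simp: algebra_simps)
    then have n: "nat \<lfloor>real (Suc u) * x\<rfloor> = Suc K" by simp
    have "\<lfloor>real (Suc K) * (1 / x)\<rfloor> = int u"
      using K x False ne by (intro floor_unique) (auto simp: field_simps)
    then have "altern (1 / x) (Suc K) = (if even (K + 1 + u) then 1 else - 1)"
      by (simp add: altern_def)
    moreover have "altern x (Suc u) = (if even (int (Suc u) + (int K + 1)) then 1 else - 1)" by (simp only: altern_def fl')
    ultimately show ?thesis using Suc unfolding n altern_sum_Suc fl by auto
  qed
qed simp

lemma frac_less_half_iff: "frac r < 1 / 2 \<longleftrightarrow> even \<lfloor>2 * r\<rfloor>" for r :: real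
proof (cases "frac r < 1 / 2")
  case True
  then have "\<lfloor>2 * r\<rfloor> = 2 * \<lfloor>r\<rfloor>" by (intro floor_unique) (auto simp: frac_def)
  with True show ?thesis by simp
next
  case False
  then have "\<lfloor>2 * r\<rfloor> = 2 * \<lfloor>r\<rfloor> + 1" using frac_lt_1[of r] by (intro floor_unique) (auto simp: frac_def)
  with False show ?thesis by simp
qed

text \<open>A fractional part is below 1/2 exactly if the floor of the doubled number is even, and
  \<open>2 * \<alpha>\<close> is \<open>1 + x\<close> up to an even integer.\<close>

lemma discrepancy_eq:
  assumes "2 * \<alpha> - 1 = 2 * of_int n + x"
  shows "2 * discrepancy (Suc u) \<alpha> = 1 + of_int (altern_sum x u)"
proof -
  have alt: "(if frac (real j * \<alpha>) \<in> {0..<1/2} then 1 else - 1) = altern x j" for j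
  proof -
    have "2 * (real j * \<alpha>) = real_of_int (int j + 2 * (int j * n)) + real j * x"
      using arg_cong[OF assms, of "\<lambda>r. real j * r"] by (simp add: algebra_simps)
    then have "\<lfloor>2 * (real j * \<alpha>)\<rfloor> = int j + 2 * (int j * n) + \<lfloor>real j * x\<rfloor>" by (simp only: int_add_floor)
    then show ?thesis using frac_less_half_iff[of "real j * \<alpha>"] by (simp add: altern_def frac_ge_0)
  qed
  have "2 * int (card {j. j < N \<and> frac (real j * \<alpha>) \<in> {0..<1/2}}) - int N = (\<Sum>j<N. altern x j)" for N
  proof -
    have "{j. j < N \<and> frac (real j * \<alpha>) \<in> {0..<1/2}} = {j\<in>{..<N}. frac (real j * \<alpha>) \<in> {0..<1/2}}" by auto
    then have "2 * int (card {j. j < N \<and> frac (real j * \<alpha>) \<in> {0..<1/2}}) - int N = (\<Sum>j<N. 2 * of_bool (frac (real j * \<alpha>) \<in> {0..<1/2}) - 1)"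
      by (simp add: sum_subtractf sum_of_bool_eq flip: sum_distrib_left) (simp add: Int_def)
    also have "\<dots> = (\<Sum>j<N. altern x j)"
      by (intro sum.cong refl) (auto simp flip: alt)
    finally show ?thesis .
  qed
  note this[of "Suc u"]
  also have "(\<Sum>j<Suc u. altern x j) = 1 + altern_sum x u"
    unfolding sum.lessThan_Suc_shift altern_sum_def by (simp add: altern_def sum.atLeast1_atMost_eq)
  finally have "2 * real (card {j. j < Suc u \<and> frac (real j * \<alpha>) \<in> {0..<1/2}}) - real (Suc u) = 1 + of_int (altern_sum x u)"
    by (metis (mono_tags, lifting) of_int_1 of_int_add of_int_diff of_int_mult of_int_numeral of_int_of_nat_eq)
  moreover have "2 * (a - b / 2) = 2 * a - b" for a b :: real by simp
  ultimately show ?thesis by (simp only: discrepancy_def)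
qed

section \<open>The tree generated by an even continued fraction\<close>

locale even_digits =
  fixes x :: "nat \<Rightarrow> real" and d :: "nat \<Rightarrow> int" and \<delta> :: real
  assumes rec: "1 / x k = 2 * of_int (d k) + x (Suc k)" and irr: "x k \<notin> \<rat>"
    and lo: "\<delta> \<le> \<bar>x k\<bar>" and hi: "\<bar>x k\<bar> \<le> 1 - \<delta>" and \<delta>_pos: "0 < \<delta>"
begin

definition y :: "nat \<Rightarrow> real" where "y k = \<bar>x k\<bar>"

definition m :: "nat \<Rightarrow> nat" where "m k = nat \<bar>d k\<bar>"

definition pos :: "nat \<Rightarrow> bool" where "pos k \<longleftrightarrow> (0 < x k \<longleftrightarrow> 0 < x (Suc k))"

text \<open>\<open>d k\<close> is the digit of \<beta> with index \<open>k + 1\<close>, so this is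
  \<open>(- 1) ^ j\<close> times the sign of the digit with index \<open>j = k + 1\<close>; each
  renormalization step reverses the sign of the remaining sum.\<close>

definition sg :: "nat \<Rightarrow> int" where "sg k = (- 1) ^ Suc k * sgn (d k)"

lemma y: "\<delta> \<le> y k" "y k \<le> 1 - \<delta>" "0 < y k" "y k < 1" "y k \<notin> \<rat>"
  using lo[of k] hi[of k] \<delta>_pos irr[of k] by (auto simp: y_def abs_if)

lemma \<delta>_less_1: "\<delta> < 1"
  using y[of 0] by linarith

lemma x_nonzero: "x k \<noteq> 0"
  using y(3)[of k] by (auto simp: y_def)

lemma d_sgn: "d k \<noteq> 0" "sgn (d k) = (if 0 < x k then 1 else - 1)"
proof -
  have 1: "1 < \<bar>1 / x k\<bar>" using y(3,4)[of k] by (simp add: y_def)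
  have 2: "\<bar>x (Suc k)\<bar> < 1" using y(4)[of "Suc k"] by (simp add: y_def)
  have "(0 < 1 / x k) = (0 < x k)" by simp
  then show "d k \<noteq> 0" "sgn (d k) = (if 0 < x k then 1 else - 1)"
    using 1 2 rec[of k] by (auto simp: sgn_if split: if_splits)
qed

lemma inverse_y: "1 / y k = 2 * real (m k) + (if pos k then y (Suc k) else - y (Suc k))"
proof -
  have m: "real (m k) = \<bar>of_int (d k)\<bar>" by (simp add: m_def)
  have "1 / y k = \<bar>1 / x k\<bar>" by (simp add: y_def)
  also have "\<dots> = (if 0 < x k then 1 / x k else - (1 / x k))" using x_nonzero[of k] by auto
  also have "\<dots> = 2 * real (m k) + (if pos k then y (Suc k) else - y (Suc k))"
    using d_sgn[of k] x_nonzero[of "Suc k"] unfolding rec m y_def pos_def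
    by (auto simp: sgn_if abs_if split: if_splits)
  finally show ?thesis .
qed

text \<open>Serves both as a bound for the digits and, increased by 1, as the distance within which
  a good level occurs.\<close>

definition K :: nat where "K = nat \<lceil>1 / \<delta>\<rceil> + 1"

lemma K: "1 / \<delta> \<le> real K" "1 \<le> K"
proof -
  show "1 \<le> K" by (simp add: K_def)
  have "real K = of_int \<lceil>1 / \<delta>\<rceil> + 1" using \<delta>_pos by (simp add: K_def)
  then show "1 / \<delta> \<le> real K" using le_of_int_ceiling[of "1 / \<delta>"] by linarith
qed

lemma m_ge: "1 \<le> m k"
  using d_sgn(1)[of k] by (simp add: m_def)

lemma m_le: "m k \<le> K"
proof -
  have "1 / y k \<le> 1 / \<delta>" using y[of k] \<delta>_pos by (intro divide_left_mono) auto
  then have "2 * real (m k) \<le> 1 / \<delta> + 1" using inverse_y[of k] y(3,4)[of "Suc k"] by (auto split: if_splits)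
  then have "2 * real (m k) \<le> real K + real K" using K by linarith
  then show ?thesis by simp
qed

text \<open>A bad step is \<open>1 / y = 2 - y'\<close>, which is parabolic with fixed point 1; in
  the coordinate \<open>1 / (1 - y)\<close> it is translation by -1. This coordinate is positive and
  at most \<open>1 / \<delta>\<close>, so bad steps run out.\<close>

lemma good_step: "\<exists>j. i \<le> j \<and> j < i + (K + 1) \<and> (pos j \<or> 2 \<le> m j)"
proof (rule ccontr)
  assume "\<nexists>j. i \<le> j \<and> j < i + (K + 1) \<and> (pos j \<or> 2 \<le> m j)"
  then have bad: "\<not> pos j \<and> m j = 1" if "i \<le> j" "j < i + (K + 1)" for j
    using that m_ge[of j] by (metis One_nat_def Suc_1 le_antisym not_less_eq_eq)
  have "1 / (1 - y (i + n)) = 1 / (1 - y i) - real n" if "n \<le> K + 1" for n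
    using that
  proof (induction n)
    case (Suc n)
    then have "1 / y (i + n) = 2 - y (i + Suc n)" using inverse_y[of "i + n"] bad[of "i + n"] by simp
    then have e: "1 - y (i + Suc n) = (1 - y (i + n)) / y (i + n)" using y(3)[of "i + n"] by (simp add: diff_divide_distrib)
    have "1 / (1 - y (i + Suc n)) = 1 / (1 - y (i + n)) - 1"
      unfolding e using y(3,4)[of "i + n"] by (simp add: field_simps)
    then show ?case using Suc by simp
  qed simp
  from this[of "K + 1"] have "1 / (1 - y i) \<ge> real (K + 1)" using y(4)[of "i + (K + 1)"] divide_pos_pos[of 1 "1 - y (i + (K + 1))"] by simp
  moreover have "1 / (1 - y i) \<le> 1 / \<delta>" using y[of i] \<delta>_pos by (intro divide_left_mono) auto
  ultimately show False using K by simp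
qed

sublocale tree: renormalization_tree m pos sg K "K + 1"
proof
  show "\<bar>sg i\<bar> = 1" for i using d_sgn[of i] by (simp add: sg_def abs_mult power_abs abs_sgn_eq)
qed (rule m_ge m_le good_step)+

definition par :: "nat \<Rightarrow> nat \<Rightarrow> nat" where "par k u = nat \<lfloor>real u * y k\<rfloor>"

text \<open>The bit is the one from \<open>altern_sum_reciprocal\<close>; the second component says
  that \<open>u\<close> is the last point over its parent.\<close>

definition st :: "nat \<Rightarrow> nat \<Rightarrow> state" where
  "st k u = (odd (u + par k u), par k (Suc u) \<noteq> par k u)"

text \<open>The least point over a node \<open>w \<ge> 1\<close>, namely \<open>w / y k\<close>
  rounded up. By \<open>inverse_y\<close> this is \<open>2 * m k * w\<close> plus or minus
  \<open>w * y (Suc k)\<close>, whose floor is the parent of \<open>w\<close>.\<close>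

definition start :: "nat \<Rightarrow> nat \<Rightarrow> nat" where
  "start k w = (if pos k then 2 * m k * w + par (Suc k) w + 1 else 2 * m k * w - par (Suc k) w)"

lemma le_par_iff: "w \<le> par k u \<longleftrightarrow> real w \<le> real u * y k"
  using y(3)[of k] by (simp add: par_def le_nat_iff le_floor_iff)

lemma par_0 [simp]: "par k 0 = 0"
  by (simp add: par_def)

lemma par_le: "par k u \<le> u"
proof -
  have "real (par k u) \<le> real u * y k" using le_par_iff by blast
  also have "\<dots> \<le> real u * 1" using y(4)[of k] by (intro mult_left_mono) auto
  finally show ?thesis by simp
qed

lemma par_mono: "u \<le> v \<Longrightarrow> par k u \<le> par k v"
  using y(3)[of k] by (auto simp: par_def intro!: nat_mono floor_mono mult_right_mono)

lemma par_bounds: "real (par k u) \<le> real u * y k" "real u * y k < real (par k u) + 1"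
proof -
  show "real (par k u) \<le> real u * y k" using le_par_iff by blast
  have "\<not> Suc (par k u) \<le> par k u" by simp
  then show "real u * y k < real (par k u) + 1" unfolding le_par_iff by simp
qed

lemma par_Suc: "par k (Suc u) = par k u + of_bool (par k (Suc u) \<noteq> par k u)"
proof -
  have "par k u \<le> par k (Suc u)" by (rule par_mono) simp
  moreover have "real (par k (Suc u)) < real (par k u) + 2"
    using par_bounds[where k = k and u = u] par_bounds[where k = k and u = "Suc u"] y(4)[of k] by (simp add: algebra_simps)
  then have "par k (Suc u) < par k u + 2" by linarith
  ultimately show ?thesis by auto
qed

lemma start_le_iff:
  assumes w: "1 \<le> w"
  shows "w \<le> par k u \<longleftrightarrow> start k w \<le> u"
proof -
  define f where "f = par (Suc k) w"
  have f: "real f < real w * y (Suc k)" "real w * y (Suc k) < real f + 1"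
  proof -
    have "real f \<noteq> real w * y (Suc k)"
      using irrational_mult_of_nat[OF y(5) w, of "Suc k"] by (metis Rats_of_nat)
    then show "real f < real w * y (Suc k)" "real w * y (Suc k) < real f + 1"
      using par_bounds[where k = "Suc k" and u = w] by (auto simp: f_def)
  qed
  have "w \<le> par k u \<longleftrightarrow> real w * (1 / y k) \<le> real u"
    unfolding le_par_iff using y(3)[of k] by (simp add: field_simps)
  also have "\<dots> \<longleftrightarrow> start k w \<le> u"
  proof (cases "pos k")
    case True
    then have "real w * (1 / y k) = real (2 * m k * w) + real w * y (Suc k)" by (simp add: inverse_y algebra_simps)
    moreover have "start k w = 2 * m k * w + f + 1" using True by (simp add: start_def f_def)
    ultimately show ?thesis using f by (auto simp del: of_nat_mult)
  next
    case False
    then have "real w * (1 / y k) = real (2 * m k * w) - real w * y (Suc k)" by (simp add: inverse_y algebra_simps)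
    moreover have "start k w = 2 * m k * w - f" using False by (simp add: start_def f_def)
    ultimately show ?thesis using f by (auto simp del: of_nat_mult)
  qed
  finally show ?thesis .
qed

lemma par_le_digit: "par (Suc k) w \<le> 2 * m k * w"
proof -
  have "par (Suc k) w \<le> 1 * w" using par_le by simp
  also have "\<dots> \<le> 2 * m k * w" using m_ge[of k] by (intro mult_right_mono) auto
  finally show ?thesis .
qed

text \<open>The run over \<open>w\<close> deviates from the length \<open>2 * m k\<close> exactly
  when the parent jumps after \<open>w\<close>, that is, when \<open>w\<close> is itself a last
  child.\<close>

lemma start_Suc: "start k (Suc w) = start k w + tree.run k (st (Suc k) w)"
  using par_Suc[of "Suc k" w] par_le_digit[of k w] m_ge[of k]
  by (cases "par (Suc k) (Suc w) = par (Suc k) w")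
    (auto simp: start_def tree.run_def st_def)

lemma start_ge: "1 \<le> w \<Longrightarrow> 1 \<le> start k w"
proof (cases "pos k")
  case False
  assume "1 \<le> w"
  then have "w < 2 * m k * w" using m_ge[of k] by (cases "m k") auto
  then have "1 \<le> 2 * m k * w - par (Suc k) w" using par_le[of "Suc k" w] by linarith
  then show ?thesis using False by (simp only: start_def if_False)
qed (simp add: start_def)

text \<open>The node 0 is excluded: it is its own parent, and its fiber does not follow the formula
  for \<open>start\<close>.\<close>

lemma fiber:
  assumes w: "1 \<le> w"
  shows "par k u = w \<longleftrightarrow> (\<exists>r<tree.run k (st (Suc k) w). u = start k w + r)"
proof -
  have 1: "par k u = w \<longleftrightarrow> w \<le> par k u \<and> \<not> Suc w \<le> par k u" for u by auto
  have 2: "Suc w \<le> par k u \<longleftrightarrow> start k w + tree.run k (st (Suc k) w) \<le> u" for u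
    using start_le_iff[of "Suc w" k u] by (simp add: start_Suc)
  have "par k u = w \<longleftrightarrow> start k w \<le> u \<and> u < start k w + tree.run k (st (Suc k) w)"
    by (simp only: 1 2 start_le_iff[OF w] not_le)
  also have "\<dots> \<longleftrightarrow> (\<exists>r<tree.run k (st (Suc k) w). u = start k w + r)"
    by (auto simp: le_iff_add)
  finally show ?thesis .
qed

text \<open>Identifies the arithmetic tree of floors with the abstract one: the state of a point
  depends only on the state of its parent and on the place in the run.\<close>

lemma st_start:
  assumes w: "1 \<le> w" and r: "r < tree.run k (st (Suc k) w)"
  shows "st k (start k w + r) = tree.child k (st (Suc k) w) r"
proof -
  have p: "par k (start k w + r) = w" using fiber[OF w, of k] r by (metis (no_types))
  have "par k (Suc (start k w + r)) \<noteq> w \<longleftrightarrow> Suc w \<le> par k (Suc (start k w + r))"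
    using par_mono[of "start k w + r" "Suc (start k w + r)" k] p by auto
  also have "\<dots> \<longleftrightarrow> Suc r = tree.run k (st (Suc k) w)"
    using start_le_iff[of "Suc w" k "Suc (start k w + r)"] r by (auto simp: start_Suc)
  finally have "par k (Suc (start k w + r)) \<noteq> w \<longleftrightarrow> Suc r = tree.run k (st (Suc k) w)" .
  moreover have "odd (start k w + r + w) = odd (r + of_bool (fst (st (Suc k) w)) + of_bool (pos k))"
    using par_le_digit[of k w] by (auto simp: start_def st_def)
  ultimately show ?thesis by (simp add: st_def[of k] tree.child_def p)
qed

primrec anc :: "nat \<Rightarrow> nat \<Rightarrow> nat" where
  "anc 0 u = u"
| "anc (Suc J) u = par J (anc J u)"

definition val :: "nat \<Rightarrow> nat \<Rightarrow> int" where
  "val J u = (\<Sum>k<J. sg k * of_bool (fst (st k (anc k u))))"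

lemma val_Suc: "val (Suc J) u = val J u + sg J * of_bool (fst (st J (anc J u)))"
  by (simp add: val_def)

lemma anc_mono: "u \<le> v \<Longrightarrow> anc J u \<le> anc J v"
  by (induction J) (auto intro: par_mono)

lemma card_Union_fibers:
  assumes w: "1 \<le> w" and fin: "\<And>v. 1 \<le> v \<Longrightarrow> finite {u. anc J u = v}"
  shows "card {u. anc (Suc J) u = w \<and> Q u} = (\<Sum>r<tree.run J (st (Suc J) w). card {u. anc J u = start J w + r \<and> Q u})"
proof -
  have "{u. anc (Suc J) u = w \<and> Q u} = (\<Union>r\<in>{..<tree.run J (st (Suc J) w)}. {u. anc J u = start J w + r \<and> Q u})"
    unfolding anc.simps fiber[OF w] by auto
  moreover have "finite {u. anc J u = start J w + r \<and> Q u}" for r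
    by (rule finite_subset[OF _ fin[of "start J w + r"]]) (use start_ge[OF w, of J] in auto)
  ultimately show ?thesis
    by (simp only:) (rule card_UN_disjoint, auto)
qed

lemma anc_fiber:
  "1 \<le> w \<Longrightarrow> finite {u. anc J u = w} \<and> card {u. anc J u = w} = tree.wt J (st J w)
     \<and> (\<forall>z. card {u. anc J u = w \<and> val J u = z} = tree.cnt J (st J w) z)"
proof (induction J arbitrary: w)
  case 0
  have "{u. u = w \<and> z = 0} = (if z = 0 then {w} else {})" for z :: int by auto
  then show ?case by (auto simp: val_def)
next
  case (Suc J)
  let ?R = "tree.run J (st (Suc J) w)"
  have s: "1 \<le> start J w + r" for r using start_ge[OF Suc.prems, of J] by simp
  have fins: "finite {u. anc J u = v}" if "1 \<le> v" for v using Suc.IH[OF that] by simp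
  have "{u. anc (Suc J) u = w} = (\<Union>r<?R. {u. anc J u = start J w + r})"
    unfolding anc.simps fiber[OF Suc.prems] by auto
  then have fin: "finite {u. anc (Suc J) u = w}" using Suc.IH[OF s] by simp
  have "card {u. anc (Suc J) u = w} = (\<Sum>r<?R. card {u. anc J u = start J w + r})"
    using card_Union_fibers[OF Suc.prems fins, of "\<lambda>_. True"] by simp
  also have "\<dots> = tree.wt (Suc J) (st (Suc J) w)"
    unfolding tree.wt.simps using Suc.IH[OF s] st_start[OF Suc.prems] by (intro sum.cong refl) auto
  finally have c: "card {u. anc (Suc J) u = w} = tree.wt (Suc J) (st (Suc J) w)" .
  have "card {u. anc (Suc J) u = w \<and> val (Suc J) u = z} = tree.cnt (Suc J) (st (Suc J) w) z" for z
  proof -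
    have "card {u. anc (Suc J) u = w \<and> val (Suc J) u = z} = (\<Sum>r<?R. card {u. anc J u = start J w + r \<and> val (Suc J) u = z})"
      using card_Union_fibers[OF Suc.prems fins, of "\<lambda>u. val (Suc J) u = z"] by (simp only:)
    also have "\<dots> = (\<Sum>r<?R. tree.cnt J (tree.child J (st (Suc J) w) r) (z - sg J * of_bool (fst (tree.child J (st (Suc J) w) r))))"
    proof (rule sum.cong[OF refl])
      fix r assume "r \<in> {..<?R}"
      then have r: "st J (start J w + r) = tree.child J (st (Suc J) w) r" by (intro st_start[OF Suc.prems]) simp
      have "{u. anc J u = start J w + r \<and> val (Suc J) u = z} =
        {u. anc J u = start J w + r \<and> val J u = z - sg J * of_bool (fst (st J (start J w + r)))}"
        by (rule Collect_cong) (auto simp: val_Suc)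
      moreover have "card {u. anc J u = start J w + r \<and> val J u = z'} = tree.cnt J (st J (start J w + r)) z'" for z'
        using Suc.IH[OF s] by blast
      ultimately show "card {u. anc J u = start J w + r \<and> val (Suc J) u = z} =
        tree.cnt J (tree.child J (st (Suc J) w) r) (z - sg J * of_bool (fst (tree.child J (st (Suc J) w) r)))"
        by (simp only: r)
    qed
    also have "\<dots> = tree.cnt (Suc J) (st (Suc J) w) z" by (simp only: tree.cnt.simps)
    finally show ?thesis .
  qed
  with fin c show ?case by blast
qed

text \<open>Oddness reduces to \<open>y k\<close> in \<open>(0, 1)\<close>, reciprocity applies, and
  \<open>1 / x k\<close> only matters modulo 2. The sign of \<open>x k\<close> is used twice and
  cancels from the remaining sum.\<close>

lemma altern_sum_step:
  "altern_sum (x k) u = - sgn (d k) * of_bool (fst (st k u)) - altern_sum (x (Suc k)) (par k u)"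
proof -
  define \<sigma> :: int where "\<sigma> = (if 0 < x k then 1 else - 1)"
  have \<sigma>: "\<sigma> * \<sigma> = 1" "sgn (d k) = \<sigma>" using d_sgn[of k] by (auto simp: \<sigma>_def)
  have sx: "altern_sum (x k) u = \<sigma> * altern_sum (y k) u"
    using altern_sum_uminus[OF irr[of k]] by (auto simp: \<sigma>_def y_def abs_if)
  have "1 / y k = (if 0 < x k then 1 / x k else - (1 / x k))" using x_nonzero[of k] by (auto simp: y_def abs_if)
  moreover have "altern_sum (1 / x k) v = altern_sum (x (Suc k)) v" for v
    by (simp only: rec altern_sum_add_even)
  moreover have "1 / x k \<notin> \<rat>" using irr[of k] by (metis Rats_divide Rats_1 divide_divide_eq_right mult_1 div_by_1)
  ultimately have s1: "altern_sum (1 / y k) v = \<sigma> * altern_sum (x (Suc k)) v" for v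
    using altern_sum_uminus[of "1 / x k" v] by (auto simp: \<sigma>_def)
  have A: "altern_sum (y k) u = - of_bool (fst (st k u)) - \<sigma> * altern_sum (x (Suc k)) (par k u)"
    using altern_sum_reciprocal[of "y k" u] y(3-5)[of k] unfolding s1 par_def[symmetric] by (simp add: st_def)
  have "altern_sum (x k) u = - \<sigma> * of_bool (fst (st k u)) - (\<sigma> * \<sigma>) * altern_sum (x (Suc k)) (par k u)"
    by (simp only: sx A right_diff_distrib mult_minus_right mult_minus_left mult.assoc)
  then show ?thesis using \<sigma> by simp
qed

lemma altern_sum_eq_val: "altern_sum (x 0) u = val J u + (- 1) ^ J * altern_sum (x J) (anc J u)"
proof (induction J)
  case (Suc J)
  then show ?case by (simp add: val_def sg_def altern_sum_step[of J "anc J u"] algebra_simps)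
qed (simp add: val_def)

end

section \<open>Counting over an initial segment\<close>

lemma std_normal_density_le_1: "std_normal_density x \<le> 1"
proof -
  have "1 / sqrt (2 * pi) \<le> 1" using pi_ge_two by simp
  then have "1 / sqrt (2 * pi) * exp (- x\<^sup>2 / 2) \<le> 1 * 1" by (intro mult_mono) auto
  then show ?thesis by (simp add: std_normal_density_def)
qed

text \<open>Increments \<open>A * w J\<close> along a geometrically growing \<open>w\<close> sum to
  a multiple of the last one, which needs \<open>C \<ge> A / (\<rho> - 1)\<close>; the finite sum in
  \<open>C\<close> covers the levels before growth sets in. The parameter \<open>a\<close> keeps
  \<open>C\<close> uniform over targets.\<close>

lemma geometric_growth_bound:
  fixes z :: "nat \<Rightarrow> 'a \<Rightarrow> real" and w :: "nat \<Rightarrow> real"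
  assumes w: "\<And>J. 0 < w J" and \<rho>: "1 < \<rho>" and A: "0 \<le> A"
    and growth: "\<forall>\<^sub>F J in sequentially. \<rho> * w J \<le> w (Suc J)"
    and step: "\<And>J a. z (Suc J) a \<le> z J a + A * w J"
    and bound: "\<And>J. \<exists>B. \<forall>a. z J a \<le> B"
  shows "\<exists>C>0. \<forall>J a. z J a \<le> C * w J"
proof -
  obtain J0 where J0: "\<And>J. J \<ge> J0 \<Longrightarrow> \<rho> * w J \<le> w (Suc J)"
    using growth by (auto simp: eventually_sequentially)
  obtain B where B: "\<And>J a. z J a \<le> B J" using bound by metis
  define C where "C = A / (\<rho> - 1) + (\<Sum>J\<le>J0. \<bar>B J\<bar> / w J) + 1"
  have nn: "0 \<le> (\<Sum>J\<le>J0. \<bar>B J\<bar> / w J)" using w by (intro sum_nonneg) (simp add: less_imp_le)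
  have A': "0 \<le> A / (\<rho> - 1)" using A \<rho> by simp
  have C: "C > 0" using nn A' by (simp add: C_def)
  have CA: "A \<le> C * (\<rho> - 1)"
  proof -
    have "A = A / (\<rho> - 1) * (\<rho> - 1)" using \<rho> by simp
    also have "\<dots> \<le> C * (\<rho> - 1)" using \<rho> nn by (intro mult_right_mono) (auto simp: C_def)
    finally show ?thesis .
  qed
  have small: "z J a \<le> C * w J" if "J \<le> J0" for J a
  proof -
    have "\<bar>B J\<bar> / w J \<le> (\<Sum>J\<le>J0. \<bar>B J\<bar> / w J)"
      using that w by (intro member_le_sum) (auto simp: less_imp_le)
    then have "\<bar>B J\<bar> / w J \<le> C" using A' by (simp add: C_def)
    then have "\<bar>B J\<bar> \<le> C * w J" using w[of J] by (simp add: field_simps)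
    then show ?thesis using B[of J a] by linarith
  qed
  have "z J a \<le> C * w J" for J a
  proof (induction J)
    case (Suc J)
    show ?case
    proof (cases "Suc J \<le> J0")
      case False
      have "z (Suc J) a \<le> (C + A) * w J" using Suc step[of J a] by (simp add: algebra_simps)
      also have "\<dots> \<le> (C * \<rho>) * w J" using CA w[of J] by (intro mult_right_mono) (auto simp: algebra_simps)
      also have "\<dots> \<le> C * w (Suc J)" using J0[of J] False C by simp
      finally show ?thesis .
    qed (rule small)
  qed (rule small, simp)
  with C show ?thesis by blast
qed

context renormalization_tree
begin

lemma cnt_le_wt: "cnt J s z \<le> wt J s"
proof (induction J arbitrary: s z)
  case (Suc J)
  then show ?case by (simp add: wt.simps sum_mono)
qed simp

text \<open>Only the upper bound in the local limit theorem, made valid at all levels; at the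
  finitely many early ones the trivial bound by \<open>wt\<close> is used.\<close>

lemma cnt_le:
  "\<exists>C>0. \<forall>J s z. real (cnt J s z) \<le> C * (real (W J False) / sqrt (real J + 1))"
proof -
  obtain V e c where c: "c > 0" and Vc: "\<forall>\<^sub>F J in sequentially. V J \<ge> c * real J" and e: "e \<longlonglongrightarrow> 0"
    and lim: "\<forall>\<^sub>F J in sequentially. \<forall>s y.
        \<bar>sqrt (V J) * real (cnt J s y) / real (wt J s) - std_normal_density ((of_int y - center J) / sqrt (V J))\<bar> \<le> e J"
    using local_limit by blast
  have e1: "\<forall>\<^sub>F J in sequentially. e J < 1" using order_tendstoD(2)[OF e, of 1] by simp
  \<comment> \<open>Normalized counts are at most 2 (density at most 1, error below 1),
    \<open>wt\<close> is at most twice \<open>W J False\<close>, and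
    \<open>J + 1 \<le> 2 * J\<close>.\<close>
  define C1 where "C1 = 4 * sqrt 2 / sqrt c"
  have C1: "C1 > 0" using c by (simp add: C1_def)
  have "\<forall>\<^sub>F J in sequentially. \<forall>s z. real (cnt J s z) \<le> C1 * (real (W J False) / sqrt (real J + 1))"
    using Vc lim e1 eventually_ge_at_top[of 1]
  proof (eventually_elim, intro allI)
    case (elim J)
    fix s z
    have wt: "0 < real (wt J s)" using wt_pos[of J s] by simp
    define a where "a = sqrt (V J) * real (cnt J s z) / real (wt J s)"
    define f where "f = std_normal_density ((of_int z - center J) / sqrt (V J))"
    have "\<bar>a - f\<bar> \<le> e J" unfolding a_def f_def by (rule elim(2)[THEN spec, THEN spec])
    moreover have "f \<le> 1" unfolding f_def by (rule std_normal_density_le_1)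
    ultimately have "a \<le> 2" using elim(3) by linarith
    then have 1: "sqrt (V J) * real (cnt J s z) \<le> 2 * real (wt J s)" using wt by (simp add: a_def divide_le_eq)
    have "sqrt c * sqrt (real J + 1) \<le> sqrt 2 * sqrt (c * real J)"
      using c elim by (simp add: real_sqrt_mult[symmetric])
    also have "\<dots> \<le> sqrt 2 * sqrt (V J)" using elim by simp
    finally have "(sqrt c * sqrt (real J + 1)) * real (cnt J s z) \<le> (sqrt 2 * sqrt (V J)) * real (cnt J s z)"
      by (intro mult_right_mono) auto
    also have "\<dots> \<le> sqrt 2 * (2 * real (wt J s))" using 1 by simp
    also have "\<dots> \<le> sqrt 2 * (4 * real (W J False))" using wt_le_False[of J s] by simp
    finally show "real (cnt J s z) \<le> C1 * (real (W J False) / sqrt (real J + 1))"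
      using c by (simp add: C1_def field_simps)
  qed
  then obtain J0 where J0: "\<And>J s z. J \<ge> J0 \<Longrightarrow> real (cnt J s z) \<le> C1 * (real (W J False) / sqrt (real J + 1))"
    unfolding eventually_sequentially by blast
  define C where "C = max C1 (2 * sqrt (real J0 + 1))"
  have "real (cnt J s z) \<le> C * (real (W J False) / sqrt (real J + 1))" for J s z
  proof (cases "J \<ge> J0")
    case True
    then have "real (cnt J s z) \<le> C1 * (real (W J False) / sqrt (real J + 1))" by (rule J0)
    also have "\<dots> \<le> C * (real (W J False) / sqrt (real J + 1))" by (intro mult_right_mono) (auto simp: C_def)
    finally show ?thesis .
  next
    case False
    have "real (cnt J s z) \<le> real (2 * W J False)"
      using cnt_le_wt[of J s z] wt_le_False[of J s] by (intro of_nat_mono) linarith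
    also have "\<dots> \<le> (2 * sqrt (real J0 + 1)) * (real (W J False) / sqrt (real J + 1))"
    proof -
      have "sqrt (real J + 1) \<le> sqrt (real J0 + 1)" using False by simp
      then have "2 * real (W J False) * sqrt (real J + 1) \<le> 2 * real (W J False) * sqrt (real J0 + 1)" by (intro mult_left_mono) auto
      then show ?thesis by (simp add: field_simps)
    qed
    also have "\<dots> \<le> C * (real (W J False) / sqrt (real J + 1))" by (intro mult_right_mono) (auto simp: C_def)
    finally show ?thesis .
  qed
  moreover have "C > 0" using C1 by (simp add: C_def)
  ultimately show ?thesis by blast
qed

text \<open>The square root changes the growth rate by a factor tending to 1, so any rate below that
  of \<open>W_growth\<close> survives; \<open>\<rho>'\<close> is the midpoint.\<close>

lemma W_sqrt_growth:
  "\<exists>\<rho>>1. \<forall>\<^sub>F J in sequentially. \<rho> * (real (W J False) / sqrt (real J + 1)) \<le> real (W (Suc J) False) / sqrt (real (Suc J) + 1)"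
proof -
  define \<rho> where "\<rho> = 1 + 1 / real (gap + 2)"
  define \<rho>' where "\<rho>' = (1 + \<rho>) / 2"
  have \<rho>: "1 < \<rho>" by (simp add: \<rho>_def)
  then have \<rho>': "1 < \<rho>'" "\<rho>' < \<rho>" by (simp_all add: \<rho>'_def)
  have "(\<lambda>J. sqrt (real J + 1) / sqrt (real (Suc J) + 1)) \<longlonglongrightarrow> 1" by real_asymp
  then have "(\<lambda>J. \<rho> * (sqrt (real J + 1) / sqrt (real (Suc J) + 1))) \<longlonglongrightarrow> \<rho> * 1" by (intro tendsto_intros)
  then have "\<forall>\<^sub>F J in sequentially. \<rho>' < \<rho> * (sqrt (real J + 1) / sqrt (real (Suc J) + 1))"
    using \<rho>' by (intro order_tendstoD) auto
  then have "\<forall>\<^sub>F J in sequentially. \<rho>' * (real (W J False) / sqrt (real J + 1)) \<le> real (W (Suc J) False) / sqrt (real (Suc J) + 1)"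
  proof eventually_elim
    case (elim J)
    have "\<rho>' * (real (W J False) / sqrt (real J + 1)) \<le> \<rho> * (sqrt (real J + 1) / sqrt (real (Suc J) + 1)) * (real (W J False) / sqrt (real J + 1))"
      using elim by (intro mult_right_mono) auto
    also have "\<dots> = \<rho> * real (W J False) / sqrt (real (Suc J) + 1)" by simp
    also have "\<dots> \<le> real (W (Suc J) False) / sqrt (real (Suc J) + 1)"
      using W_growth[of J] by (intro divide_right_mono) (auto simp: \<rho>_def)
    finally show ?case .
  qed
  with \<rho>' show ?thesis by blast
qed

end

context even_digits
begin

definition P :: "nat \<Rightarrow> real" where "P J = (\<Prod>k<J. y k)"

lemma P_0 [simp]: "P 0 = 1" and P_Suc: "P (Suc J) = P J * y J"
  by (simp_all add: P_def)

lemma P_pos: "0 < P J"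
  by (auto simp: P_def intro!: prod_pos y(3))

lemma anc_le: "real (anc J u) \<le> real u * P J"
proof (induction J)
  case (Suc J)
  have "real (anc (Suc J) u) \<le> real (anc J u) * y J" using par_bounds(1) by simp
  also have "\<dots> \<le> real u * P J * y J" using y(3)[of J] by (intro mult_right_mono Suc) auto
  finally show ?case by (simp add: P_Suc mult_ac)
qed simp

text \<open>Each floor loses less than 1, and older losses shrink by \<open>1 - \<delta>\<close> per
  level; the geometric series sums to \<open>1 / \<delta>\<close>.\<close>

lemma anc_ge: "real u * P J - 1 / \<delta> \<le> real (anc J u)"
proof (induction J)
  case 0
  then show ?case using \<delta>_pos by simp
next
  case (Suc J)
  have "real u * P (Suc J) = real u * P J * y J" by (simp add: P_Suc)
  also have "\<dots> \<le> (real (anc J u) + 1 / \<delta>) * y J" using y(3)[of J] Suc by (intro mult_right_mono) auto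
  also have "\<dots> = real (anc J u) * y J + y J / \<delta>" by (simp add: algebra_simps)
  also have "\<dots> \<le> (real (anc (Suc J) u) + 1) + (1 - \<delta>) / \<delta>"
    using par_bounds(2)[of "anc J u" J] y(2)[of J] \<delta>_pos by (intro add_mono divide_right_mono) auto
  also have "\<dots> = real (anc (Suc J) u) + 1 / \<delta>" using \<delta>_pos by (simp add: field_simps)
  finally show ?case by simp
qed

lemma finite_anc: "finite {u. anc J u = w}"
proof (cases "w = 0")
  case True
  have "{u. anc J u = w} \<subseteq> {..nat \<lceil>1 / \<delta> / P J\<rceil>}"
  proof
    fix u assume "u \<in> {u. anc J u = w}"
    then have "real u * P J \<le> 1 / \<delta>" using anc_ge[of u J] True by simp
    then have "real u \<le> 1 / \<delta> / P J" by (rule mult_imp_le_div_pos[OF P_pos])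
    then show "u \<in> {..nat \<lceil>1 / \<delta> / P J\<rceil>}" by (simp add: nat_le_iff le_ceiling_iff) linarith
  qed
  then show ?thesis by (rule finite_subset) simp
next
  case False
  then show ?thesis using anc_fiber[of w J] by simp
qed

lemma par_eq_0: "par J v = 0 \<Longrightarrow> v \<le> K"
proof -
  assume "par J v = 0"
  then have "real v * y J < 1" using par_bounds(2)[of v J] by simp
  moreover have "real v * \<delta> \<le> real v * y J" using y(1) by (intro mult_left_mono) auto
  ultimately have "real v * \<delta> < 1" by linarith
  then have "real v < 1 / \<delta>" using \<delta>_pos by (simp add: field_simps)
  then have "real v < real K" using K(1) by linarith
  then show ?thesis by simp
qed

text \<open>A point below the node 0 of level \<open>J + 1\<close> lies below the node 0 of level
  \<open>J\<close> or below one of at most \<open>K\<close> regular nodes. Two predicates occur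
  because the condition on \<open>val\<close> refers to the level.\<close>

lemma card_anc_0_step:
  assumes Q: "\<And>u. anc J u = 0 \<Longrightarrow> Q' u \<Longrightarrow> Q u"
    and b: "\<And>v. 1 \<le> v \<Longrightarrow> card {u. anc J u = v \<and> Q' u} \<le> b"
  shows "card {u. anc (Suc J) u = 0 \<and> Q' u} \<le> card {u. anc J u = 0 \<and> Q u} + K * b"
proof -
  have fin: "finite {u. anc J u = v \<and> R u}" for v R
    by (rule finite_subset[OF _ finite_anc[of J v]]) auto
  have "{u. anc (Suc J) u = 0 \<and> Q' u} \<subseteq> {u. anc J u = 0 \<and> Q u} \<union> (\<Union>v\<in>{1..K}. {u. anc J u = v \<and> Q' u})"
    using Q par_eq_0 by (auto simp: Suc_le_eq)
  then have "card {u. anc (Suc J) u = 0 \<and> Q' u} \<le> card ({u. anc J u = 0 \<and> Q u} \<union> (\<Union>v\<in>{1..K}. {u. anc J u = v \<and> Q' u}))"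
    by (intro card_mono) (auto simp: fin)
  also have "\<dots> \<le> card {u. anc J u = 0 \<and> Q u} + card (\<Union>v\<in>{1..K}. {u. anc J u = v \<and> Q' u})" by (rule card_Un_le)
  also have "card (\<Union>v\<in>{1..K}. {u. anc J u = v \<and> Q' u}) \<le> (\<Sum>v\<in>{1..K}. card {u. anc J u = v \<and> Q' u})"
    by (rule card_UN_le) simp
  also have "\<dots> \<le> (\<Sum>v\<in>{1..K}. b)" by (intro sum_mono b) auto
  finally show ?thesis by simp
qed

abbreviation "W J \<equiv> real (tree.wt J (False, False))"

lemma W_pos: "0 < W J"
  using tree.wt_pos by simp

lemma card_anc_0_le: "\<exists>C>0. \<forall>J. real (card {u. anc J u = 0}) \<le> C * W J"
proof -
  have "\<exists>C>0. \<forall>J (a::unit). real (card {u. anc J u = 0}) \<le> C * W J"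
  proof (rule geometric_growth_bound[where \<rho> = "1 + 1 / real (K + 1 + 2)" and A = "2 * real K"])
    show "\<forall>\<^sub>F J in sequentially. (1 + 1 / real (K + 1 + 2)) * W J \<le> W (Suc J)"
      by (intro always_eventually allI tree.W_growth)
    fix J
    have "card {u. anc (Suc J) u = 0} \<le> card {u. anc J u = 0} + K * (2 * tree.wt J (False, False))"
      using card_anc_0_step[of J "\<lambda>_. True" "\<lambda>_. True" "2 * tree.wt J (False, False)"] anc_fiber tree.wt_le_False by auto
    then have "real (card {u. anc (Suc J) u = 0}) \<le> real (card {u. anc J u = 0} + K * (2 * tree.wt J (False, False)))"
      by (rule of_nat_mono)
    then show "real (card {u. anc (Suc J) u = 0}) \<le> real (card {u. anc J u = 0}) + 2 * real K * W J" by simp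
  qed (auto simp: tree.wt_pos intro: exI[of _ "real (card {u. anc J u = 0})" for J])
  then show ?thesis by simp
qed

text \<open>The node 0 has bit 0, so passing a level through it leaves \<open>val\<close> unchanged;
  the regular nodes joining at each level obey the local bound.\<close>

lemma card_anc_0_val_le: "\<exists>C>0. \<forall>J z. real (card {u. anc J u = 0 \<and> val J u = z}) \<le> C * (W J / sqrt (real J + 1))"
proof -
  obtain C where C: "C > 0" "\<And>J s z. real (tree.cnt J s z) \<le> C * (W J / sqrt (real J + 1))"
    using tree.cnt_le by blast
  obtain \<rho> where \<rho>: "\<rho> > 1" "\<forall>\<^sub>F J in sequentially. \<rho> * (W J / sqrt (real J + 1)) \<le> W (Suc J) / sqrt (real (Suc J) + 1)"
    using tree.W_sqrt_growth by blast
  show ?thesis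
  proof (rule geometric_growth_bound[OF _ \<rho>(1) _ \<rho>(2), where A = "real K * C"])
    show "0 < W J / sqrt (real J + 1)" for J using W_pos[of J] by simp
    show "0 \<le> real K * C" using C by simp
    fix J z
    define b where "b = nat \<lfloor>C * (W J / sqrt (real J + 1))\<rfloor>"
    have "card {u. anc (Suc J) u = 0 \<and> val (Suc J) u = z} \<le> card {u. anc J u = 0 \<and> val J u = z} + K * b"
    proof (rule card_anc_0_step)
      show "val J u = z" if "anc J u = 0" "val (Suc J) u = z" for u
        using that by (simp add: val_Suc st_def)
      fix v :: nat assume v: "1 \<le> v"
      have "{u. anc J u = v \<and> val (Suc J) u = z} = {u. anc J u = v \<and> val J u = z - sg J * of_bool (fst (st J v))}"
        by (rule Collect_cong) (auto simp: val_Suc)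
      then have "card {u. anc J u = v \<and> val (Suc J) u = z} = tree.cnt J (st J v) (z - sg J * of_bool (fst (st J v)))"
        using anc_fiber[OF v, of J] by simp
      moreover have "tree.cnt J (st J v) z' \<le> b" for z'
        unfolding b_def using C(2)[of J "st J v" z'] by (simp add: le_nat_floor)
      ultimately show "card {u. anc J u = v \<and> val (Suc J) u = z} \<le> b" by simp
    qed
    then have "real (card {u. anc (Suc J) u = 0 \<and> val (Suc J) u = z}) \<le> real (card {u. anc J u = 0 \<and> val J u = z} + K * b)"
      by (rule of_nat_mono)
    also have "\<dots> = real (card {u. anc J u = 0 \<and> val J u = z}) + real K * real b" by simp
    also have "real b \<le> C * (W J / sqrt (real J + 1))" using C(1) W_pos[of J] by (simp add: b_def of_nat_floor)
    finally show "real (card {u. anc (Suc J) u = 0 \<and> val (Suc J) u = z}) \<le> real (card {u. anc J u = 0 \<and> val J u = z}) + real K * C * (W J / sqrt (real J + 1))"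
      by (simp add: mult_left_mono mult.assoc)
  next
    show "\<exists>B. \<forall>z. real (card {u. anc J u = 0 \<and> val J u = z}) \<le> B" for J
    proof (intro exI allI)
      fix z
      show "real (card {u. anc J u = 0 \<and> val J u = z}) \<le> real (card {u. anc J u = 0})"
        by (intro of_nat_mono card_mono finite_anc) auto
    qed
  qed
qed

text \<open>\<open>anc\<close> is monotone, so every regular node before \<open>N\<close> has its
  whole fiber below \<open>n\<close>; only the fibers of 0 and \<open>N\<close> escape the exact
  count.\<close>

lemma card_below:
  assumes N: "N = anc J n" "1 \<le> N"
  shows "(\<Sum>w\<in>{1..<N}. card {u. anc J u = w \<and> Q u}) \<le> card {u. u < n \<and> Q u}"
    and "card {u. u < n \<and> Q u} \<le> (\<Sum>w\<in>{1..<N}. card {u. anc J u = w \<and> Q u}) + card {u. anc J u = 0 \<and> Q u} + card {u. anc J u = N \<and> Q u}"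
proof -
  have fin: "finite {u. anc J u = v \<and> R u}" for v R
    by (rule finite_subset[OF _ finite_anc[of J v]]) auto
  have U: "card (\<Union>w\<in>{1..<N}. {u. anc J u = w \<and> Q u}) = (\<Sum>w\<in>{1..<N}. card {u. anc J u = w \<and> Q u})"
    by (rule card_UN_disjoint) (auto simp: fin)
  have lt: "u < n" if "anc J u < N" for u
    using anc_mono[of n u J] that N by (meson leD not_le)
  have le: "anc J u \<le> N" if "u < n" for u
    using anc_mono[of u n J] that N by simp
  show "(\<Sum>w\<in>{1..<N}. card {u. anc J u = w \<and> Q u}) \<le> card {u. u < n \<and> Q u}"
    unfolding U[symmetric] by (intro card_mono) (auto intro: lt)
  have "{u. u < n \<and> Q u} \<subseteq> ((\<Union>w\<in>{1..<N}. {u. anc J u = w \<and> Q u}) \<union> {u. anc J u = 0 \<and> Q u}) \<union> {u. anc J u = N \<and> Q u}"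
  proof
    fix u assume "u \<in> {u. u < n \<and> Q u}"
    then have "anc J u \<le> N" "Q u" using le by auto
    then show "u \<in> ((\<Union>w\<in>{1..<N}. {u. anc J u = w \<and> Q u}) \<union> {u. anc J u = 0 \<and> Q u}) \<union> {u. anc J u = N \<and> Q u}"
      by (cases "anc J u = 0"; cases "anc J u = N") auto
  qed
  then have "card {u. u < n \<and> Q u} \<le> card (((\<Union>w\<in>{1..<N}. {u. anc J u = w \<and> Q u}) \<union> {u. anc J u = 0 \<and> Q u}) \<union> {u. anc J u = N \<and> Q u})"
    by (intro card_mono) (auto simp: fin)
  also have "\<dots> \<le> (\<Sum>w\<in>{1..<N}. card {u. anc J u = w \<and> Q u}) + card {u. anc J u = 0 \<and> Q u} + card {u. anc J u = N \<and> Q u}"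
    unfolding U[symmetric] by (intro order.trans[OF card_Un_le] add_mono card_Un_le) auto
  finally show "card {u. u < n \<and> Q u} \<le> (\<Sum>w\<in>{1..<N}. card {u. anc J u = w \<and> Q u}) + card {u. anc J u = 0 \<and> Q u} + card {u. anc J u = N \<and> Q u}" .
qed

text \<open>Here \<open>u\<close> stands for \<open>N - 1\<close>, and the summand 1 is the term
  \<open>j = 0\<close>.\<close>

definition count :: "nat \<Rightarrow> int \<Rightarrow> nat" where
  "count n k = card {u. u < n \<and> 1 + altern_sum (x 0) u = k}"

text \<open>Each of three errors is at most \<open>\<epsilon> * n\<close>: the deviation inside the
  full subtrees, the points outside them, and the hits outside them. The last two live over the
  nodes 0 and \<open>N\<close>, a small proportion once there are enough full subtrees.\<close>

lemma count_estimate: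
  "\<exists>C>0. \<forall>J n k v \<epsilon> a. 0 \<le> v \<longrightarrow> 0 \<le> a \<longrightarrow> a \<le> 1 \<longrightarrow> 0 < \<epsilon> \<longrightarrow> v \<le> h * sqrt (real J + 1) \<longrightarrow>
     C \<le> \<epsilon> * (real (anc J n) - 1) \<longrightarrow>
     (\<forall>w\<in>{1..<anc J n}. \<bar>v * real (tree.cnt J (st J w) (k - 1 - (- 1) ^ J * altern_sum (x J) w)) / real (tree.wt J (st J w)) - a\<bar> \<le> \<epsilon>) \<longrightarrow>
     \<bar>v * real (count n k) - a * real n\<bar> \<le> 3 * \<epsilon> * real n"
proof -
  obtain C1 where C1: "C1 > 0" "\<And>J s z. real (tree.cnt J s z) \<le> C1 * (W J / sqrt (real J + 1))"
    using tree.cnt_le by blast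
  obtain C2 where C2: "C2 > 0" "\<And>J z. real (card {u. anc J u = 0 \<and> val J u = z}) \<le> C2 * (W J / sqrt (real J + 1))"
    using card_anc_0_val_le by blast
  obtain C3 where C3: "C3 > 0" "\<And>J. real (card {u. anc J u = 0}) \<le> C3 * W J" using card_anc_0_le by blast
  define C where "C = (real K + 3) * max (C3 + 2) (\<bar>h\<bar> * (C1 + C2))"
  have "C > 0" using C3 by (auto simp: C_def intro!: mult_pos_pos)
  moreover have "\<bar>v * real (count n k) - a * real n\<bar> \<le> 3 * \<epsilon> * real n"
    if v: "0 \<le> v" and a: "0 \<le> a" "a \<le> 1" and \<epsilon>: "0 < \<epsilon>" and vh: "v \<le> h * sqrt (real J + 1)"
      and NC: "C \<le> \<epsilon> * (real (anc J n) - 1)"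
      and L: "\<And>w. w \<in> {1..<anc J n} \<Longrightarrow> \<bar>v * real (tree.cnt J (st J w) (k - 1 - (- 1) ^ J * altern_sum (x J) w)) / real (tree.wt J (st J w)) - a\<bar> \<le> \<epsilon>"
    for J n k v \<epsilon> a
  proof -
    define N where "N = anc J n"
    have "0 < \<epsilon> * (real N - 1)" using NC \<open>C > 0\<close> by (simp add: N_def)
    then have N: "1 < real N" using \<epsilon> by (simp add: zero_less_mult_iff)
    then have N1: "1 \<le> N" by simp
    \<comment> \<open>What the bits below level \<open>J\<close> must add up to, once the sum
      remaining above the node \<open>w\<close> is subtracted.\<close>
    define Y where "Y w = k - 1 - (- 1) ^ J * altern_sum (x J) w" for w
    have val: "1 + altern_sum (x 0) u = k \<longleftrightarrow> val J u = Y (anc J u)" for u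
      unfolding Y_def using altern_sum_eq_val[of u J] by auto
    define Sw where "Sw = (\<Sum>w\<in>{1..<N}. real (tree.wt J (st J w)))"
    define Sc where "Sc = (\<Sum>w\<in>{1..<N}. real (tree.cnt J (st J w) (Y w)))"
    have cw: "card {u. anc J u = w \<and> 1 + altern_sum (x 0) u = k} = tree.cnt J (st J w) (Y w)" if "1 \<le> w" for w
    proof -
      have "{u. anc J u = w \<and> 1 + altern_sum (x 0) u = k} = {u. anc J u = w \<and> val J u = Y w}"
        by (rule Collect_cong) (auto simp: val)
      then show ?thesis using anc_fiber[OF that, of J] by simp
    qed
    have c0: "card {u. anc J u = 0 \<and> 1 + altern_sum (x 0) u = k} = card {u. anc J u = 0 \<and> val J u = Y 0}"
      by (rule arg_cong[where f = card], rule Collect_cong) (auto simp: val)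
    have cs: "(\<Sum>w\<in>{1..<N}. card {u. anc J u = w \<and> 1 + altern_sum (x 0) u = k}) = (\<Sum>w\<in>{1..<N}. tree.cnt J (st J w) (Y w))"
      by (intro sum.cong refl cw) auto
    note cb = card_below[OF N_def N1, of "\<lambda>u. 1 + altern_sum (x 0) u = k", unfolded cs cw[OF N1] c0, folded count_def]
    have cb1: "Sc \<le> real (count n k)" using of_nat_mono[OF cb(1)] by (simp add: Sc_def)
    have cb2: "real (count n k) \<le> Sc + (C1 + C2) * (W J / sqrt (real J + 1))"
    proof -
      have "real (count n k) \<le> Sc + real (card {u. anc J u = 0 \<and> val J u = Y 0}) + real (tree.cnt J (st J N) (Y N))"
        using of_nat_mono[OF cb(2), where 'a = real] by (simp add: Sc_def)
      also have "\<dots> \<le> Sc + C2 * (W J / sqrt (real J + 1)) + C1 * (W J / sqrt (real J + 1))"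
        by (intro add_mono C1 C2 order.refl)
      finally show ?thesis by (simp add: algebra_simps add_divide_distrib)
    qed
    have ws: "(\<Sum>w\<in>{1..<N}. card {u. anc J u = w \<and> True}) = (\<Sum>w\<in>{1..<N}. tree.wt J (st J w))"
      using anc_fiber by (intro sum.cong refl) auto
    have wN: "card {u. anc J u = N \<and> True} = tree.wt J (st J N)" using anc_fiber[OF N1] by simp
    note wb = card_below[OF N_def N1, of "\<lambda>_. True", unfolded ws wN]
    have wb1: "Sw \<le> real n" using of_nat_mono[OF wb(1), where 'a = real] by (simp add: Sw_def)
    have wb2: "real n \<le> Sw + (C3 + 2) * W J"
    proof -
      have "real n \<le> Sw + real (card {u. anc J u = 0}) + real (tree.wt J (st J N))"
        using of_nat_mono[OF wb(2), where 'a = real] by (simp add: Sw_def)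
      also have "\<dots> \<le> Sw + C3 * W J + 2 * W J"
        using of_nat_mono[OF tree.wt_le_False[of J "st J N"], where 'a = real] by (intro add_mono C3 order.refl) simp
      finally show ?thesis by (simp add: algebra_simps)
    qed
    have "(real N - 1) * W J \<le> (real K + 3) * Sw"
    proof -
      have "W J \<le> (real K + 3) * real (tree.wt J (st J w))" for w
        using of_nat_mono[OF tree.W_False_le_wt[of J "st J w"], where 'a = real] by (simp add: algebra_simps)
      then have "(\<Sum>w\<in>{1..<N}. W J) \<le> (\<Sum>w\<in>{1..<N}. (real K + 3) * real (tree.wt J (st J w)))" by (intro sum_mono)
      then show ?thesis using N1 by (simp add: Sw_def sum_distrib_left of_nat_diff)
    qed
    then have NW: "(real N - 1) * W J \<le> (real K + 3) * real n" using wb1 by (meson mult_left_mono order.trans add_nonneg_nonneg of_nat_0_le_iff zero_le_numeral)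
    have small: "c * W J \<le> \<epsilon> * real n" if c: "(real K + 3) * c \<le> C" for c
    proof -
      have "c * W J * (real K + 3) \<le> C * W J" using c W_pos[of J] by (simp add: mult_ac)
      also have "\<dots> \<le> \<epsilon> * (real N - 1) * W J" using NC W_pos[of J] by (intro mult_right_mono) (auto simp: N_def)
      also have "\<dots> \<le> \<epsilon> * ((real K + 3) * real n)" using NW \<epsilon> by simp
      finally have "c * W J * (real K + 3) \<le> \<epsilon> * real n * (real K + 3)" by (simp add: mult_ac)
      then show ?thesis by simp
    qed
    have e1: "(C3 + 2) * W J \<le> \<epsilon> * real n"
      by (rule small) (auto simp: C_def)
    have e2: "v * ((C1 + C2) * (W J / sqrt (real J + 1))) \<le> \<epsilon> * real n"
    proof -
      have "v / sqrt (real J + 1) \<le> \<bar>h\<bar>" using vh by (simp add: field_simps) (meson abs_ge_self mult_right_mono order.trans real_sqrt_ge_zero of_nat_0_le_iff add_nonneg_nonneg zero_le_one)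
      then have "v / sqrt (real J + 1) * ((C1 + C2) * W J) \<le> \<bar>h\<bar> * ((C1 + C2) * W J)"
        using C1 C2 W_pos[of J] by (intro mult_right_mono) auto
      also have "\<dots> = (\<bar>h\<bar> * (C1 + C2)) * W J" by simp
      also have "\<dots> \<le> \<epsilon> * real n" by (rule small) (auto simp: C_def)
      finally show ?thesis by (simp add: mult_ac)
    qed
    have e3: "\<bar>v * Sc - a * Sw\<bar> \<le> \<epsilon> * Sw"
    proof -
      have "\<bar>v * real (tree.cnt J (st J w) (Y w)) - a * real (tree.wt J (st J w))\<bar> \<le> \<epsilon> * real (tree.wt J (st J w))" if "w \<in> {1..<N}" for w
      proof -
        have wt: "0 < real (tree.wt J (st J w))" using tree.wt_pos by simp
        have "v * real (tree.cnt J (st J w) (Y w)) - a * real (tree.wt J (st J w)) =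
          (v * real (tree.cnt J (st J w) (Y w)) / real (tree.wt J (st J w)) - a) * real (tree.wt J (st J w))"
          using wt by (simp add: field_simps)
        then show ?thesis using L[of w] that wt by (simp add: abs_mult Y_def N_def mult_right_mono)
      qed
      then have "\<bar>\<Sum>w\<in>{1..<N}. v * real (tree.cnt J (st J w) (Y w)) - a * real (tree.wt J (st J w))\<bar> \<le> (\<Sum>w\<in>{1..<N}. \<epsilon> * real (tree.wt J (st J w)))"
        by (intro order.trans[OF sum_abs] sum_mono)
      then show ?thesis by (simp add: Sc_def Sw_def sum_subtractf sum_distrib_left)
    qed
    have "\<epsilon> * Sw \<le> \<epsilon> * real n" using wb1 \<epsilon> by simp
    moreover have "a * (real n - Sw) \<le> (C3 + 2) * W J"
    proof -
      have "a * (real n - Sw) \<le> 1 * (real n - Sw)" using a wb1 by (intro mult_right_mono) auto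
      also have "\<dots> \<le> (C3 + 2) * W J" using wb2 by simp
      finally show ?thesis .
    qed
    moreover have "0 \<le> a * (real n - Sw)" using a wb1 by simp
    moreover have "0 \<le> v * (real (count n k) - Sc)" using v cb1 by simp
    moreover have "real (count n k) - Sc \<le> (C1 + C2) * (W J / sqrt (real J + 1))" using cb2 by simp
    then have "v * (real (count n k) - Sc) \<le> v * ((C1 + C2) * (W J / sqrt (real J + 1)))" by (rule mult_left_mono[OF _ v])
    moreover have "v * real (count n k) - a * real n = (v * Sc - a * Sw) + v * (real (count n k) - Sc) - a * (real n - Sw)"
      by (simp add: algebra_simps)
    ultimately show ?thesis using e1 e2 e3 unfolding abs_le_iff by linarith
  qed
  ultimately show ?thesis by (intro exI[of _ C]) blast
qed

end

lemma same_orderI: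
  assumes "0 < c1" and ev: "\<forall>\<^sub>F n in sequentially. 0 < g n \<and> c1 * g n \<le> f n \<and> f n \<le> c2 * g n"
  shows "same_order f g"
proof -
  obtain N where N: "\<And>n. n \<ge> N \<Longrightarrow> 0 < g n \<and> c1 * g n \<le> f n \<and> f n \<le> c2 * g n"
    using ev by (auto simp: eventually_sequentially)
  define C where "C = max 2 (max c2 (1 / c1))"
  have C: "2 \<le> C" "c2 \<le> C" "1 / c1 \<le> C" by (auto simp: C_def)
  have "inverse C \<le> f n / g n \<and> f n / g n \<le> C" if "n > max N 2" for n
  proof -
    have n: "0 < g n" "c1 * g n \<le> f n" "f n \<le> c2 * g n" using N[of n] that by auto
    have "inverse C \<le> c1" using C \<open>0 < c1\<close> by (simp add: field_simps)
    then have "inverse C * g n \<le> f n" using n by (meson less_imp_le mult_right_mono order.trans)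
    moreover have "f n \<le> C * g n" using n C by (meson less_imp_le mult_right_mono order.trans)
    ultimately show ?thesis using n by (simp add: pos_le_divide_eq pos_divide_le_eq)
  qed
  then show ?thesis unfolding same_order_def using C by (intro exI[of _ C] conjI exI[of _ "max N 2"]) auto
qed

section \<open>Choice of the level and passage to the limit\<close>

context even_digits
begin

lemma P_add_le: "P (J + i) \<le> P J * (1 - \<delta>) ^ i"
proof (induction i)
  case (Suc i)
  have "P (J + Suc i) = P (J + i) * y (J + i)" by (simp add: P_Suc)
  also have "\<dots> \<le> P J * (1 - \<delta>) ^ i * (1 - \<delta>)"
    using Suc y[of "J + i"] P_pos[of J] \<delta>_less_1 by (intro mult_mono) auto
  finally show ?case by (simp add: mult_ac)
qed simp

lemma P_add_ge: "P J * \<delta> ^ i \<le> P (J + i)"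
proof (induction i)
  case (Suc i)
  have "P J * \<delta> ^ Suc i = P J * \<delta> ^ i * \<delta>" by simp
  also have "\<dots> \<le> P (J + i) * y (J + i)"
    using Suc y[of "J + i"] P_pos[of "J + i"] \<delta>_pos by (intro mult_mono) auto
  finally show ?case by (simp add: P_Suc)
qed simp

lemma power_small: "0 < h \<Longrightarrow> \<exists>i. c * (1 - \<delta>) ^ i < h" for h c :: real
proof -
  assume h: "0 < h"
  have "(\<lambda>i. c * (1 - \<delta>) ^ i) \<longlonglongrightarrow> c * 0"
    using \<delta>_pos \<delta>_less_1 by (intro tendsto_intros LIMSEQ_power_zero) auto
  then have "\<forall>\<^sub>F i in sequentially. c * (1 - \<delta>) ^ i < h" using h by (intro order_tendstoD) auto
  then show ?thesis by (meson eventually_sequentially order.refl)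
qed

text \<open>The last level \<open>i\<close> with \<open>real n * P i\<close> at least
  \<open>h\<close>, that is, with about \<open>h\<close> subtrees in the segment. The set is an
  initial segment of the positive integers, so its size is its maximum, and 0 if it is
  empty.\<close>

definition lev :: "real \<Rightarrow> nat \<Rightarrow> nat" where
  "lev h n = card {i. 1 \<le> i \<and> h \<le> real n * P i}"

lemma P_antimono: "i \<le> j \<Longrightarrow> P j \<le> P i"
proof -
  assume "i \<le> j"
  then obtain k where j: "j = i + k" using le_Suc_ex by blast
  have "(1 - \<delta>) ^ k \<le> 1" using \<delta>_pos \<delta>_less_1 by (intro power_le_one) auto
  then have "P i * (1 - \<delta>) ^ k \<le> P i * 1" using P_pos[of i] by (intro mult_left_mono) auto
  then show ?thesis using P_add_le[of i k] by (simp add: j)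
qed

lemma finite_lev: "0 < h \<Longrightarrow> finite {i. 1 \<le> i \<and> h \<le> real n * P i}"
proof -
  assume "0 < h"
  then obtain i where i: "real n * (1 - \<delta>) ^ i < h" using power_small by blast
  have "j < i" if "h \<le> real n * P j" for j
  proof (rule ccontr)
    assume "\<not> j < i"
    then have "real n * P j \<le> real n * P i" by (intro mult_left_mono P_antimono) auto
    also have "\<dots> \<le> real n * (1 - \<delta>) ^ i" using P_add_le[of 0 i] by (intro mult_left_mono) auto
    finally show False using i that by simp
  qed
  then have "{i. 1 \<le> i \<and> h \<le> real n * P i} \<subseteq> {..<i}" by auto
  then show ?thesis by (rule finite_subset) simp
qed

lemma le_lev_iff:
  assumes h: "0 < h" and i: "1 \<le> i"
  shows "i \<le> lev h n \<longleftrightarrow> h \<le> real n * P i"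
proof -
  let ?S = "{i. 1 \<le> i \<and> h \<le> real n * P i}"
  have down: "j \<in> ?S" if "k \<in> ?S" "1 \<le> j" "j \<le> k" for j k
  proof -
    have "real n * P k \<le> real n * P j" by (intro mult_left_mono P_antimono that) auto
    then show ?thesis using that by auto
  qed
  show ?thesis
  proof (cases "?S = {}")
    case True
    have "lev h n = 0" unfolding lev_def by (simp only: True card.empty)
    then show ?thesis using True i by auto
  next
    case False
    define M where "M = Max ?S"
    have M: "M \<in> ?S" unfolding M_def by (rule Max_in[OF finite_lev[OF h] False])
    have "?S = {1..M}"
    proof (intro equalityI subsetI)
      fix j assume "j \<in> ?S"
      then show "j \<in> {1..M}" using Max_ge[OF finite_lev[OF h]] by (auto simp: M_def)
    next
      fix j assume "j \<in> {1..M}"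
      then show "j \<in> ?S" using down[OF M, of j] by simp
    qed
    then have "lev h n = M" "i \<in> ?S \<longleftrightarrow> i \<le> M" using i by (auto simp: lev_def)
    then show ?thesis using i by auto
  qed
qed

lemma lev_ge: "0 < h \<Longrightarrow> h \<le> real n \<Longrightarrow> h \<le> real n * P (lev h n)"
  using le_lev_iff[of h "lev h n" n] by (cases "lev h n = 0") auto

lemma lev_less: "0 < h \<Longrightarrow> real n * P (Suc (lev h n)) < h"
  using le_lev_iff[of h "Suc (lev h n)" n] by auto

lemma lev_lessI:
  assumes h: "0 < h" and "real n * P (Suc i) < h"
  shows "lev h n \<le> i"
  using le_lev_iff[OF h, of "Suc i" n] assms(2) by auto

lemma lev_mono: "0 < h \<Longrightarrow> n \<le> n' \<Longrightarrow> lev h n \<le> lev h n'"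
proof (cases "lev h n = 0")
  case False
  assume h: "0 < h" and n: "n \<le> n'"
  have "h \<le> real n * P (lev h n)" using le_lev_iff[OF h, of "lev h n" n] False by auto
  also have "\<dots> \<le> real n' * P (lev h n)" using n P_pos[of "lev h n"] by (intro mult_right_mono) auto
  finally show ?thesis using le_lev_iff[OF h, of "lev h n" n'] False by auto
qed simp

lemma lev_antimono: "0 < h \<Longrightarrow> h \<le> h' \<Longrightarrow> lev h' n \<le> lev h n"
  unfolding lev_def by (rule card_mono[OF finite_lev]) auto

text \<open>\<open>P\<close> decays geometrically, so raising the threshold costs boundedly many
  levels. This separates \<open>\<nu>\<close>, defined with threshold 1, from the threshold dictated
  by the precision.\<close>

lemma lev_1_le: "\<exists>i0. \<forall>n h'. 0 < h' \<longrightarrow> h' \<le> h \<longrightarrow> lev 1 n \<le> lev h' n + i0"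
proof -
  obtain i where i: "h * (1 - \<delta>) ^ i < 1" using power_small[of 1 h] by auto
  have "lev 1 n \<le> lev h' n + i" if h: "0 < h'" "h' \<le> h" for n h'
  proof (rule lev_lessI)
    have "real n * P (Suc (lev h' n) + i) \<le> real n * (P (Suc (lev h' n)) * (1 - \<delta>) ^ i)"
      by (intro mult_left_mono P_add_le) auto
    also have "\<dots> = real n * P (Suc (lev h' n)) * (1 - \<delta>) ^ i" by simp
    also have "\<dots> \<le> h * (1 - \<delta>) ^ i" using lev_less[OF h(1), of n] h \<delta>_less_1 by (intro mult_right_mono) auto
    finally show "real n * P (Suc (lev h' n + i)) < 1" using i by simp
  qed simp
  then show ?thesis by blast
qed

lemma lev_jump: "\<exists>i0. \<forall>n. lev 1 (Suc n) \<le> lev 1 n + i0"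
proof -
  obtain i where i: "2 * (1 - \<delta>) ^ i < 1" using power_small[of 1 2] by auto
  have "lev 1 (Suc n) \<le> lev 1 n + i" for n
  \<comment> \<open>The factor 2 in the choice of \<open>i\<close> comes from
    \<open>n + 1 \<le> 2 * n\<close>, which fails at 0.\<close>
  proof (cases "n = 0")
    case True
    have "real 1 * P (Suc 0) < 1" using y(4)[of 0] by (simp add: P_Suc)
    then have "lev 1 1 \<le> 0" by (intro lev_lessI) auto
    then show ?thesis using True by simp
  next
    case False
    show ?thesis
    proof (rule lev_lessI)
      have "real (Suc n) * P (Suc (lev 1 n) + i) \<le> (2 * real n) * (P (Suc (lev 1 n)) * (1 - \<delta>) ^ i)"
        using False P_pos \<delta>_less_1 by (intro mult_mono P_add_le) (auto intro!: less_imp_le)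
      also have "\<dots> = (real n * P (Suc (lev 1 n))) * (2 * (1 - \<delta>) ^ i)" by simp
      also have "\<dots> \<le> 1 * (2 * (1 - \<delta>) ^ i)" using lev_less[of 1 n] \<delta>_less_1 by (intro mult_right_mono) auto
      finally show "real (Suc n) * P (Suc (lev 1 n + i)) < 1" using i by simp
    qed simp
  qed
  then show ?thesis by blast
qed

text \<open>Halved because each summand of \<open>A\<close> covers two levels; the level in use is
  then \<open>2 * \<nu> n\<close>, off by at most 1.\<close>

definition \<nu> :: "nat \<Rightarrow> nat" where "\<nu> n = lev 1 n div 2"

lemma mono_\<nu>: "mono \<nu>"
  unfolding \<nu>_def by (intro monoI div_le_mono lev_mono) auto

lemma \<nu>_jump: "\<exists>k. \<forall>n. \<nu> (Suc n) \<le> \<nu> n + k"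
proof -
  obtain i0 where i0: "\<And>n. lev 1 (Suc n) \<le> lev 1 n + i0" using lev_jump by blast
  have "\<nu> (Suc n) \<le> \<nu> n + (i0 + 1)" for n using i0[of n] unfolding \<nu>_def by linarith
  then show ?thesis by blast
qed

lemma \<nu>_ln: "\<exists>c1>0. \<exists>c2. \<forall>\<^sub>F n in sequentially. 0 < ln (real n) \<and> c1 * ln (real n) \<le> real (\<nu> n) \<and> real (\<nu> n) \<le> c2 * ln (real n)"
proof -
  define a where "a = - ln (1 - \<delta>)"
  define b where "b = - ln \<delta>"
  have a: "a > 0" and b: "b > 0" using \<delta>_pos \<delta>_less_1 by (auto simp: a_def b_def)
  \<comment> \<open>From here on the additive constant \<open>2 * b\<close> in the lower bound is at
    most half of \<open>ln n\<close>.\<close>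
  have "\<forall>\<^sub>F n in sequentially. ln (real n) \<ge> 4 * b" by real_asymp
  moreover have "\<forall>\<^sub>F n in sequentially. ln (real n) > 0" by real_asymp
  ultimately have "\<forall>\<^sub>F n in sequentially. 0 < ln (real n) \<and> 1 / (4 * b) * ln (real n) \<le> real (\<nu> n) \<and> real (\<nu> n) \<le> 1 / a * ln (real n)"
    using eventually_ge_at_top[of 1]
  proof eventually_elim
    case (elim n)
    define L where "L = lev 1 n"
    have n: "0 < real n" using elim by simp
    have "1 \<le> real n * P L" unfolding L_def using elim by (intro lev_ge) auto
    also have "\<dots> \<le> real n * (1 - \<delta>) ^ L" using P_add_le[of 0 L] by (intro mult_left_mono) auto
    finally have "ln 1 \<le> ln (real n * (1 - \<delta>) ^ L)" using n \<delta>_less_1 by (intro ln_mono) auto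
    also have "\<dots> = ln (real n) - real L * a" using n \<delta>_less_1 by (simp add: ln_mult ln_realpow a_def)
    finally have up: "real L * a \<le> ln (real n)" by simp
    have "real n * \<delta> ^ Suc L \<le> real n * P (Suc L)" using P_add_ge[of 0 "Suc L"] by (intro mult_left_mono) auto
    also have "\<dots> < 1" unfolding L_def by (rule lev_less) simp
    finally have "ln (real n * \<delta> ^ Suc L) < ln 1" using n \<delta>_pos by (subst ln_less_cancel_iff) auto
    moreover have "ln (real n * \<delta> ^ Suc L) = ln (real n) + real (Suc L) * ln \<delta>"
      using n \<delta>_pos by (subst ln_mult) (auto simp: ln_realpow simp del: power_Suc)
    ultimately have low: "ln (real n) < (real L + 1) * b" by (simp add: b_def algebra_simps)
    have nu: "real L \<le> 2 * real (\<nu> n) + 1" "2 * real (\<nu> n) \<le> real L"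
    proof -
      have "L \<le> 2 * \<nu> n + 1" "2 * \<nu> n \<le> L" unfolding \<nu>_def L_def by linarith+
      then show "real L \<le> 2 * real (\<nu> n) + 1" "2 * real (\<nu> n) \<le> real L" by linarith+
    qed
    have "(real L + 1) * b \<le> (2 * real (\<nu> n) + 2) * b" using nu b by (intro mult_right_mono) auto
    then have "ln (real n) \<le> 4 * b * real (\<nu> n)" using low elim by (simp add: algebra_simps)
    then have "1 / (4 * b) * ln (real n) \<le> real (\<nu> n)" using b by (simp add: field_simps)
    moreover have "real (\<nu> n) * a \<le> real L * a" using nu a by (intro mult_right_mono) auto
    then have "real (\<nu> n) * a \<le> ln (real n)" using up by linarith
    then have "real (\<nu> n) \<le> 1 / a * ln (real n)" using a by (simp add: field_simps)
    ultimately show ?case using elim by simp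
  qed
  then show ?thesis using b by (intro exI[of _ "1 / (4 * b)"] conjI exI[of _ "1 / a"]) auto
qed

lemma filterlim_\<nu>: "filterlim \<nu> at_top sequentially"
proof -
  obtain c1 c2 where c1: "c1 > 0" and nu: "\<forall>\<^sub>F n in sequentially. 0 < ln (real n) \<and> c1 * ln (real n) \<le> real (\<nu> n) \<and> real (\<nu> n) \<le> c2 * ln (real n)"
    using \<nu>_ln by blast
  have "filterlim (\<lambda>n. real (\<nu> n)) at_top sequentially"
  proof (rule filterlim_at_top_mono)
    show "filterlim (\<lambda>n::nat. c1 * ln (real n)) at_top sequentially" using c1 by real_asymp
    show "\<forall>\<^sub>F n in sequentially. c1 * ln (real n) \<le> real (\<nu> n)" using nu by eventually_elim simp
  qed
  then show ?thesis using filterlim_sequentially_iff_filterlim_real by blast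
qed

text \<open>Levels \<open>2 * j - 2\<close> and \<open>2 * j - 1\<close> carry the digits with
  indices \<open>2 * j - 1\<close> and \<open>2 * j\<close>. Together with the passage from twice
  the discrepancy to the discrepancy, the 1/2 becomes the 1/4 of \<open>A\<close>.\<close>

lemma center_even:
  assumes "\<And>k. d k = mm (Suc k)"
  shows "tree.center (2 * v) = 1 / 2 * real_of_int (\<Sum>j = 1..v. sgn (mm (2 * j)) - sgn (mm (2 * j - 1)))"
proof -
  have s: "sg (2 * v) = - sgn (mm (Suc (2 * v)))" "sg (Suc (2 * v)) = sgn (mm (Suc (Suc (2 * v))))" for v
    by (simp_all add: sg_def assms)
  have "(\<Sum>k<2 * v. sg k) = (\<Sum>j = 1..v. sgn (mm (2 * j)) - sgn (mm (2 * j - 1)))"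
    by (induction v) (simp_all add: s)
  then show ?thesis unfolding tree.center_def by (simp flip: of_int_sum)
qed

lemma center_diff: "\<bar>tree.center J - tree.center J'\<bar> \<le> \<bar>real J - real J'\<bar> / 2"
proof -
  have "\<bar>tree.center (Suc J) - tree.center J\<bar> \<le> 1 / 2" for J
  proof -
    have "tree.center (Suc J) - tree.center J = of_int (sg J) / 2"
      by (simp add: tree.center_def add_divide_distrib)
    moreover have "\<bar>real_of_int (sg J)\<bar> = 1" using tree.sg[of J] by (simp flip: of_int_abs)
    ultimately show ?thesis by (simp only: abs_divide)
  qed
  from bounded_increments[of tree.center "1 / 2" J J', OF this] show ?thesis by simp
qed

text \<open>The subtrees are taken at a level \<open>J n\<close> depending on the precision. It
  differs from \<open>2 * \<nu> n\<close> by O(1), so exchanging \<open>V\<close> and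
  \<open>center\<close> between the two levels alters the normalized argument by a null sequence
  only.\<close>

lemma count_limit:
  assumes C: "0 < C" and c: "0 < c" and V1: "\<And>J. \<bar>V (Suc J) - V J\<bar> \<le> C"
    and Vc: "\<forall>\<^sub>F J in sequentially. c * real J \<le> V J" and e: "e \<longlonglongrightarrow> 0"
    and llt: "\<forall>\<^sub>F J in sequentially. \<forall>s y.
        \<bar>sqrt (V J) * real (tree.cnt J s y) / real (tree.wt J s) - std_normal_density ((of_int y - tree.center J) / sqrt (V J))\<bar> \<le> e J"
    and v: "\<And>n. v n = sqrt (max 1 (V (2 * \<nu> n)))"
    and lim: "(\<lambda>n. (of_int (k n) - tree.center (2 * \<nu> n)) / v n) \<longlonglongrightarrow> t"
  shows "(\<lambda>n. v n * real (count n (k n)) / real n) \<longlonglongrightarrow> std_normal_density t"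
proof -
  define \<phi> where "\<phi> = std_normal_density"
  have \<phi>1: "0 \<le> \<phi> t" "\<phi> t \<le> 1" unfolding \<phi>_def by (simp_all add: std_normal_density_le_1)
  note Vdiff = bounded_increments[of V C, OF V1]
  define h where "h = sqrt (\<bar>V 0\<bar> + C)"
  have Vh: "sqrt (V J) \<le> h * sqrt (real J + 1)" for J
  proof -
    have "V J \<le> \<bar>V 0\<bar> * 1 + C * real J" using Vdiff[of J 0] by simp
    also have "\<dots> \<le> \<bar>V 0\<bar> * (real J + 1) + C * (real J + 1)" using C by (intro add_mono mult_left_mono) auto
    finally have "V J \<le> (\<bar>V 0\<bar> + C) * (real J + 1)" by (simp add: algebra_simps)
    then show ?thesis by (simp add: h_def flip: real_sqrt_mult)
  qed
  obtain C0 where C0: "0 < C0" and est: "\<And>J n k v \<epsilon> a. \<lbrakk>0 \<le> v; 0 \<le> a; a \<le> 1; 0 < \<epsilon>; v \<le> h * sqrt (real J + 1);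
     C0 \<le> \<epsilon> * (real (anc J n) - 1);
     \<And>w. w\<in>{1..<anc J n} \<Longrightarrow> \<bar>v * real (tree.cnt J (st J w) (k - 1 - (- 1) ^ J * altern_sum (x J) w)) / real (tree.wt J (st J w)) - a\<bar> \<le> \<epsilon>\<rbrakk> \<Longrightarrow>
     \<bar>v * real (count n k) - a * real n\<bar> \<le> 3 * \<epsilon> * real n"
    using count_estimate[of h] by metis
  have Vinf: "filterlim V at_top sequentially"
    by (rule filterlim_at_top_mono[OF _ Vc]) (use c in real_asymp)
  have isq: "(\<lambda>J. 1 / sqrt (V J)) \<longlonglongrightarrow> 0"
    by (intro tendsto_divide_0[OF tendsto_const] filterlim_at_top_imp_at_infinity filterlim_compose[OF sqrt_at_top Vinf])
  have inv: "(\<lambda>J. 1 / V J) \<longlonglongrightarrow> 0"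
    by (intro tendsto_divide_0[OF tendsto_const] filterlim_at_top_imp_at_infinity Vinf)
  have "\<forall>\<^sub>F n in sequentially. \<bar>v n * real (count n (k n)) / real n - \<phi> t\<bar> < \<epsilon>" if \<epsilon>: "0 < \<epsilon>" for \<epsilon>
  proof -
    \<comment> \<open>The estimate gives \<open>3 * \<epsilon>1\<close>, doubled by
      \<open>\<bar>r n\<bar> \<le> 2\<close>; this is half of \<open>\<epsilon>\<close>, and the
      change of normalization takes the other half.\<close>
    define \<epsilon>1 where "\<epsilon>1 = \<epsilon> / 12"
    have \<epsilon>1: "0 < \<epsilon>1" using \<epsilon> by (simp add: \<epsilon>1_def)
    \<comment> \<open>By \<open>anc_ge\<close> at least \<open>C0 / \<epsilon>1 + 2\<close> nodes
      remain at level \<open>J n\<close>, enough for the premise of the estimate.\<close>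
    define H where "H = C0 / \<epsilon>1 + 2 + 1 / \<delta>"
    have H: "1 \<le> H" using C0 \<epsilon>1 \<delta>_pos by (simp add: H_def add_nonneg_nonneg)
    define J where "J = lev H"
    obtain i0 where i00: "\<forall>n h'. 0 < h' \<longrightarrow> h' \<le> H \<longrightarrow> lev 1 n \<le> lev h' n + i0" using lev_1_le[of H] by blast
    have i0: "lev 1 n \<le> J n + i0" for n
      using spec[OF spec[OF i00, of n], of H] H unfolding J_def by simp
    define D where "D = real i0 + 2"
    have JD: "\<bar>real (J n) - real (2 * \<nu> n)\<bar> \<le> D" for n
    proof -
      have "J n \<le> lev 1 n" unfolding J_def using H by (intro lev_antimono) auto
      then have "J n \<le> 2 * \<nu> n + 1" "2 * \<nu> n \<le> J n + i0" unfolding \<nu>_def using i0[of n] by linarith+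
      then show ?thesis unfolding D_def by linarith
    qed
    have "filterlim J at_top sequentially"
    proof -
      have "filterlim (\<lambda>n. real (J n)) at_top sequentially"
      proof (rule filterlim_at_top_mono)
        have "filterlim (\<lambda>n. 2 * real n - D) at_top sequentially" by real_asymp
        then show "filterlim (\<lambda>n. 2 * real (\<nu> n) - D) at_top sequentially"
          by (rule filterlim_compose[OF _ filterlim_\<nu>])
        show "\<forall>\<^sub>F n in sequentially. 2 * real (\<nu> n) - D \<le> real (J n)"
        proof (intro always_eventually allI)
          fix n
          show "2 * real (\<nu> n) - D \<le> real (J n)" using JD[of n] by (simp add: abs_le_iff)
        qed
      qed
      then show ?thesis using filterlim_sequentially_iff_filterlim_real by blast
    qed
    note J_ev = this[THEN filterlim_iff[THEN iffD1], rule_format] and J_lim = filterlim_compose[OF _ this]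
    have Vpos: "\<forall>\<^sub>F n in sequentially. 0 < V (J n)"
      using J_ev[of "\<lambda>J. 0 < V J"] Vinf by (simp add: filterlim_at_top_dense)
    define r where "r n = v n / sqrt (V (J n))" for n
    have V2: "\<forall>\<^sub>F n in sequentially. 1 \<le> V (2 * \<nu> n)"
    proof -
      have "filterlim (\<lambda>n. 2 * \<nu> n) at_top sequentially"
        by (rule filterlim_at_top_mono[OF filterlim_\<nu>]) auto
      from filterlim_compose[OF Vinf this] show ?thesis by (simp add: filterlim_at_top)
    qed
    have r1: "r \<longlonglongrightarrow> 1"
    proof -
      have "(\<lambda>n. (V (2 * \<nu> n) - V (J n)) * (1 / V (J n))) \<longlonglongrightarrow> 0"
      proof (rule Lim_null_comparison)
        show "(\<lambda>n. C * D * \<bar>1 / V (J n)\<bar>) \<longlonglongrightarrow> 0"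
          by (rule tendsto_mult_right_zero[OF tendsto_rabs_zero[OF J_lim[OF inv]]])
        show "\<forall>\<^sub>F n in sequentially. norm ((V (2 * \<nu> n) - V (J n)) * (1 / V (J n))) \<le> C * D * \<bar>1 / V (J n)\<bar>"
        proof (intro always_eventually allI)
          fix n
          have "\<bar>V (2 * \<nu> n) - V (J n)\<bar> \<le> C * \<bar>real (2 * \<nu> n) - real (J n)\<bar>" by (rule Vdiff)
          also have "\<dots> \<le> C * D" using JD[of n] C by (intro mult_left_mono) (auto simp: abs_minus_commute)
          finally show "norm ((V (2 * \<nu> n) - V (J n)) * (1 / V (J n))) \<le> C * D * \<bar>1 / V (J n)\<bar>"
            unfolding real_norm_def abs_mult by (intro mult_right_mono) auto
        qed
      qed
      then have "(\<lambda>n. sqrt (1 + (V (2 * \<nu> n) - V (J n)) * (1 / V (J n)))) \<longlonglongrightarrow> sqrt (1 + 0)"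
        by (intro tendsto_intros)
      then have "(\<lambda>n. sqrt (1 + (V (2 * \<nu> n) - V (J n)) / V (J n))) \<longlonglongrightarrow> 1" by simp
      then show ?thesis
      proof (rule Lim_transform_eventually)
        show "\<forall>\<^sub>F n in sequentially. sqrt (1 + (V (2 * \<nu> n) - V (J n)) / V (J n)) = r n"
          using Vpos V2
        proof eventually_elim
          case (elim n)
          have "1 + (V (2 * \<nu> n) - V (J n)) / V (J n) = V (2 * \<nu> n) / V (J n)" using elim by (simp add: field_simps)
          then show ?case using elim by (simp add: r_def v real_sqrt_divide max_def)
        qed
      qed
    qed
    define a where "a n = (of_int (k n) - tree.center (2 * \<nu> n)) / sqrt (V (J n))" for n
    have a: "a \<longlonglongrightarrow> t"
    proof -
      have "(\<lambda>n. (of_int (k n) - tree.center (2 * \<nu> n)) / v n * r n) \<longlonglongrightarrow> t * 1" by (intro tendsto_intros lim r1)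
      moreover have "(of_int (k n) - tree.center (2 * \<nu> n)) / v n * r n = a n" for n
      proof -
        have "v n \<noteq> 0" by (simp add: v max_def)
        then show ?thesis by (simp add: r_def a_def)
      qed
      ultimately show ?thesis by simp
    qed
    \<comment> \<open>The shift of the target by the remaining sum is at most \<open>1 + w\<close>
      with \<open>w \<le> H / \<delta>\<close>; \<open>D / 2\<close> is the change of
      \<open>center\<close> between the levels.\<close>
    define E where "E = 1 + H / \<delta> + D / 2"
    have aE: "(\<lambda>n. \<bar>a n - t\<bar> + E * (1 / sqrt (V (J n)))) \<longlonglongrightarrow> 0"
    proof -
      have "(\<lambda>n. \<bar>a n - t\<bar> + E * (1 / sqrt (V (J n)))) \<longlonglongrightarrow> \<bar>t - t\<bar> + E * 0"
        by (intro tendsto_intros a J_lim[OF isq])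
      then show ?thesis by simp
    qed
    have "isCont \<phi> t" unfolding \<phi>_def normal_density_def by (intro continuous_intros) auto
    then obtain \<eta> where \<eta>: "\<eta> > 0" "\<And>z. \<bar>z - t\<bar> < \<eta> \<Longrightarrow> \<bar>\<phi> z - \<phi> t\<bar> < \<epsilon>1 / 2"
      using \<epsilon>1 unfolding continuous_at_eps_delta by (metis dist_real_def half_gt_zero)
    have e2: "\<forall>\<^sub>F J in sequentially. e J < \<epsilon>1 / 2" using order_tendstoD(2)[OF e, of "\<epsilon>1 / 2"] \<epsilon>1 by simp
    have main: "\<forall>\<^sub>F n in sequentially. \<bar>sqrt (V (J n)) * real (count n (k n)) - \<phi> t * real n\<bar> \<le> 3 * \<epsilon>1 * real n"
      using order_tendstoD(2)[OF aE \<eta>(1)] J_ev[OF eventually_conj[OF e2 llt]] Vpos eventually_ge_at_top[of "nat \<lceil>H\<rceil>"]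
    proof eventually_elim
      case (elim n)
      have nH: "H \<le> real n" using elim(4) by linarith
      have HP: "H \<le> real n * P (J n)" unfolding J_def using nH H by (intro lev_ge) auto
      have PH: "real n * P (J n) \<le> H / \<delta>"
      proof -
        have "real n * P (J n) * \<delta> \<le> real n * P (Suc (J n))"
          using P_add_ge[of "J n" 1] by (simp add: mult.assoc mult_left_mono)
        also have "\<dots> < H" unfolding J_def using H by (intro lev_less) auto
        finally show ?thesis using \<delta>_pos by (simp add: field_simps)
      qed
      have N1: "C0 / \<epsilon>1 + 1 \<le> real (anc (J n) n)" using anc_ge[of n "J n"] HP by (simp add: H_def)
      have N2: "real (anc (J n) n) \<le> H / \<delta>" using anc_le[of "J n" n] PH by linarith
      show ?case
      proof (rule est)
        show "C0 \<le> \<epsilon>1 * (real (anc (J n) n) - 1)" using N1 \<epsilon>1 by (simp add: field_simps)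
        fix w assume w: "w \<in> {1..<anc (J n) n}"
        define z where "z = k n - 1 - (- 1) ^ J n * altern_sum (x (J n)) w"
        have "\<bar>z - k n\<bar> \<le> 1 + int w"
          using abs_altern_sum_le[of "x (J n)" w] by (cases "even (J n)") (auto simp: z_def)
        then have "\<bar>real_of_int z - real_of_int (k n)\<bar> \<le> 1 + real w" by linarith
        moreover have "real w \<le> H / \<delta>" using w N2 by simp
        moreover have "\<bar>real (2 * \<nu> n) - real (J n)\<bar> \<le> D" using JD[of n] by (simp only: abs_minus_commute)
        then have "\<bar>tree.center (2 * \<nu> n) - tree.center (J n)\<bar> \<le> D / 2"
          by (rule order.trans[OF center_diff divide_right_mono]) simp
        ultimately have "\<bar>(real_of_int z - tree.center (J n)) - (real_of_int (k n) - tree.center (2 * \<nu> n))\<bar> \<le> E"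
          unfolding E_def by linarith
        then have "\<bar>((real_of_int z - tree.center (J n)) - (real_of_int (k n) - tree.center (2 * \<nu> n))) / sqrt (V (J n))\<bar> \<le> E * (1 / sqrt (V (J n)))"
          using elim(3) by (simp add: abs_divide divide_right_mono)
        then have "\<bar>(real_of_int z - tree.center (J n)) / sqrt (V (J n)) - a n\<bar> \<le> E * (1 / sqrt (V (J n)))"
          by (simp add: a_def diff_divide_distrib)
        then have "\<bar>(real_of_int z - tree.center (J n)) / sqrt (V (J n)) - t\<bar> < \<eta>" using elim(1) by linarith
        then have 1: "\<bar>\<phi> ((real_of_int z - tree.center (J n)) / sqrt (V (J n))) - \<phi> t\<bar> < \<epsilon>1 / 2" by (rule \<eta>(2))
        have "\<bar>sqrt (V (J n)) * real (tree.cnt (J n) (st (J n) w) z) / real (tree.wt (J n) (st (J n) w)) - \<phi> ((real_of_int z - tree.center (J n)) / sqrt (V (J n)))\<bar> \<le> e (J n)"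
          unfolding \<phi>_def by (rule elim(2)[THEN conjunct2, THEN spec, THEN spec])
        then show "\<bar>sqrt (V (J n)) * real (tree.cnt (J n) (st (J n) w) (k n - 1 - (- 1) ^ J n * altern_sum (x (J n)) w)) / real (tree.wt (J n) (st (J n) w)) - \<phi> t\<bar> \<le> \<epsilon>1"
          unfolding z_def[symmetric] using 1 conjunct1[OF elim(2)] by linarith
      qed (use \<phi>1 \<epsilon>1 Vh elim(3) in auto)
    qed
    have "\<forall>\<^sub>F n in sequentially. \<bar>r n - 1\<bar> < min 1 (\<epsilon> / 2)"
      using tendstoD[OF r1, of "min 1 (\<epsilon> / 2)"] \<epsilon> by (simp add: dist_real_def)
    then show ?thesis
      using main Vpos eventually_gt_at_top[of 0]
    proof eventually_elim
      case (elim n)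
      define q where "q = sqrt (V (J n)) * real (count n (k n)) / real n"
      have "q - \<phi> t = (sqrt (V (J n)) * real (count n (k n)) - \<phi> t * real n) / real n"
        using elim(4) by (simp add: q_def field_simps)
      then have "\<bar>q - \<phi> t\<bar> = \<bar>sqrt (V (J n)) * real (count n (k n)) - \<phi> t * real n\<bar> / real n"
        by (simp add: abs_divide)
      also have "\<dots> \<le> 3 * \<epsilon>1" using elim by (simp add: field_simps)
      finally have q: "\<bar>q - \<phi> t\<bar> \<le> 3 * \<epsilon>1" .
      have vq: "v n * real (count n (k n)) / real n = q * r n" using elim(3) by (simp add: q_def r_def)
      have "\<bar>q * r n - \<phi> t\<bar> = \<bar>(q - \<phi> t) * r n + \<phi> t * (r n - 1)\<bar>" by (simp add: algebra_simps)
      also have "\<dots> \<le> \<bar>q - \<phi> t\<bar> * \<bar>r n\<bar> + \<phi> t * \<bar>r n - 1\<bar>"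
        using \<phi>1 by (intro order.trans[OF abs_triangle_ineq]) (simp add: abs_mult)
      also have "\<dots> \<le> 3 * \<epsilon>1 * 2 + 1 * \<bar>r n - 1\<bar>"
        using q \<phi>1 elim(1) \<epsilon>1 by (intro add_mono mult_mono) auto
      also have "\<dots> < \<epsilon>" using elim(1) by (simp add: \<epsilon>1_def)
      finally show ?case unfolding vq .
    qed
  qed
  then show ?thesis unfolding \<phi>_def by (intro tendstoI) (simp add: dist_real_def)
qed

end

theorem theorem1p13:
  fixes \<alpha> \<beta> :: real and m :: "nat \<Rightarrow> int"
  assumes "bounded_type \<alpha>"
    and "\<beta> = 2 * \<alpha> - 1"
    and "is_even_cfrac m \<beta>"
  shows "\<exists>(\<nu> :: nat \<Rightarrow> nat) (A :: nat \<Rightarrow> real) (B :: nat \<Rightarrow> real).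
      mono \<nu> \<and>
      (\<exists>K. \<forall>n. \<nu> (Suc n) \<le> \<nu> n + K) \<and>
      same_order (\<lambda>n. real (\<nu> n)) (\<lambda>n. ln (real n)) \<and>
      A \<in> O(\<lambda>n. ln (real n)) \<and>
      (\<forall>n. A n = 1 / 4 * real_of_int (\<Sum>j = 1..\<nu> n. sgn (m (2 * j)) - sgn (m (2 * j - 1)))) \<and>
      (\<forall>n. B n > 0) \<and>
      same_order B (\<lambda>n. sqrt (ln (real n))) \<and>
      (\<forall>(\<xi> :: nat \<Rightarrow> real) (t :: real).
        (\<forall>n. \<exists>k :: int. \<xi> n = real_of_int k / 2) \<longrightarrow>
        (\<lambda>n. (\<xi> n - A n) / B n) \<longlonglongrightarrow> t \<longrightarrow>
        (\<lambda>n. real (card {N. 1 \<le> N \<and> N \<le> n \<and> discrepancy N \<alpha> = \<xi> n}))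
          \<sim>[at_top]
        (\<lambda>n. real n * exp (- t\<^sup>2 / 2) / sqrt (8 * pi * (B n)\<^sup>2)))"
proof -
  obtain x \<delta> where \<delta>: "\<delta> > 0" and \<beta>0: "\<beta> = 2 * of_int (m 0) + x 0"
    and x: "\<And>k. 1 / x k = 2 * of_int (m (Suc k)) + x (Suc k) \<and> x k \<notin> \<rat> \<and> \<delta> \<le> \<bar>x k\<bar> \<and> \<bar>x k\<bar> \<le> 1 - \<delta>"
    using even_cfrac_bounds[OF assms] by blast
  interpret even_digits x "\<lambda>k. m (Suc k)" \<delta>
    by standard (use x \<delta> in auto)
  obtain V e C c where C: "0 < C" and c: "0 < c" and V1: "\<And>J. \<bar>V (Suc J) - V J\<bar> \<le> C"
    and Vc: "\<forall>\<^sub>F J in sequentially. c * real J \<le> V J" and e: "e \<longlonglongrightarrow> 0"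
    and llt: "\<forall>\<^sub>F J in sequentially. \<forall>s y.
        \<bar>sqrt (V J) * real (tree.cnt J s y) / real (tree.wt J s) - std_normal_density ((of_int y - tree.center J) / sqrt (V J))\<bar> \<le> e J"
    using tree.local_limit by blast
  \<comment> \<open>The cutoff at 1 keeps \<open>B n\<close> positive for every \<open>n\<close>; it
    is inactive for large \<open>n\<close>, as \<open>V\<close> tends to infinity.\<close>
  define v where "v n = sqrt (max 1 (V (2 * \<nu> n)))" for n
  \<comment> \<open>Everything so far concerns twice the discrepancy, hence the halves here and in
    \<open>A\<close>.\<close>
  define B where "B n = v n / 2" for n
  define A where "A n = tree.center (2 * \<nu> n) / 2" for n
  have v1: "1 \<le> v n" for n by (simp add: v_def)
  obtain c1 c2 where c1: "c1 > 0" and nu: "\<forall>\<^sub>F n in sequentially. 0 < ln (real n) \<and> c1 * ln (real n) \<le> real (\<nu> n) \<and> real (\<nu> n) \<le> c2 * ln (real n)"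
    using \<nu>_ln by blast
  have AO: "A \<in> O(\<lambda>n. ln (real n))"
  proof (rule bigoI)
    show "\<forall>\<^sub>F n in sequentially. norm (A n) \<le> c2 / 2 * norm (ln (real n))"
      using nu
    proof eventually_elim
      case (elim n)
      have "\<bar>tree.center (2 * \<nu> n)\<bar> \<le> real (2 * \<nu> n) / 2"
        using center_diff[of "2 * \<nu> n" 0] by (simp add: tree.center_def)
      then show ?case using elim by (simp add: A_def)
    qed
  qed
  have A_eq: "A n = 1 / 4 * real_of_int (\<Sum>j = 1..\<nu> n. sgn (m (2 * j)) - sgn (m (2 * j - 1)))" for n
    unfolding A_def center_even[of m, OF refl] by simp
  have B_order: "same_order B (\<lambda>n. sqrt (ln (real n)))"
  proof (rule same_orderI)
    define c3 where "c3 = \<bar>V 0\<bar> + 1 + 2 * C * c2"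
    show "0 < sqrt (2 * c * c1) / 2" using c c1 by simp
    have "filterlim (\<lambda>n. 2 * \<nu> n) at_top sequentially"
      by (rule filterlim_at_top_mono[OF filterlim_\<nu>]) auto
    then have "\<forall>\<^sub>F n in sequentially. c * real (2 * \<nu> n) \<le> V (2 * \<nu> n)"
      by (rule filterlim_iff[THEN iffD1, rule_format, OF _ Vc])
    moreover have "\<forall>\<^sub>F n in sequentially. 1 \<le> ln (real n)" by real_asymp
    ultimately show "\<forall>\<^sub>F n in sequentially. 0 < sqrt (ln (real n)) \<and> sqrt (2 * c * c1) / 2 * sqrt (ln (real n)) \<le> B n \<and> B n \<le> sqrt c3 / 2 * sqrt (ln (real n))"
      using nu
    proof eventually_elim
      case (elim n)
      have "2 * c * (c1 * ln (real n)) \<le> 2 * c * real (\<nu> n)" using elim c by (intro mult_left_mono) auto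
      then have "2 * c * c1 * ln (real n) \<le> max 1 (V (2 * \<nu> n))" using elim by (simp add: mult_ac)
      then have low: "sqrt (2 * c * c1) * sqrt (ln (real n)) \<le> v n"
        unfolding v_def real_sqrt_mult[symmetric] by (rule real_sqrt_le_mono)
      have "V (2 * \<nu> n) \<le> \<bar>V 0\<bar> + 2 * C * real (\<nu> n)"
        using bounded_increments[of V C "2 * \<nu> n" 0, OF V1] by simp
      also have "\<dots> \<le> \<bar>V 0\<bar> * ln (real n) + 2 * C * (c2 * ln (real n))"
        using elim C mult_left_mono[of 1 "ln (real n)" "\<bar>V 0\<bar>"] by (intro add_mono mult_left_mono) auto
      also have "\<dots> \<le> c3 * ln (real n)" using elim by (simp add: c3_def algebra_simps)
      finally have up: "V (2 * \<nu> n) \<le> c3 * ln (real n)" .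
      have "1 \<le> c3 * ln (real n)"
      proof -
        have "0 \<le> c1 * ln (real n)" using elim c1 by simp
        then have "0 \<le> c2 * ln (real n)" using elim by linarith
        then have "0 \<le> c2" using elim by (simp add: zero_le_mult_iff)
        then have "1 * 1 \<le> c3 * ln (real n)" using elim C by (intro mult_mono) (auto simp: c3_def)
        then show ?thesis by simp
      qed
      with up have "v n \<le> sqrt c3 * sqrt (ln (real n))"
        unfolding v_def real_sqrt_mult[symmetric] by (intro real_sqrt_le_mono) simp
      with low show ?case using elim by (simp add: B_def)
    qed
  qed
  have lim: "(\<lambda>n. real (card {N. 1 \<le> N \<and> N \<le> n \<and> discrepancy N \<alpha> = \<xi> n})) \<sim>[at_top]
        (\<lambda>n. real n * exp (- t\<^sup>2 / 2) / sqrt (8 * pi * (B n)\<^sup>2))"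
    if \<xi>: "\<forall>n. \<exists>k :: int. \<xi> n = real_of_int k / 2" and t: "(\<lambda>n. (\<xi> n - A n) / B n) \<longlonglongrightarrow> t" for \<xi> t
  proof -
    obtain k where k: "\<And>n. \<xi> n = real_of_int (k n) / 2" using \<xi> by metis
    have "2 * \<alpha> - 1 = 2 * of_int (m 0) + x 0" using \<beta>0 assms(2) by simp
    note disc = discrepancy_eq[OF this]
    have count: "card {N. 1 \<le> N \<and> N \<le> n \<and> discrepancy N \<alpha> = \<xi> n} = count n (k n)" for n
    proof -
      have "discrepancy (Suc u) \<alpha> = \<xi> n \<longleftrightarrow> 1 + altern_sum (x 0) u = k n" for u
      proof -
        have "discrepancy (Suc u) \<alpha> = \<xi> n \<longleftrightarrow> 1 + real_of_int (altern_sum (x 0) u) = real_of_int (k n)"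
          using disc[of u] k[of n] by linarith
        then show ?thesis by linarith
      qed
      then have "{N. 1 \<le> N \<and> N \<le> n \<and> discrepancy N \<alpha> = \<xi> n} = Suc ` {u. u < n \<and> 1 + altern_sum (x 0) u = k n}"
        by (auto simp: image_iff Suc_le_eq gr0_conv_Suc)
      then show ?thesis by (simp add: count_def card_image)
    qed
    have "(\<lambda>n. v n * real (count n (k n)) / real n) \<longlonglongrightarrow> std_normal_density t"
    proof (rule count_limit[OF C c V1 Vc e llt v_def])
      have "(\<xi> n - A n) / B n = (of_int (k n) - tree.center (2 * \<nu> n)) / v n" for n
        using v1[of n] by (simp add: k A_def B_def field_simps)
      then show "(\<lambda>n. (of_int (k n) - tree.center (2 * \<nu> n)) / v n) \<longlonglongrightarrow> t" using t by simp
    qed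
    moreover have nz: "std_normal_density t \<noteq> 0" using normal_density_pos[of 1 0 t] by simp
    ultimately have "(\<lambda>n. v n * real (count n (k n)) / real n / std_normal_density t) \<longlonglongrightarrow> std_normal_density t / std_normal_density t"
      by (intro tendsto_intros nz)
    then have L: "(\<lambda>n. v n * real (count n (k n)) / real n / std_normal_density t) \<longlonglongrightarrow> 1"
      using nz by simp
    show ?thesis
      unfolding count
    proof (rule asymp_equivI')
      show "(\<lambda>n. real (count n (k n)) / (real n * exp (- t\<^sup>2 / 2) / sqrt (8 * pi * (B n)\<^sup>2))) \<longlonglongrightarrow> 1"
      proof (rule Lim_transform_eventually[OF L])
        show "\<forall>\<^sub>F n in sequentially. v n * real (count n (k n)) / real n / std_normal_density t =
          real (count n (k n)) / (real n * exp (- t\<^sup>2 / 2) / sqrt (8 * pi * (B n)\<^sup>2))"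
        proof (intro always_eventually allI)
          fix n
          have "8 * pi * (B n)\<^sup>2 = 2 * pi * (v n)\<^sup>2" by (simp add: B_def power_divide)
          then have "sqrt (8 * pi * (B n)\<^sup>2) = sqrt (2 * pi * (v n)\<^sup>2)" by (simp only:)
          also have "\<dots> = sqrt (2 * pi) * v n" using v1[of n] by (simp add: real_sqrt_mult)
          finally show "v n * real (count n (k n)) / real n / std_normal_density t =
            real (count n (k n)) / (real n * exp (- t\<^sup>2 / 2) / sqrt (8 * pi * (B n)\<^sup>2))"
            by (simp add: std_normal_density_def)
        qed
      qed
    qed
  qed
  have "same_order (\<lambda>n. real (\<nu> n)) (\<lambda>n. ln (real n))"
    by (rule same_orderI[OF c1 nu])
  moreover have "B n > 0" for n using v1[of n] by (simp add: B_def)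
  ultimately show ?thesis
    using mono_\<nu> \<nu>_jump AO A_eq B_order lim by (intro exI[of _ \<nu>] exI[of _ A] exI[of _ B]) blast
qed

end
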